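(* Let $\mathbb{K}$ be a field, let $n\geq 1$, let $A \in \mathrm{M}_n(\mathbb{K})$ and let $\alpha,\beta \in \mathbb{K}\setminus\{0\}$ be such that $\alpha \neq \beta$ and $\alpha\neq-\beta$. Then $A$ is an $(\alpha,\beta)$-composite (in $\mathrm{M}_n(\mathbb{K})$) if and only if all the following conditions hold: (i) The sequences $(n_k(A,0))_{k \geq 1}$ and $(n_k(A,\alpha+\beta))_{k \geq 1}$ are intertwined. (ii) The sequences $(n_k(A,\alpha))_{k \geq 1}$ and $(n_k(A,\beta))_{k \geq 1}$ are intertwined. (iii) For every $\lambda \in \overline{\mathbb{K}} \setminus \{0,\alpha,\beta,\alpha+\beta\}$ and every integer $k \geq 1$, $j_k(A,\lambda)=j_k(A,\alpha+\beta-\lambda)$. (iv) If in addition the characteristic of $\mathbb{K}$ is not $2$, then for every integer $k\geq 0$, $j_{2k+1}\bigl(A,\frac{\alpha+\beta}{2}\bigr)=0$.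
   Context: $\overline{\mathbb{K}}$ is an algebraic closure of $\mathbb{K}$. For scalars $a,b \in \mathbb{K}\setminus\{0\}$, an element $x$ of a $\mathbb{K}$-algebra $\mathcal{A}$ is an $(a,b)$-composite if there are idempotents $p,q \in \mathcal{A}$ (i.e. $p^2=p$, $q^2=q$) with $x = a p + b q$. For $A \in \mathrm{M}_n(\mathbb{K})$, $\lambda\in\overline{\mathbb{K}}$ and an integer $k\geq 1$, $n_k(A,\lambda) := \dim \operatorname{Ker}(A-\lambda I_n)^k - \dim\operatorname{Ker}(A-\lambda I_n)^{k-1}$ (dimensions over $\overline{\mathbb{K}}$), i.e. the number of Jordan blocks of size at least $k$ for $\lambda$ in the Jordan reduction of $A$ over $\overline{\mathbb{K}}$ (zero if $\lambda$ is not an eigenvalue); $j_k(A,\lambda)$ is the number of Jordan blocks of size exactly $k$ for $\lambda$ in that Jordan reduction. Two sequences $(u_k)_{k\geq 1}$ and $(v_k)_{k\geq 1}$ are intertwined if for all $k \geq 1$: $v_{k+1} \leq u_k$ and $u_{k+1} \leq v_k$. *)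

theory Defs
  imports
    "HOL-Algebra.Algebraic_Closure_Type"
    "Jordan_Normal_Form.Jordan_Normal_Form_Uniqueness"
begin

definition composite :: "nat \<Rightarrow> 'a :: field \<Rightarrow> 'a \<Rightarrow> 'a mat \<Rightarrow> bool" where
  "composite n a b A \<longleftrightarrow>
     (\<exists>P \<in> carrier_mat n n. \<exists>Q \<in> carrier_mat n n.
        P * P = P \<and> Q * Q = Q \<and> A = a \<cdot>\<^sub>m P + b \<cdot>\<^sub>m Q)"

text \<open>The dimension of the kernel of the \<open>k\<close>-th power of \<open>A - \<mu> I\<close> over the algebraic closure
  is nondecreasing in \<open>k\<close>, so the truncated subtraction agrees with the one on integers for \<open>k \<ge> 1\<close>.
  The value at \<open>k = 0\<close> has no meaning. Lemma \<open>num_blocks_ge_jordan_nf\<close> below says that this is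
  the number of Jordan blocks of size at least \<open>k\<close>.\<close>

definition num_blocks_ge :: "'a :: field mat \<Rightarrow> 'a alg_closure \<Rightarrow> nat \<Rightarrow> nat" where
  "num_blocks_ge A \<mu> k =
     dim_gen_eigenspace (map_mat to_ac A) \<mu> k - dim_gen_eigenspace (map_mat to_ac A) \<mu> (k - 1)"

text \<open>\<^const>\<open>jordan_nf\<close> relates a matrix to the lists of (block size, eigenvalue) pairs of its Jordan
  reductions. Such a list exists for every square matrix over an algebraically closed field;
  by lemma \<open>num_blocks_eq_jordan_nf\<close> below, the result does not depend on which one is chosen.\<close>

definition num_blocks_eq :: "'a :: field mat \<Rightarrow> 'a alg_closure \<Rightarrow> nat \<Rightarrow> nat" where
  "num_blocks_eq A \<mu> k = count_list (SOME n_as. jordan_nf (map_mat to_ac A) n_as) (k, \<mu>)"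

lemma num_blocks_eq_jordan_nf:
  assumes "jordan_nf (map_mat to_ac A) n_as"
  shows "num_blocks_eq A \<mu> k = count_list n_as (k, \<mu>)"
proof -
  let ?m = "SOME n_as. jordan_nf (map_mat to_ac A) n_as"
  have m: "jordan_nf (map_mat to_ac A) ?m"
    using assms by (rule someI)
  have count: "count_list xs y = length (filter ((=) y) xs)" for xs and y :: "nat \<times> 'a alg_closure"
    by (induction xs) auto
  have "count_list ?m (k, \<mu>) = count_list n_as (k, \<mu>)"
  proof (cases "k = 0")
    case True
    then have "(k, \<mu>) \<notin> set ?m" "(k, \<mu>) \<notin> set n_as"
      using m assms by (force simp: jordan_nf_def)+
    then show ?thesis
      by (simp add: count_notin)
  next
    case False
    show ?thesis
      unfolding count compute_nr_of_jordan_blocks[OF m False, symmetric]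
        compute_nr_of_jordan_blocks[OF assms False, symmetric] ..
  qed
  then show ?thesis
    by (simp add: num_blocks_eq_def)
qed

lemma num_blocks_ge_jordan_nf:
  assumes "jordan_nf (map_mat to_ac A) n_as" and "k \<ge> 1"
  shows "num_blocks_ge A \<mu> k = length (filter (\<lambda>(m, x). m \<ge> k \<and> x = \<mu>) n_as)"
proof -
  have "(\<Sum>n\<leftarrow>map fst [(n, e)\<leftarrow>n_as . e = \<mu>]. min k n) =
      (\<Sum>n\<leftarrow>map fst [(n, e)\<leftarrow>n_as . e = \<mu>]. min (k - 1) n) +
      length (filter (\<lambda>(m, x). m \<ge> k \<and> x = \<mu>) n_as)"
    using assms(2) by (induction n_as) auto
  then show ?thesis
    by (simp add: num_blocks_ge_def dim_gen_eigenspace[OF assms(1)])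
qed

text \<open>Sequences are indexed by the positive integers; the value at \<open>0\<close> plays no role.\<close>

definition intertwined :: "(nat \<Rightarrow> nat) \<Rightarrow> (nat \<Rightarrow> nat) \<Rightarrow> bool" where
  "intertwined u v \<longleftrightarrow> (\<forall>k\<ge>1. v (k + 1) \<le> u k \<and> u (k + 1) \<le> v k)"

end

theory Submission
  imports Defs "Jordan_Normal_Form.DL_Rank" "Jordan_Normal_Form.Jordan_Normal_Form_Existence"
begin

text \<open>
  Write \<open>s = \<alpha> + \<beta>\<close>. Conditions on Jordan blocks are treated throughout as statements about ranks of powers
  of \<open>A - \<mu>\<close> over the algebraic closure: the number of blocks of size at least \<open>k\<close> is the drop of
  rank between the powers \<open>k - 1\<close> and \<open>k\<close>. The predicate \<open>balanced\<close> collects the four conditions in this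
  form, and \<open>blocks_conditions_iff_balanced\<close> is the translation; it needs the existence of Jordan
  normal forms over an algebraically closed field.

  Necessity. Let \<open>A = \<alpha>P + \<beta>Q\<close> with idempotents \<open>P\<close> and \<open>Q\<close>, and put \<open>D = P - Q\<close> and \<open>K = PQ - QP\<close>. Then
  \<open>K A = (s - A) K\<close>, so \<open>K\<close> maps the generalized eigenspace of \<open>\<mu>\<close> into that of \<open>s - \<mu>\<close>, and
  \<open>K\<^sup>2 = A (A - s) (A - \<alpha>) (A - \<beta>) / (\<alpha>\<beta>)\<^sup>2\<close>. Away from the four roots of the right-hand side, \<open>K\<close> is an
  isomorphism between these spaces, which gives the symmetry of the block numbers. At the roots,
  which the assumptions on \<open>\<alpha>\<close> and \<open>\<beta>\<close> make simple, the round trip through the reflected eigenvalue loses one power of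
  the linear factor, which gives the intertwining. The centre \<open>s / 2\<close> is its own reflection and
  needs another relation: for \<open>N = A - s / 2\<close> one has \<open>D N + N D = (\<alpha> - \<beta>) D\<^sup>2\<close>, so \<open>D\<close> commutes with \<open>N\<^sup>2\<close>,
  and on the kernel of \<open>N\<close> the square \<open>D\<^sup>2\<close> is a nonzero scalar; this excludes blocks of odd size. The
  inequality of ranks behind all three arguments is \<open>matrix_rank_loss_mono\<close>.

  Sufficiency. The matrix \<open>A\<close> is decomposed by induction into cyclic summands \<open>K[X]/\<mu>\<close>, where \<open>\<mu>\<close> is each
  time the minimal polynomial of what is left (\<open>cyclic_summand\<close>). Such a summand contains exactly one
  Jordan block of the largest size for each eigenvalue, and removing one largest block everywhere
  preserves the conditions (\<open>balanced_remove\<close>). The conditions also say which polynomials \<open>\<mu>\<close> can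
  occur: \<open>\<mu> = h g\<close>, where \<open>g\<close> is invariant under \<open>X \<mapsto> s - X\<close> and \<open>h\<close> divides \<open>(X - r) (X - \<rho>)\<close> with
  \<open>r\<close> one of \<open>0, s\<close> and \<open>\<rho>\<close> one of \<open>\<alpha>, \<beta>\<close> (\<open>composite_mod_if_orders\<close>). For \<open>r = 0\<close> and \<open>\<rho> = \<alpha>\<close>, and
  with the divided difference \<open>\<partial>f = (f - f(s - X)) / (2X - s)\<close>, the formulas
  \<open>Q f = X (X - \<alpha>) \<partial>f / \<beta>\<close> and \<open>P f = X (f - (X - \<alpha>) \<partial>f) / \<alpha>\<close> define idempotent maps on \<open>K[X]/\<mu>\<close>
  with \<open>\<alpha>P + \<beta>Q = X\<close> (\<open>composite_mod_base\<close>); the other choices of the roots follow by symmetry. These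
  formulas are uniform in the field and its characteristic, and they avoid a descent of idempotents from the
  closure to \<open>K\<close>.
\<close>

section \<open>Ranks of matrices\<close>

hide_const (open) Coset.order

text \<open>The dimension of the image, stated through a subspace of the codomain because the arguments below
  compare images and the parts of them that a further map kills.\<close>
definition matrix_rank :: "'a::field mat \<Rightarrow> nat" where
  "matrix_rank M = vectorspace.dim class_ring
     ((module_vec TYPE('a) (dim_row M))\<lparr>carrier := {M *\<^sub>v x | x. x \<in> carrier_vec (dim_col M)}\<rparr>)"

lemma (in vec_space) subspace_vecI:
  assumes "W \<subseteq> carrier_vec n" "0\<^sub>v n \<in> W"
    "\<And>x y. x \<in> W \<Longrightarrow> y \<in> W \<Longrightarrow> x + y \<in> W" "\<And>c x. x \<in> W \<Longrightarrow> c \<cdot>\<^sub>v x \<in> W"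
  shows "subspace class_ring W V"
  unfolding subspace_def submodule_def using assms vec_vs module_axioms  by auto

lemma (in vec_space) fin_dim_subspace:
  assumes "subspace class_ring W V"
  shows "vectorspace.fin_dim class_ring (vs W)"
proof -
  interpret W: vectorspace class_ring "vs W" using assms by (rule subspace_is_vs)
  have sub: "submodule class_ring W V" using assms by auto
  have Wc: "W \<subseteq> carrier_vec n" using sub by (auto simp: submodule_def)
  have li: "finite S \<and> card S \<le> dim" if "S \<subseteq> carrier (vs W) \<and> W.lin_indpt S" for S
  proof -
    have "S \<subseteq> W" "lin_indpt S" using that span_li_not_depend(2)[OF _ sub, of S] by auto
    then show ?thesis using li_le_dim[OF fin_dim, of S] Wc by auto
  qed
  have "W.lin_indpt {}" by (simp add: W.lin_dep_def)
  from maximal_exists[of "\<lambda>S. S \<subseteq> carrier (vs W) \<and> W.lin_indpt S", OF li] this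
  obtain S where "finite S" "maximal S (\<lambda>S. S \<subseteq> carrier (vs W) \<and> W.lin_indpt S)" by blast
  then show ?thesis unfolding W.fin_dim_def using W.max_li_is_gen[of S]
    by (auto simp: maximal_def)
qed

lemma (in vec_space) subspace_dim_mono:
  assumes "subspace class_ring U V" "subspace class_ring W V" "U \<subseteq> W"
  shows "vectorspace.dim class_ring (vs U) \<le> vectorspace.dim class_ring (vs W)"
proof -
  interpret W: vectorspace class_ring "vs W" using assms(2) by (rule subspace_is_vs)
  have "subspace class_ring U (vs W)" using nested_subspaces assms by blast
  from W.subspace_dim[OF this] fin_dim_subspace[OF assms(1)] fin_dim_subspace[OF assms(2)]
  show ?thesis by simp
qed

lemma linear_map_mat:
  fixes M :: "'a::field mat"
  assumes M: "M \<in> carrier_mat m n"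
    and W: "subspace class_ring W (module_vec TYPE('a) n)"
  shows "linear_map class_ring ((module_vec TYPE('a) n)\<lparr>carrier := W\<rparr>) (module_vec TYPE('a) m) (\<lambda>x. M *\<^sub>v x)"
proof -
  interpret N: vec_space "TYPE('a)" n .
  interpret M: vec_space "TYPE('a)" m .
  have "W \<subseteq> carrier_vec n" using W by (auto simp: subspace_def submodule_def)
  then show ?thesis
    unfolding linear_map_def mod_hom_def mod_hom_axioms_def module_hom_def
    using N.subspace_is_vs[OF W] M.vectorspace_axioms M
    by (auto simp: vectorspace_def mult_add_distrib_mat_vec[OF M] mult_mat_vec[OF M] subset_eq)
qed

lemma dim_image_plus_dim_kernel:
  fixes M :: "'a::field mat"
  assumes M: "M \<in> carrier_mat m n"
    and W: "subspace class_ring W (module_vec TYPE('a) n)"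
  shows "vectorspace.dim class_ring ((module_vec TYPE('a) m)\<lparr>carrier := {M *\<^sub>v x | x. x \<in> W}\<rparr>)
     + vectorspace.dim class_ring ((module_vec TYPE('a) n)\<lparr>carrier := {x \<in> W. M *\<^sub>v x = 0\<^sub>v m}\<rparr>)
     = vectorspace.dim class_ring ((module_vec TYPE('a) n)\<lparr>carrier := W\<rparr>)"
proof -
  interpret N: vec_space "TYPE('a)" n .
  interpret linear_map class_ring "N.vs W" "module_vec TYPE('a) m" "\<lambda>x. M *\<^sub>v x" by (rule linear_map_mat[OF M W])
  show ?thesis using rank_nullity[OF N.fin_dim_subspace[OF W]]
    by (simp add: im_def ker_def image_def Collect_conj_eq Setcompr_eq_image module_vec_simps)
qed

lemma subspace_image_mat:
  fixes M :: "'a::field mat"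
  assumes M: "M \<in> carrier_mat m n"
  shows "subspace class_ring {M *\<^sub>v x | x. x \<in> carrier_vec n} (module_vec TYPE('a) m)"
proof -
  interpret N: vec_space "TYPE('a)" n .
  have W: "subspace class_ring (carrier_vec n) N.V" by (rule N.subspace_vecI) auto
  interpret linear_map class_ring "N.vs (carrier_vec n)" "module_vec TYPE('a) m" "\<lambda>x. M *\<^sub>v x" by (rule linear_map_mat[OF M W])
  show ?thesis using imT_is_subspace by (simp add: im_def Setcompr_eq_image)
qed

lemma matrix_rank_eq_diff_kernel_on_image:
  fixes f M :: "'a::field mat"
  assumes f: "f \<in> carrier_mat l n" and M: "M \<in> carrier_mat n m"
  shows "matrix_rank M = matrix_rank (f * M) + vectorspace.dim class_ring ((module_vec TYPE('a) n)
     \<lparr>carrier := {v \<in> {M *\<^sub>v x | x. x \<in> carrier_vec m}. f *\<^sub>v v = 0\<^sub>v l}\<rparr>)"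
proof -
  have im: "{f *\<^sub>v y | y. y \<in> {M *\<^sub>v x | x. x \<in> carrier_vec m}} = {f * M *\<^sub>v x | x. x \<in> carrier_vec m}"
  proof -
    have "f *\<^sub>v (M *\<^sub>v x) = f * M *\<^sub>v x" if "x \<in> carrier_vec m" for x
      using assoc_mult_mat_vec[OF f M that] by simp
    then have "(\<lambda>x. f *\<^sub>v (M *\<^sub>v x)) ` carrier_vec m = (\<lambda>x. f * M *\<^sub>v x) ` carrier_vec m"
      by (rule image_cong[OF refl])
    then show ?thesis by (simp add: Setcompr_eq_image image_image)
  qed
  show ?thesis
    using dim_image_plus_dim_kernel[OF f subspace_image_mat[OF M]] f M
    unfolding im matrix_rank_def by simp
qed

text \<open>By rank and nullity, the rank that \<open>M\<close> loses under \<open>f\<close> is the dimension of that part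
  of its image which \<open>f\<close> kills. Hence the loss can only grow when this part of the image
  grows. The inequalities of the form "one Jordan block count is at most another" are all obtained
  by comparing two such parts.\<close>
lemma matrix_rank_loss_mono:
  fixes f M M' :: "'a::field mat"
  assumes f: "f \<in> carrier_mat l n" and M: "M \<in> carrier_mat n m" and M': "M' \<in> carrier_mat n m'"
    and sub: "\<And>x. x \<in> carrier_vec m \<Longrightarrow> f *\<^sub>v (M *\<^sub>v x) = 0\<^sub>v l \<Longrightarrow>
       \<exists>y \<in> carrier_vec m'. M *\<^sub>v x = M' *\<^sub>v y"
  shows "matrix_rank M + matrix_rank (f * M') \<le> matrix_rank M' + matrix_rank (f * M)"
proof -
  interpret vec_space "TYPE('a)" n .
  let ?k = "\<lambda>M m. {v \<in> {M *\<^sub>v x | x. x \<in> carrier_vec m}. f *\<^sub>v v = 0\<^sub>v l}"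
  have ss: "subspace class_ring (?k M m) V" if M: "M \<in> carrier_mat n m" for M m
  proof -
    note im = subspace_image_mat[OF M]
    interpret linear_map class_ring "vs {M *\<^sub>v x | x. x \<in> carrier_vec m}" "module_vec TYPE('a) l" "\<lambda>x. f *\<^sub>v x"
      by (rule linear_map_mat[OF f im])
    have "ker = ?k M m" by (simp add: ker_def module_vec_simps)
    with kerT_is_subspace im show ?thesis
      by (auto simp: subspace_def submodule_def)
  qed
  have "vectorspace.dim class_ring (vs (?k M m)) \<le> vectorspace.dim class_ring (vs (?k M' m'))"
  proof (rule subspace_dim_mono[OF ss[OF M] ss[OF M']], rule subsetI)
    fix v assume "v \<in> ?k M m"
    then obtain x where "v = M *\<^sub>v x" "x \<in> carrier_vec m" "f *\<^sub>v v = 0\<^sub>v l" by blast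
    with sub[of x] show "v \<in> ?k M' m'" by auto
  qed
  then show ?thesis
    using matrix_rank_eq_diff_kernel_on_image[OF f M] matrix_rank_eq_diff_kernel_on_image[OF f M']
    by linarith
qed

lemma matrix_rank_zero [simp]: "matrix_rank (0\<^sub>m m n :: 'a::field mat) = 0"
proof -
  let ?z = "0\<^sub>m m n :: 'a mat"
  interpret vec_space "TYPE('a)" m .
  have "{?z *\<^sub>v x |x. x \<in> carrier_vec n} = {0\<^sub>v m}"
    by (auto intro!: exI[of _ "0\<^sub>v n"])
  then have "matrix_rank ?z = vectorspace.dim class_ring (vs {0\<^sub>v m})"
    by (simp add: matrix_rank_def)
  also have "\<dots> = 0"
    using dim_zero_vs span_empty by simp
  finally show ?thesis .
qed

lemma matrix_rank_plus_kernel_dim: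
  fixes M :: "'a::field mat"
  assumes M: "M \<in> carrier_mat m n"
  shows "matrix_rank M + kernel_dim M = n"
proof -
  interpret kernel m n M by (rule kernel.intro[OF M])
  have "subspace class_ring (carrier_vec n) NC.V"
    by (rule NC.subspace_vecI) auto
  have "mat_kernel M = {x \<in> carrier_vec n. M *\<^sub>v x = 0\<^sub>v m}" using mat_kernel[OF M] .
  moreover have "vectorspace.dim class_ring (NC.V\<lparr>carrier := carrier_vec n\<rparr>) = n"
    using NC.dim_is_n by (simp add: module_vec_def)
  ultimately show ?thesis
    using dim_image_plus_dim_kernel[OF M \<open>subspace class_ring (carrier_vec n) NC.V\<close>] M NC.dim_is_n
    by (simp add: matrix_rank_def)
qed

lemma matrix_rank_one [simp]: "matrix_rank (1\<^sub>m n :: 'a::field mat) = n"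
  using matrix_rank_plus_kernel_dim[of "1\<^sub>m n :: 'a mat" n n] kernel_one_mat[of n, where 'a='a]
  by (simp add: kernel_dim_def)

text \<open>The image of \<open>G * H\<close> lies in that of \<open>G\<close>, so \<open>F\<close> kills less of it.\<close>
lemma frobenius_rank_inequality:
  fixes F G H :: "'a::field mat"
  assumes "F \<in> carrier_mat a b" "G \<in> carrier_mat b c" "H \<in> carrier_mat c d"
  shows "matrix_rank (F * G) + matrix_rank (G * H) \<le> matrix_rank G + matrix_rank (F * (G * H))"
proof -
  have "matrix_rank (G * H) + matrix_rank (F * G) \<le> matrix_rank G + matrix_rank (F * (G * H))"
  proof (rule matrix_rank_loss_mono[of F a b "G * H" d G c])
    fix x :: "'a vec" assume "x \<in> carrier_vec d"
    then have "G * H *\<^sub>v x = G *\<^sub>v (H *\<^sub>v x)" "H *\<^sub>v x \<in> carrier_vec c"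
      using assms by auto
    then show "\<exists>y\<in>carrier_vec c. G * H *\<^sub>v x = G *\<^sub>v y" by blast
  qed (use assms in auto)
  then show ?thesis by simp
qed

lemma matrix_rank_mult_le_right:
  fixes F G :: "'a::field mat"
  assumes "F \<in> carrier_mat a b" "G \<in> carrier_mat b c"
  shows "matrix_rank (F * G) \<le> matrix_rank G"
  using frobenius_rank_inequality[OF assms, of "0\<^sub>m c c" c] assms by simp

lemma matrix_rank_mult_le_left:
  fixes F G :: "'a::field mat"
  assumes "F \<in> carrier_mat a b" "G \<in> carrier_mat b c"
  shows "matrix_rank (F * G) \<le> matrix_rank F"
  using frobenius_rank_inequality[of "0\<^sub>m a a" a a F b G c] assms by simp

lemma matrix_rank_smult [simp]:
  fixes F :: "'a::field mat"
  assumes c: "c \<noteq> 0"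
  shows "matrix_rank (c \<cdot>\<^sub>m F) = matrix_rank F"
proof -
  have F: "F \<in> carrier_mat (dim_row F) (dim_col F)" by auto
  have le: "matrix_rank (d \<cdot>\<^sub>m G) \<le> matrix_rank G" if "G \<in> carrier_mat (dim_row F) (dim_col F)" for d and G :: "'a mat"
  proof -
    have eq: "(d \<cdot>\<^sub>m 1\<^sub>m (dim_row F)) * G = d \<cdot>\<^sub>m G"
      using mult_smult_assoc_mat[OF one_carrier_mat that] left_mult_one_mat[OF that] by simp
    then show ?thesis
      using matrix_rank_mult_le_right[OF smult_carrier_mat[OF one_carrier_mat] that, of d] by simp
  qed
  have inv: "inverse c \<cdot>\<^sub>m (c \<cdot>\<^sub>m F) = F" using c by (intro eq_matI) auto
  show ?thesis
    using le[of F c, OF F] le[of "c \<cdot>\<^sub>m F" "inverse c", OF smult_carrier_mat[OF F]]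
    unfolding inv by (rule antisym)
qed

text \<open>Orthogonal idempotents that commute with \<open>B\<close> split its image into a direct sum. One inequality is
  Frobenius' with the idempotents at both ends; for the other one, the part of the image of
  \<open>B * (e1 + e2)\<close> that \<open>e1\<close> kills lies in the image of \<open>B * e2\<close>.\<close>
lemma matrix_rank_split_idempotent:
  fixes B e e1 e2 :: "'a::field mat"
  assumes c: "B \<in> carrier_mat n n" "e1 \<in> carrier_mat n n" "e2 \<in> carrier_mat n n"
    and e1: "e1 * e1 = e1" and e2: "e2 * e2 = e2"
    and o: "e1 * e2 = 0\<^sub>m n n" "e2 * e1 = 0\<^sub>m n n"
    and comm: "e1 * B = B * e1" "e2 * B = B * e2"
  shows "matrix_rank (B * (e1 + e2)) = matrix_rank (B * e1) + matrix_rank (B * e2)"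
proof -
  let ?M = "B * (e1 + e2)"
  have M: "?M \<in> carrier_mat n n" using c by auto
  have l: "e * ?M = B * (e * e1 + e * e2)" if "e \<in> carrier_mat n n" "e * B = B * e" for e
  proof -
    have "e * ?M = (e * B) * (e1 + e2)" using c that(1) by (simp add: assoc_mult_mat[of _ n n _ n _ n])
    also have "\<dots> = B * (e * (e1 + e2))" unfolding that(2) by (rule assoc_mult_mat) (use c that in auto)
    finally show ?thesis using c that by (simp add: mult_add_distrib_mat[of _ n n _ n])
  qed
  have l1: "e1 * ?M = B * e1" and l2: "e2 * ?M = B * e2"
    using l[OF c(2) comm(1)] l[OF c(3) comm(2)] e1 e2 o c by simp_all
  have r2: "?M * e2 = B * e2"
    using e2 o c by (simp add: assoc_mult_mat[of _ n n _ n _ n] add_mult_distrib_mat[of _ n n _ _ n])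
  have z: "e1 * (B * e2) = 0\<^sub>m n n"
  proof -
    have "e1 * (B * e2) = (e1 * B) * e2" using c by (simp add: assoc_mult_mat[of _ n n _ n _ n])
    also have "\<dots> = B * (e1 * e2)" unfolding comm using c by (simp add: assoc_mult_mat[of _ n n _ n _ n])
    finally show ?thesis using o c by simp
  qed
  have "matrix_rank (B * e1) + matrix_rank (B * e2) \<le> matrix_rank ?M"
    using frobenius_rank_inequality[of e1 n n ?M n e2 n] c M by (simp add: l1 r2 z)
  moreover have "matrix_rank ?M + matrix_rank (e1 * (B * e2)) \<le> matrix_rank (B * e2) + matrix_rank (e1 * ?M)"
  proof (rule matrix_rank_loss_mono[of e1 n n ?M n "B * e2" n])
    fix x :: "'a vec" assume x: "x \<in> carrier_vec n" and k: "e1 *\<^sub>v (?M *\<^sub>v x) = 0\<^sub>v n"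
    have "?M = e1 * ?M + e2 * ?M" unfolding l1 l2 using c by (simp add: mult_add_distrib_mat[of _ n n _ n])
    then have "?M *\<^sub>v x = (e1 * ?M + e2 * ?M) *\<^sub>v x" by simp
    also have "\<dots> = e1 * ?M *\<^sub>v x + e2 * ?M *\<^sub>v x" using c M x by (intro add_mult_distrib_mat_vec) auto
    also have "e1 * ?M *\<^sub>v x = 0\<^sub>v n" using k c M x by (simp add: assoc_mult_mat_vec[of e1 n n ?M n])
    finally show "\<exists>y\<in>carrier_vec n. ?M *\<^sub>v x = B * e2 *\<^sub>v y" using x c unfolding l2 by (auto intro!: bexI[of _ x])
  qed (use c M in auto)
  ultimately show ?thesis by (simp add: z l1)
qed

section \<open>Polynomials in a matrix\<close>

definition mat_poly :: "'a::field mat \<Rightarrow> 'a poly \<Rightarrow> 'a mat" where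
  "mat_poly A p = fold_coeffs (\<lambda>c M. c \<cdot>\<^sub>m 1\<^sub>m (dim_row A) + A * M) p (0\<^sub>m (dim_row A) (dim_row A))"

lemma mat_poly_0 [simp]: "mat_poly A 0 = 0\<^sub>m (dim_row A) (dim_row A)"
  by (simp add: mat_poly_def)

context
  fixes A :: "'a::field mat" and n :: nat
  assumes A: "A \<in> carrier_mat n n"
begin

private lemma dims [simp]: "dim_row A = n" "dim_col A = n" using A by auto

lemma mat_poly_pCons: "mat_poly A (pCons c p) = c \<cdot>\<^sub>m 1\<^sub>m n + A * mat_poly A p"
proof (cases "c = 0 \<and> p = 0")
  case True
  have "0 \<cdot>\<^sub>m 1\<^sub>m n + A * 0\<^sub>m n n = 0\<^sub>m n n" using A by (intro eq_matI) auto
  then show ?thesis using True A by simp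
next
  case False
  then have "fold_coeffs f (pCons c p) z = f c (fold_coeffs f p z)" for f and z :: "'a mat"
    by (cases "p = 0") (auto simp: fold_coeffs_pCons_coeff_not_0_eq fold_coeffs_pCons_not_0_0_eq)
  then show ?thesis by (simp add: mat_poly_def)
qed

lemma mat_poly_carrier [simp]: "mat_poly A p \<in> carrier_mat n n"
  using A by (induction p) (auto simp: mat_poly_pCons)

private lemma mdims [simp]: "dim_row (mat_poly A p) = n" "dim_col (mat_poly A p) = n"
  using mat_poly_carrier[of p] by (simp_all only: carrier_matD)

lemma mat_poly_1: "mat_poly A 1 = 1\<^sub>m n"
  using A by (simp add: one_pCons mat_poly_pCons right_mult_zero_mat[of _ n n]) (intro eq_matI; simp)

lemma mat_poly_linear: "mat_poly A [:- c, 1:] = char_matrix A c"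
  using A by (simp add: mat_poly_pCons char_matrix_def) (intro eq_matI; simp)

lemma mat_poly_monom_1: "mat_poly A [:0, 1:] = A"
  using A by (simp add: mat_poly_pCons) (intro eq_matI; simp)

lemma mat_poly_add: "mat_poly A (p + q) = mat_poly A p + mat_poly A q"
proof (induction p q rule: poly_induct2)
  case 0
  then show ?case using A by simp
next
  case (pCons a p b q)
  have "mat_poly A (pCons a p + pCons b q) = (a + b) \<cdot>\<^sub>m 1\<^sub>m n + (A * mat_poly A p + A * mat_poly A q)"
    using A by (simp add: mat_poly_pCons pCons.IH mult_add_distrib_mat[of _ n n _ n])
  also have "\<dots> = (a \<cdot>\<^sub>m 1\<^sub>m n + A * mat_poly A p) + (b \<cdot>\<^sub>m 1\<^sub>m n + A * mat_poly A q)"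
    using A by (intro eq_matI) (auto simp: algebra_simps)
  finally show ?case by (simp add: mat_poly_pCons)
qed

lemma mat_poly_smult: "mat_poly A (smult c p) = c \<cdot>\<^sub>m mat_poly A p"
proof (induction p)
  case 0
  then show ?case using A by simp
next
  case (pCons a p)
  have "mat_poly A (smult c (pCons a p)) = (c * a) \<cdot>\<^sub>m 1\<^sub>m n + c \<cdot>\<^sub>m (A * mat_poly A p)"
    using A by (simp add: mat_poly_pCons pCons.IH mult_smult_distrib[of _ n n _ n])
  also have "\<dots> = c \<cdot>\<^sub>m (a \<cdot>\<^sub>m 1\<^sub>m n + A * mat_poly A p)"
    using A by (intro eq_matI) (auto simp: algebra_simps)
  finally show ?case by (simp add: mat_poly_pCons)
qed

lemma mat_poly_mult: "mat_poly A (p * q) = mat_poly A p * mat_poly A q"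
proof (induction p)
  case 0
  then show ?case using A by simp
next
  case (pCons a p)
  have "mat_poly A (pCons a p * q) = mat_poly A (smult a q) + mat_poly A (pCons 0 (p * q))"
    by (simp add: mat_poly_add)
  also have "mat_poly A (pCons 0 (p * q)) = A * (mat_poly A p * mat_poly A q)"
    using A by (simp add: mat_poly_pCons pCons.IH) (intro eq_matI; simp)
  also have "mat_poly A (smult a q) = (a \<cdot>\<^sub>m 1\<^sub>m n) * mat_poly A q"
    using A by (simp add: mat_poly_smult mult_smult_assoc_mat[of _ n n _ n])
  also have "(a \<cdot>\<^sub>m 1\<^sub>m n) * mat_poly A q + A * (mat_poly A p * mat_poly A q) = mat_poly A (pCons a p) * mat_poly A q"
    using A by (simp add: mat_poly_pCons add_mult_distrib_mat[of _ n n _ _ n] assoc_mult_mat[of _ n n _ n _ n])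
  finally show ?case .
qed

lemma mat_poly_power: "mat_poly A (p ^ k) = mat_poly A p ^\<^sub>m k"
proof (induction k)
  case (Suc k)
  have "mat_poly A (p ^ Suc k) = mat_poly A (p ^ k * p)" by (simp add: mult.commute)
  then show ?case by (simp only: mat_poly_mult Suc.IH) simp
qed (simp add: mat_poly_1)

lemma mat_poly_mult_commute: "mat_poly A p * mat_poly A q = mat_poly A q * mat_poly A p"
  by (metis mat_poly_mult mult.commute)

end

text \<open>An intertwiner of two matrices intertwines all polynomials in them. This covers the commutation of
  \<open>A\<close> with idempotents, the reflection of eigenvalues, and the passage to a cyclic subspace.\<close>
lemma mat_poly_intertwine:
  assumes A: "A \<in> carrier_mat n n" and K: "K \<in> carrier_mat m n" and A': "A' \<in> carrier_mat m m"
    and KA: "K * A = A' * K"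
  shows "K * mat_poly A p = mat_poly A' p * K"
proof (induction p)
  case 0
  then show ?case using A A' K by simp
next
  case (pCons a p)
  note c = mat_poly_carrier[OF A] mat_poly_carrier[OF A']
  have "K * mat_poly A (pCons a p) = K * (a \<cdot>\<^sub>m 1\<^sub>m n) + K * (A * mat_poly A p)"
    using A K c by (simp add: mat_poly_pCons[OF A] mult_add_distrib_mat[of _ m n _ n])
  also have "K * (A * mat_poly A p) = A' * (K * mat_poly A p)"
  proof -
    have "K * (A * mat_poly A p) = (K * A) * mat_poly A p" by (rule assoc_mult_mat[OF K A c(1), symmetric])
    also have "\<dots> = A' * (K * mat_poly A p)" unfolding KA by (rule assoc_mult_mat[OF A' K c(1)])
    finally show ?thesis .
  qed
  also have "K * (a \<cdot>\<^sub>m 1\<^sub>m n) = (a \<cdot>\<^sub>m 1\<^sub>m m) * K"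
    using K by (simp add: mult_smult_distrib[of _ m n _ n] mult_smult_assoc_mat[of _ m m _ n])
  also have "(a \<cdot>\<^sub>m 1\<^sub>m m) * K + A' * (K * mat_poly A p) = mat_poly A' (pCons a p) * K"
    using A' K c by (simp add: pCons.IH mat_poly_pCons[OF A'] add_mult_distrib_mat[of _ m m _ _ n]
      assoc_mult_mat[of _ m m _ m _ n])
  finally show ?case .
qed

lemma mat_poly_pcompose:
  assumes A: "A \<in> carrier_mat n n"
  shows "mat_poly A (pcompose p q) = mat_poly (mat_poly A q) p"
proof (induction p)
  case 0
  then show ?case using A mat_poly_carrier[OF A, of q] by simp
next
  case (pCons a p)
  then show ?case
    using A by (simp add: pcompose_pCons mat_poly_add[OF A] mat_poly_mult[OF A] mat_poly_pCons[OF mat_poly_carrier[OF A]]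
       mat_poly_pCons[OF A, of a 0])
qed

lemma (in field_hom) mat_poly_hom:
  assumes A: "A \<in> carrier_mat n n"
  shows "mat_poly (mat\<^sub>h A) (map_poly hom p) = mat\<^sub>h (mat_poly A p)"
proof (induction p)
  case 0
  then show ?case using A by (auto intro!: eq_matI)
next
  case (pCons a p)
  have c: "mat\<^sub>h A \<in> carrier_mat n n" using A by auto
  show ?case
    using A c pCons mat_poly_carrier[OF A, of p] mat_hom_mult[OF A mat_poly_carrier[OF A, of p], symmetric]
    by (simp add: mat_poly_pCons[OF A] mat_poly_pCons[OF c]) (intro eq_matI; simp add: hom_distribs)
qed

text \<open>Linear functionals of polynomials are determined by their values on the monomials; this is
  how identities between matrices built from coefficients are reduced to polynomial arithmetic.\<close>
lemma poly_functional_expand: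
  fixes \<phi> :: "'a::comm_ring_1 poly \<Rightarrow> 'a"
  assumes add: "\<And>p q. \<phi> (p + q) = \<phi> p + \<phi> q" and smult: "\<And>c p. \<phi> (smult c p) = c * \<phi> p"
    and deg: "p = 0 \<or> degree p < d"
  shows "\<phi> p = (\<Sum>i<d. coeff p i * \<phi> (monom 1 i))"
proof -
  have zero: "\<phi> 0 = 0" using smult[of 0 0] by simp
  have p: "p = (\<Sum>i<d. smult (coeff p i) (monom 1 i))"
    using deg by (intro poly_eqI) (auto simp: coeff_sum coeff_eq_0 if_distrib cong: if_cong)
  have "\<phi> (\<Sum>i\<in>S. smult (coeff p i) (monom 1 i)) = (\<Sum>i\<in>S. coeff p i * \<phi> (monom 1 i))" for S
    by (induction S rule: infinite_finite_induct) (simp_all add: zero add smult)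
  then show ?thesis using p by metis
qed

section \<open>Pairs of idempotents and reflected eigenvalues\<close>

text \<open>Everything that the decomposition \<open>A = \<alpha>P + \<beta>Q\<close> imposes on the spectrum of \<open>A\<close> is contained in four
  identities for the difference \<open>D\<close> and the commutator \<open>K\<close> of the two idempotents. All of them
  follow by expanding both sides into words in which \<open>P\<close> and \<open>Q\<close> alternate.\<close>
locale idempotent_pair =
  fixes n :: nat and P Q :: "'a::field mat" and \<alpha> \<beta> :: 'a
  assumes P: "P \<in> carrier_mat n n" and Q: "Q \<in> carrier_mat n n"
    and PP: "P * P = P" and QQ: "Q * Q = Q"
begin

definition "A = \<alpha> \<cdot>\<^sub>m P + \<beta> \<cdot>\<^sub>m Q"
definition "K = P * Q - Q * P"
definition "D = P - Q"

lemma carriers: "A \<in> carrier_mat n n" "K \<in> carrier_mat n n" "D \<in> carrier_mat n n"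
  using P Q by (auto simp: A_def K_def D_def)

lemma idempotent_left: "M \<in> carrier_mat n n \<Longrightarrow> P * (P * M) = P * M" "M \<in> carrier_mat n n \<Longrightarrow> Q * (Q * M) = Q * M"
  using P Q PP QQ by (metis assoc_mult_mat)+

lemmas expand = minus_carrier_mat mult_carrier_mat[of _ n n _ n] mult_add_distrib_mat[of _ n n _ n] add_mult_distrib_mat[of _ n n _ _ n]
  mult_minus_distrib_mat[of _ n n _ n] minus_mult_distrib_mat[of _ n n _ _ n]
  mult_smult_distrib[of _ n n _ n] mult_smult_assoc_mat[of _ n n _ n] assoc_mult_mat[of _ n n _ n _ n]
  idempotent_left PP QQ P Q

lemma D_square: "(- (\<alpha> * \<beta>)) \<cdot>\<^sub>m (D * D) = A * A - (\<alpha> + \<beta>) \<cdot>\<^sub>m A"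
proof -
  define PQ QP where "PQ = P * Q" and "QP = Q * P"
  have c: "PQ \<in> carrier_mat n n" "QP \<in> carrier_mat n n" using P Q by (auto simp: PQ_def QP_def)
  have "D * D = P + Q - PQ - QP"
    unfolding D_def PQ_def QP_def by (simp add: expand) (use P Q in \<open>intro eq_matI; simp\<close>)
  moreover have "A * A = \<alpha>\<^sup>2 \<cdot>\<^sub>m P + (\<alpha> * \<beta>) \<cdot>\<^sub>m PQ + (\<alpha> * \<beta>) \<cdot>\<^sub>m QP + \<beta>\<^sup>2 \<cdot>\<^sub>m Q"
    unfolding A_def PQ_def QP_def by (simp add: expand) (use P Q in \<open>intro eq_matI; simp add: algebra_simps power2_eq_square\<close>)
  ultimately show ?thesis
    using P Q c unfolding A_def by (intro eq_matI) (auto simp: algebra_simps power2_eq_square)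
qed

lemma K_square: "K * K = D * D * (D * D) - D * D"
proof -
  define PQ QP where "PQ = P * Q" and "QP = Q * P"
  have c: "PQ \<in> carrier_mat n n" "QP \<in> carrier_mat n n" using P Q by (auto simp: PQ_def QP_def)
  have "D * D = P + Q - P * Q - Q * P"
    unfolding D_def by (simp add: expand) (use P Q in \<open>intro eq_matI; simp\<close>)
  then show ?thesis unfolding K_def
   apply (simp add: expand)
   using P Q by (intro eq_matI; simp del: index_mult_mat(1) add: algebra_simps)
qed

lemma K_intertwines: "K * A = ((\<alpha> + \<beta>) \<cdot>\<^sub>m 1\<^sub>m n - A) * K"
  unfolding K_def A_def
  apply (simp add: expand left_mult_one_mat[of _ n n])
   using P Q by (intro eq_matI; simp del: index_mult_mat(1) add: algebra_simps)

lemma D_anticommutes: "D * A + A * D = (\<alpha> + \<beta>) \<cdot>\<^sub>m D + (\<alpha> - \<beta>) \<cdot>\<^sub>m (D * D)"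
  unfolding D_def A_def
  apply (simp add: expand)
   using P Q by (intro eq_matI; simp del: index_mult_mat(1) add: algebra_simps)

end

text \<open>Coprimality of \<open>h\<close> and a power of a linear polynomial, by induction on the exponent: modulo
  \<open>[:- c, 1:]\<close>, the polynomial \<open>h\<close> is the nonzero constant \<open>poly h c\<close>.\<close>
lemma bezout_linear_power:
  fixes h :: "'a::field poly"
  assumes h: "poly h c \<noteq> 0"
  shows "\<exists>u v. u * [:- c, 1:] ^ k + v * h = 1"
proof (induction k)
  case 0
  show ?case by (rule exI[of _ 1], rule exI[of _ 0]) simp
next
  case (Suc k)
  then obtain u v where uv: "u * [:- c, 1:] ^ k + v * h = 1" by blast
  obtain h' where h': "h = [:- c, 1:] * h' + [:poly h c:]"
    using synthetic_div_correct'[of c h] by metis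
  let ?d = "[:inverse (poly h c):]"
  have d: "?d * [:poly h c:] = 1" using h by (simp add: one_pCons)
  have "(- (u * ?d * h')) * [:- c, 1:] ^ Suc k + (v + u * [:- c, 1:] ^ k * ?d) * h
      = v * h + u * [:- c, 1:] ^ k * (?d * (h - [:- c, 1:] * h'))"
    by (simp add: algebra_simps del: mult_pCons_left mult_pCons_right)
  also have "h - [:- c, 1:] * h' = [:poly h c:]"
    by (subst (1) h') (simp only: add_diff_cancel_left')
  also have "?d * [:poly h c:] = 1" by (rule d)
  also have "v * h + u * [:- c, 1:] ^ k * 1 = 1" using uv by (simp add: add.commute)
  finally show ?case by blast
qed

lemma mat_poly_mult_vec:
  assumes A: "A \<in> carrier_mat n n" and x: "x \<in> carrier_vec n"
  shows "mat_poly A p *\<^sub>v (mat_poly A q *\<^sub>v x) = mat_poly A (p * q) *\<^sub>v x"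
  unfolding mat_poly_mult[OF A]
  by (rule assoc_mult_mat_vec[OF mat_poly_carrier[OF A] mat_poly_carrier[OF A] x, symmetric])

lemma mat_poly_add_vec:
  assumes A: "A \<in> carrier_mat n n" and x: "x \<in> carrier_vec n"
  shows "mat_poly A (p + q) *\<^sub>v x = mat_poly A p *\<^sub>v x + mat_poly A q *\<^sub>v x"
  unfolding mat_poly_add[OF A]
  by (rule add_mult_distrib_mat_vec[OF mat_poly_carrier[OF A] mat_poly_carrier[OF A] x])

lemma mat_poly_vec_carrier:
  assumes A: "A \<in> carrier_mat n n" and x: "x \<in> carrier_vec n"
  shows "mat_poly A p *\<^sub>v x \<in> carrier_vec n"
  by (rule mult_mat_vec_carrier[OF mat_poly_carrier[OF A] x])

text \<open>A polynomial that does not vanish at \<open>c\<close> acts invertibly on the generalized eigenspace of \<open>c\<close>,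
  and its inverse there is again a polynomial in \<open>A\<close>.\<close>
lemma kernel_vector_in_image:
  fixes A :: "'a::field mat"
  assumes A: "A \<in> carrier_mat n n" and x: "x \<in> carrier_vec n"
    and h: "poly h c \<noteq> 0" and z: "mat_poly A ([:- c, 1:] ^ k) *\<^sub>v x = 0\<^sub>v n"
  obtains v where "x = mat_poly A (h * v) *\<^sub>v x"
proof -
  obtain u v where uv: "u * [:- c, 1:] ^ k + v * h = 1" using bezout_linear_power[OF h] by blast
  have "x = mat_poly A (u * [:- c, 1:] ^ k + v * h) *\<^sub>v x" unfolding uv using x by (simp add: mat_poly_1[OF A])
  also have "\<dots> = mat_poly A u *\<^sub>v (mat_poly A ([:- c, 1:] ^ k) *\<^sub>v x) + mat_poly A (v * h) *\<^sub>v x"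
    unfolding mat_poly_add_vec[OF A x] mat_poly_mult_vec[OF A x] ..
  also have "mat_poly A u *\<^sub>v (mat_poly A ([:- c, 1:] ^ k) *\<^sub>v x) = 0\<^sub>v n"
    unfolding z using mat_poly_carrier[OF A, of u] by auto
  also have "0\<^sub>v n + mat_poly A (v * h) *\<^sub>v x = mat_poly A (h * v) *\<^sub>v x"
    using mat_poly_vec_carrier[OF A x] by (simp add: mult.commute)
  finally show thesis by (rule that)
qed

text \<open>The relation \<open>KA = (s - A)K\<close> makes \<open>K\<close> carry the generalized eigenspace of \<open>r\<close> into that of
  \<open>s - r\<close>. How faithfully it does so is measured by \<open>K * K\<close>, which is assumed to be a polynomial in
  \<open>A\<close> where needed: if that polynomial does not vanish at \<open>r\<close>, the two eigenvalues have the same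
  Jordan structure, and if it has simple zeros at both, block sizes differ by at most one.\<close>
locale reflecting_matrix =
  fixes n :: nat and A K :: "'a::field mat" and s :: 'a
  assumes A: "A \<in> carrier_mat n n" and K: "K \<in> carrier_mat n n"
    and KA: "K * A = (s \<cdot>\<^sub>m 1\<^sub>m n - A) * K"
begin

definition "B r k = mat_poly A ([:- r, 1:] ^ k)"

lemmas mp = mat_poly_carrier[OF A]

lemma B_carrier [simp]: "B r k \<in> carrier_mat n n"
  using mp by (simp add: B_def)

lemma B_mult: "B r j * B r k = B r (j + k)"
  by (simp add: B_def mat_poly_mult[OF A] power_add)

lemma BK_carrier [simp]: "B r k * K \<in> carrier_mat n n" "K * B r k \<in> carrier_mat n n"
  using K by (auto intro!: mult_carrier_mat[of _ n n _ n])

lemma K_mat_poly: "K * mat_poly A p = mat_poly A (pcompose p [:s, - 1:]) * K"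
proof -
  have "mat_poly A [:s, - 1:] = s \<cdot>\<^sub>m 1\<^sub>m n - A"
    using A by (simp add: mat_poly_pCons[OF A]) (intro eq_matI; simp)
  moreover have "s \<cdot>\<^sub>m 1\<^sub>m n - A \<in> carrier_mat n n" using A by (rule minus_carrier_mat)
  ultimately show ?thesis
    using mat_poly_intertwine[OF A K _ KA, of p] by (simp add: mat_poly_pcompose[OF A])
qed

lemma reflect_linear_power:
  "pcompose ([:- r, 1:] ^ k) [:s, - 1:] = smult ((- 1) ^ k) ([:- (s - r), 1:] ^ k)"
proof -
  have "pcompose (p ^ k) q = smult ((- 1) ^ k) (p' ^ k)" if "pcompose p q = - p'" for p q p' :: "'a poly"
    by (induction k) (simp_all add: pcompose_mult pcompose_1 that)
  then show ?thesis by (simp add: pcompose_pCons)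
qed

lemma K_B: "K * B r k = (- 1) ^ k \<cdot>\<^sub>m (B (s - r) k * K)"
  unfolding B_def K_mat_poly reflect_linear_power mat_poly_smult[OF A] by (rule mult_smult_assoc_mat[OF mp K])

lemma matrix_rank_K_B: "matrix_rank (K * B r k) = matrix_rank (B (s - r) k * K)"
  unfolding K_B by (rule matrix_rank_smult) simp

text \<open>Since \<open>K * K\<close> is invertible on the kernel of the \<open>k\<close>-th power of \<open>A - r\<close>, this kernel lies in the
  image of \<open>K\<close>. Thus \<open>K\<close> has full rank where it matters, and multiplication by it transports
  the rank of one power to the rank of its reflection.\<close>
lemma rank_power_le_reflected:
  assumes KK: "K * K = mat_poly A q" and q: "poly q r \<noteq> 0"
  shows "matrix_rank (B (s - r) k) \<le> matrix_rank (B r k)"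
proof -
  have "matrix_rank (1\<^sub>m n :: 'a mat) + matrix_rank (B r k * K) \<le> matrix_rank K + matrix_rank (B r k * 1\<^sub>m n)"
  proof (rule matrix_rank_loss_mono[of _ n n _ n _ n])
    fix x :: "'a vec" assume x: "x \<in> carrier_vec n" and "B r k *\<^sub>v (1\<^sub>m n *\<^sub>v x) = 0\<^sub>v n"
    then have z: "mat_poly A ([:- r, 1:] ^ k) *\<^sub>v x = 0\<^sub>v n" by (simp add: B_def)
    obtain v where v: "x = mat_poly A (q * v) *\<^sub>v x"
      using kernel_vector_in_image[OF A x q z] by blast
    note c = mat_poly_vec_carrier[OF A x, of v]
    have "mat_poly A (q * v) *\<^sub>v x = K * K *\<^sub>v (mat_poly A v *\<^sub>v x)"
      unfolding KK mat_poly_mult_vec[OF A x] ..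
    also have "\<dots> = K *\<^sub>v (K *\<^sub>v (mat_poly A v *\<^sub>v x))"
      by (rule assoc_mult_mat_vec[OF K K c])
    finally have "1\<^sub>m n *\<^sub>v x = K *\<^sub>v (K *\<^sub>v (mat_poly A v *\<^sub>v x))" using v x by simp
    then show "\<exists>y\<in>carrier_vec n. 1\<^sub>m n *\<^sub>v x = K *\<^sub>v y" using mult_mat_vec_carrier[OF K c] by blast
  qed (use K in auto)
  moreover have "matrix_rank (K * 1\<^sub>m n) + matrix_rank (1\<^sub>m n * B (s - r) k)
      \<le> matrix_rank (1\<^sub>m n :: 'a mat) + matrix_rank (K * (1\<^sub>m n * B (s - r) k))"
    by (rule frobenius_rank_inequality[of _ n n _ n _ n]) (use K in auto)
  moreover have "matrix_rank (K * B (s - r) k) = matrix_rank (B r k * K)"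
    using matrix_rank_K_B[of "s - r" k] by simp
  moreover have "B r k * 1\<^sub>m n = B r k" "K * 1\<^sub>m n = K" "1\<^sub>m n * B (s - r) k = B (s - r) k"
    using K right_mult_one_mat left_mult_one_mat B_carrier by blast+
  ultimately show ?thesis by simp
qed

text \<open>In terms of Jordan blocks: there are at most as many blocks of size at least \<open>k + 2\<close> for \<open>s - r\<close> as
  blocks of size at least \<open>k + 1\<close> for \<open>r\<close>. The reason is that \<open>K (A - r)^k K\<close> equals, up to a factor
  invertible at \<open>s - r\<close>, the power \<open>(A - (s - r))^(k + 1)\<close>: passing through the eigenvalue \<open>r\<close>
  and back costs one power of the linear factor, and no more because the zeros are simple.\<close>
lemma rank_loss_le_reflected:
  assumes KK: "K * K = mat_poly A ([:- r, 1:] * [:- (s - r), 1:] * g)"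
    and g: "poly g (s - r) \<noteq> 0" and r: "s - r \<noteq> r"
  shows "matrix_rank (B (s - r) (k + 1)) + matrix_rank (B r (k + 1))
    \<le> matrix_rank (B r k) + matrix_rank (B (s - r) (k + 2))"
proof -
  define r' where "r' = s - r"
  have r'': "s - r' = r" by (simp add: r'_def)
  let ?M = "K * (B r k * K)"
  have M: "?M \<in> carrier_mat n n" using K by (auto intro: mult_carrier_mat)
  define h where "h = [:- r, 1:] * g"
  have h: "poly h r' \<noteq> 0" using g r by (auto simp: h_def r'_def)
  have M_eq: "?M = mat_poly A (smult ((-1)^k) ([:- r', 1:] ^ (k + 1) * h))"
  proof -
    have "?M = (K * B r k) * K" using K by (intro assoc_mult_mat[of _ n n _ n _ n, symmetric]) auto
    also have "\<dots> = (-1)^k \<cdot>\<^sub>m (B r' k * K * K)" unfolding K_B r'_def[symmetric]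
      using K by (intro mult_smult_assoc_mat) auto
    also have "B r' k * K * K = B r' k * (K * K)" using K by (intro assoc_mult_mat[of _ n n _ n _ n]) auto
    also have "\<dots> = mat_poly A ([:- r', 1:] ^ k * ([:- r, 1:] * [:- r', 1:] * g))"
      unfolding KK B_def mat_poly_mult[OF A] r'_def ..
    also have "[:- r', 1:] ^ k * ([:- r, 1:] * [:- r', 1:] * g) = [:- r', 1:] ^ (k + 1) * h"
      by (simp only: h_def power_add power_one_right mult.assoc mult.commute mult.left_commute)
    finally show ?thesis by (simp only: mat_poly_smult[OF A])
  qed
  \<comment> \<open>The part of the image of \<open>B r' (k + 1)\<close> that the linear factor kills lies in the image of \<open>?M\<close>.\<close>
  have a: "matrix_rank (B r' (k + 1)) + matrix_rank (B r' 1 * ?M) \<le> matrix_rank ?M + matrix_rank (B r' 1 * B r' (k + 1))"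
  proof (rule matrix_rank_loss_mono[of _ n n _ n _ n])
    fix x :: "'a vec" assume x: "x \<in> carrier_vec n" and z: "B r' 1 *\<^sub>v (B r' (k + 1) *\<^sub>v x) = 0\<^sub>v n"
    have w: "B r' (k + 1) *\<^sub>v x \<in> carrier_vec n" unfolding B_def by (rule mat_poly_vec_carrier[OF A x])
    obtain v where v: "B r' (k + 1) *\<^sub>v x = mat_poly A (h * v) *\<^sub>v (B r' (k + 1) *\<^sub>v x)"
      using kernel_vector_in_image[OF A w h z[unfolded B_def[of _ 1]]] by blast
    also have "\<dots> = mat_poly A (h * v * [:- r', 1:] ^ (k + 1)) *\<^sub>v x"
      unfolding B_def mat_poly_mult_vec[OF A x] ..
    also have "h * v * [:- r', 1:] ^ (k + 1) = smult ((-1)^k) ([:- r', 1:] ^ (k + 1) * h) * smult ((-1)^k) v"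
      by (simp only: mult_smult_left mult_smult_right smult_smult) (simp add: ac_simps flip: power_add mult_2)
    also have "mat_poly A \<dots> *\<^sub>v x = ?M *\<^sub>v (mat_poly A (smult ((-1)^k) v) *\<^sub>v x)"
      unfolding M_eq mat_poly_mult_vec[OF A x] ..
    finally show "\<exists>y\<in>carrier_vec n. B r' (k + 1) *\<^sub>v x = ?M *\<^sub>v y" using mat_poly_vec_carrier[OF A x] by blast
  qed (use M in auto)
  have BM: "matrix_rank (B r' 1 * ?M) = matrix_rank (K * (B r (k + 1) * K))"
  proof -
    have "K * (B r (k + 1) * K) = K * (B r 1 * B r k * K)" by (simp add: B_mult)
    also have "B r 1 * B r k * K = B r 1 * (B r k * K)" using K by (intro assoc_mult_mat[of _ n n _ n _ n]) auto
    also have "K * (B r 1 * (B r k * K)) = K * B r 1 * (B r k * K)" using K by (intro assoc_mult_mat[of _ n n _ n _ n, symmetric]) auto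
    also have "\<dots> = (-1)^1 \<cdot>\<^sub>m (B r' 1 * K * (B r k * K))"
      unfolding K_B[of r 1] r'_def[symmetric] using K by (intro mult_smult_assoc_mat) auto
    also have "B r' 1 * K * (B r k * K) = B r' 1 * ?M" using K by (intro assoc_mult_mat[of _ n n _ n _ n]) auto
    finally show ?thesis by simp
  qed
  have ZB: "(B r k * K) * B r' 1 = (-1)^1 \<cdot>\<^sub>m (B r (k + 1) * K)"
  proof -
    have "(B r k * K) * B r' 1 = B r k * (K * B r' 1)" using K by (intro assoc_mult_mat[of _ n n _ n _ n]) auto
    also have "\<dots> = (-1)^1 \<cdot>\<^sub>m (B r k * (B r 1 * K))"
      unfolding K_B[of r' 1] r'' by (intro mult_smult_distrib[of _ n n _ n]) auto
    also have "B r k * (B r 1 * K) = B r k * B r 1 * K" using K by (intro assoc_mult_mat[of _ n n _ n _ n, symmetric]) auto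
    finally show ?thesis by (simp add: B_mult)
  qed
  \<comment> \<open>Stripping the two factors \<open>K\<close> from \<open>?M\<close>, on the left here and on the right in the next step, only increases the rank loss.\<close>
  have b: "matrix_rank ?M + matrix_rank (B r (k + 1) * K) \<le> matrix_rank (B r k * K) + matrix_rank (K * (B r (k + 1) * K))"
  proof -
    have "K * ((-1)^1 \<cdot>\<^sub>m (B r (k + 1) * K)) = (-1)^1 \<cdot>\<^sub>m (K * (B r (k + 1) * K))"
      using K by (intro mult_smult_distrib[of _ n n _ n]) auto
    then show ?thesis
      using frobenius_rank_inequality[OF K BK_carrier(1) B_carrier, of r k r' 1] unfolding ZB by simp
  qed
  have c: "matrix_rank (B r (k + 1)) + matrix_rank (B r k * K) \<le> matrix_rank (B r k) + matrix_rank (B r (k + 1) * K)"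
  proof -
    have "B r 1 * (B r k * K) = B r 1 * B r k * K" using K by (intro assoc_mult_mat[of _ n n _ n _ n, symmetric]) auto
    then show ?thesis
      using frobenius_rank_inequality[OF B_carrier B_carrier K, of r 1 r k] by (simp add: B_mult)
  qed
  show ?thesis using a b c BM by (simp add: B_mult r'_def)
qed

end

section \<open>Spectral conditions on a composite\<close>

text \<open>For an idempotent \<open>e\<close> that commutes with \<open>A\<close>, this is the number of Jordan blocks of size at least
  \<open>k\<close> for \<open>\<mu>\<close> of the restriction of \<open>A\<close> to the image of \<open>e\<close>; invariant direct summands are
  represented by such idempotents so that all matrices keep the size of \<open>A\<close>.\<close>
definition rank_drop :: "'a::field mat \<Rightarrow> 'a mat \<Rightarrow> 'a \<Rightarrow> nat \<Rightarrow> nat" where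
  "rank_drop A e \<mu> k = matrix_rank (mat_poly A ([:- \<mu>, 1:] ^ (k - 1)) * e)
     - matrix_rank (mat_poly A ([:- \<mu>, 1:] ^ k) * e)"

lemma rank_power_antimono:
  assumes A: "A \<in> carrier_mat n n" and e: "e \<in> carrier_mat n n" and "j \<le> k"
  shows "matrix_rank (mat_poly A (p ^ k) * e) \<le> matrix_rank (mat_poly A (p ^ j) * e)"
proof -
  note c = mat_poly_carrier[OF A]
  have "p ^ k = p ^ (k - j) * p ^ j" using assms(3) by (simp flip: power_add)
  then have "mat_poly A (p ^ k) * e = mat_poly A (p ^ (k - j)) * (mat_poly A (p ^ j) * e)"
    using assoc_mult_mat[OF c c e] by (simp add: mat_poly_mult[OF A])
  then show ?thesis using matrix_rank_mult_le_right[OF c mult_carrier_mat[OF c e]] by simp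
qed

text \<open>The four spectral conditions, for an arbitrary family \<open>\<nu>\<close> of numbers of blocks of size at least
  \<open>k\<close>. The absence of blocks of size exactly \<open>2 * k + 1\<close> is the equality of two consecutive numbers,
  and the equality of the numbers of blocks of each exact size is the equality of all the cumulated
  ones. In this form the conditions can be read off from ranks, and restricted to a summand.\<close>
definition balanced :: "'b::field \<Rightarrow> 'b \<Rightarrow> ('b \<Rightarrow> nat \<Rightarrow> nat) \<Rightarrow> bool" where
  "balanced \<alpha> \<beta> \<nu> \<longleftrightarrow>
     intertwined (\<nu> 0) (\<nu> (\<alpha> + \<beta>)) \<and> intertwined (\<nu> \<alpha>) (\<nu> \<beta>) \<and>
     (\<forall>\<mu>. \<mu> \<notin> {0, \<alpha>, \<beta>, \<alpha> + \<beta>} \<longrightarrow> (\<forall>k\<ge>1. \<nu> \<mu> k = \<nu> (\<alpha> + \<beta> - \<mu>) k)) \<and>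
     ((2::'b) \<noteq> 0 \<longrightarrow> (\<forall>k. \<nu> ((\<alpha> + \<beta>) / 2) (2 * k + 1) = \<nu> ((\<alpha> + \<beta>) / 2) (2 * k + 2)))"

context idempotent_pair
begin

lemma reflecting: "reflecting_matrix n A K (\<alpha> + \<beta>)"
  by unfold_locales (auto simp: carriers K_intertwines)

lemma mat_poly_D_square: "mat_poly A [:0, - (\<alpha> + \<beta>), 1:] = (- (\<alpha> * \<beta>)) \<cdot>\<^sub>m (D * D)"
  unfolding D_square using carriers
  by (simp add: mat_poly_pCons[OF carriers(1)] mult_add_distrib_mat[of _ n n _ n] mult_smult_distrib[of _ n n _ n])
    (intro eq_matI; simp del: index_mult_mat(1) add: algebra_simps)

lemma mat_poly_D_square':
  assumes "\<alpha> \<noteq> 0" "\<beta> \<noteq> 0"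
  shows "D * D = mat_poly A (smult (- inverse (\<alpha> * \<beta>)) [:0, - (\<alpha> + \<beta>), 1:])"
  unfolding mat_poly_smult[OF carriers(1)] mat_poly_D_square
  using carriers assms by (intro eq_matI) (auto simp: field_simps simp del: index_mult_mat(1))

lemma mat_poly_K_square:
  assumes "\<alpha> \<noteq> 0" "\<beta> \<noteq> 0"
  shows "K * K = mat_poly A (smult (inverse ((\<alpha> * \<beta>)\<^sup>2)) ([:0, 1:] * [:- (\<alpha> + \<beta>), 1:] * ([:- \<alpha>, 1:] * [:- \<beta>, 1:])))"
proof -
  let ?q = "smult (- inverse (\<alpha> * \<beta>)) [:0, - (\<alpha> + \<beta>), 1:]"
  have "K * K = mat_poly A (?q * ?q - ?q)"
  proof -
    have "mat_poly A (?q * ?q + smult (-1) ?q) = mat_poly A ?q * mat_poly A ?q + (-1) \<cdot>\<^sub>m mat_poly A ?q"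
      unfolding mat_poly_add[OF carriers(1)] mat_poly_mult[OF carriers(1)] mat_poly_smult[OF carriers(1), of "-1"] ..
    also have "\<dots> = mat_poly A ?q * mat_poly A ?q - mat_poly A ?q"
      using mat_poly_carrier[OF carriers(1), of ?q] by (intro eq_matI) auto
    finally show ?thesis unfolding K_square mat_poly_D_square'[OF assms] by simp
  qed
  also have "?q * ?q - ?q = smult (inverse ((\<alpha> * \<beta>)\<^sup>2)) ([:0, 1:] * [:- (\<alpha> + \<beta>), 1:] * ([:- \<alpha>, 1:] * [:- \<beta>, 1:]))"
    using assms by (simp add: field_simps power2_eq_square)
  finally show ?thesis .
qed

text \<open>With \<open>N = A - c\<close> the relation for the difference of the idempotents becomes
  \<open>DN + ND = (\<alpha> - \<beta>)D\<^sup>2\<close>, whose right-hand side commutes with \<open>N\<close>; hence \<open>D\<close> commutes with the even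
  powers of \<open>N\<close>. If \<open>w = N^(2k) x\<close> is killed by \<open>N\<close>, then applying the relation to \<open>w\<close> gives
  \<open>(\<alpha> - \<beta>)D\<^sup>2 w = ND w = N^(2k + 1) D x\<close>, and \<open>D\<^sup>2\<close> acts on \<open>w\<close> as a nonzero scalar. So no
  chain of Jordan vectors stops at an odd length.\<close>
lemma even_rank_drop:
  assumes ab: "\<alpha> \<noteq> 0" "\<beta> \<noteq> 0" "\<alpha> \<noteq> \<beta>" "\<alpha> \<noteq> - \<beta>" and two: "(2::'a) \<noteq> 0"
  defines "c \<equiv> (\<alpha> + \<beta>) / 2"
  shows "matrix_rank (mat_poly A ([:- c, 1:] ^ (2 * k))) + matrix_rank (mat_poly A ([:- c, 1:] ^ (2 * k + 2)))
     \<le> 2 * matrix_rank (mat_poly A ([:- c, 1:] ^ (2 * k + 1)))"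
proof -
  note A = carriers(1)
  note mp = mat_poly_carrier[OF A]
  let ?L = "[:- c, 1:]"
  let ?q = "smult (- inverse (\<alpha> * \<beta>)) [:0, - (\<alpha> + \<beta>), 1:]"
  define N where "N = mat_poly A ?L"
  define C where "C = (\<alpha> - \<beta>) \<cdot>\<^sub>m (D * D)"
  have C: "C = mat_poly A (smult (\<alpha> - \<beta>) ?q)"
    unfolding C_def mat_poly_D_square'[OF ab(1,2)] mat_poly_smult[OF A] ..
  have cc: "N \<in> carrier_mat n n" "C \<in> carrier_mat n n" unfolding N_def C using mp by auto
  have N_eq: "N = A + (- c) \<cdot>\<^sub>m 1\<^sub>m n" unfolding N_def mat_poly_linear[OF A] char_matrix_def using A by auto
  have c2: "c + c = \<alpha> + \<beta>"
  proof -
    have "c + c = 2 * c" by (rule mult_2[symmetric])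
    then show ?thesis using two by (simp add: c_def)
  qed
  have DN: "D * N = C - N * D"
  proof -
    have "D * N + N * D = (D * A + A * D) + (- (c + c)) \<cdot>\<^sub>m D"
      unfolding N_eq using carriers
      by (simp add: mult_add_distrib_mat[of _ n n _ n] add_mult_distrib_mat[of _ n n _ _ n] mult_smult_distrib[of _ n n _ n]
         mult_smult_assoc_mat[of _ n n _ n])
       (intro eq_matI; simp del: index_mult_mat(1) add: algebra_simps)
    also have "\<dots> = C" unfolding D_anticommutes c2 C_def using carriers
      by (intro eq_matI; simp del: index_mult_mat(1) add: algebra_simps)
    finally have "D * N + N * D = C" .
    then show ?thesis using carriers cc by (intro eq_matI; simp del: index_mult_mat(1))
      (metis (no_types, lifting) add_diff_cancel_right' carrier_matD index_add_mat(1) index_mult_mat(2,3))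
  qed
  have CN: "C * N = N * C" unfolding C N_def by (rule mat_poly_mult_commute[OF A])
  have DNN: "D * (N * N) = (N * N) * D"
  proof -
    have "D * (N * N) = (C - N * D) * N" using carriers cc by (simp flip: DN)
    also have "\<dots> = C * N - N * (D * N)" using carriers cc
      by (simp add: minus_mult_distrib_mat[of _ n n _ _ n] assoc_mult_mat[of _ n n _ n _ n] mult_carrier_mat[of _ n n _ n])
    also have "N * (D * N) = N * C - N * (N * D)" unfolding DN using carriers cc
      by (simp add: mult_minus_distrib_mat[of _ n n _ n] mult_carrier_mat[of _ n n _ n])
    also have "C * N - (N * C - N * (N * D)) = N * (N * D)" unfolding CN
      using carriers cc by (intro eq_matI; simp del: index_mult_mat(1))
    finally show ?thesis using carriers cc by (simp add: assoc_mult_mat[of _ n n _ n _ n])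
  qed
  define M where "M = mat_poly A (?L ^ (2 * k))"
  have M: "M \<in> carrier_mat n n" unfolding M_def by (rule mp)
  have DM: "D * M = M * D"
  proof -
    have "mat_poly (N * N) p = mat_poly A (pcompose p (?L * ?L))" for p
      unfolding mat_poly_pcompose[OF A] mat_poly_mult[OF A] N_def ..
    moreover have "pcompose ([:0, 1:] ^ k) (?L * ?L) = ?L ^ (2 * k)"
    proof -
      have "pcompose ([:0, 1:] ^ k) p = p ^ k" for p :: "'a poly"
        by (induction k) (simp_all add: pcompose_1 pcompose_mult pcompose_pCons)
      then show ?thesis by (simp only: power_mult power2_eq_square)
    qed
    ultimately have "M = mat_poly (N * N) ([:0, 1:] ^ k)" unfolding M_def by simp
    then show ?thesis using mat_poly_intertwine[OF _ carriers(3) _ DNN, of "[:0,1:]^k"] cc by simp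
  qed
  have MN: "mat_poly A (?L ^ (2 * k + 1)) = M * N" "mat_poly A (?L ^ (2 * k + 1)) = N * M"
    unfolding M_def N_def mat_poly_mult[OF A, symmetric] by (simp_all add: mult.commute)
  have MNN: "mat_poly A (?L ^ (2 * k + 2)) = N * mat_poly A (?L ^ (2 * k + 1))"
    unfolding N_def mat_poly_mult[OF A, symmetric] by (simp only: power_Suc[symmetric] add_2_eq_Suc' Suc_eq_plus1[symmetric])
  have "matrix_rank M + matrix_rank (N * mat_poly A (?L ^ (2 * k + 1))) \<le> matrix_rank (mat_poly A (?L ^ (2 * k + 1))) + matrix_rank (N * M)"
  proof (rule matrix_rank_loss_mono[of _ n n _ n _ n])
    fix x :: "'a vec" assume x: "x \<in> carrier_vec n" and z: "N *\<^sub>v (M *\<^sub>v x) = 0\<^sub>v n"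
    define w where "w = M *\<^sub>v x"
    have w: "w \<in> carrier_vec n" using M x by (auto simp: w_def)
    have Dc: "D *\<^sub>v x \<in> carrier_vec n" "D *\<^sub>v w \<in> carrier_vec n" using carriers x w by auto
    have q: "smult (\<alpha> - \<beta>) ?q = [:(\<alpha> - \<beta>) * c\<^sup>2 / (\<alpha> * \<beta>):] + smult (- (\<alpha> - \<beta>) / (\<alpha> * \<beta>)) (?L * ?L)"
      using ab by (simp add: field_simps power2_eq_square flip: c2)
    \<comment> \<open>The value at \<open>c\<close> of the polynomial that represents \<open>C\<close>; it is nonzero as \<open>\<alpha>\<close> differs from \<open>\<beta>\<close> and \<open>- \<beta>\<close>.\<close>
    define d where "d = (\<alpha> - \<beta>) * c\<^sup>2 / (\<alpha> * \<beta>)"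
    have d: "d \<noteq> 0"
    proof -
      have "\<alpha> + \<beta> \<noteq> 0" using ab(4) by (simp add: eq_neg_iff_add_eq_0)
      then show ?thesis using ab two by (simp add: d_def c_def)
    qed
    have "C *\<^sub>v w = d \<cdot>\<^sub>v w"
    proof -
      have "C *\<^sub>v w = mat_poly A [:d:] *\<^sub>v w + mat_poly A (smult (- (\<alpha> - \<beta>) / (\<alpha> * \<beta>)) ?L) *\<^sub>v (mat_poly A ?L *\<^sub>v w)"
        unfolding C q d_def mat_poly_add_vec[OF A w] mat_poly_mult_vec[OF A w] mult_smult_left ..
      also have "mat_poly A ?L *\<^sub>v w = 0\<^sub>v n" using z by (simp add: w_def N_def)
      also have "mat_poly A (smult (- (\<alpha> - \<beta>) / (\<alpha> * \<beta>)) ?L) *\<^sub>v 0\<^sub>v n = 0\<^sub>v n" using mp[of "smult (- (\<alpha> - \<beta>) / (\<alpha> * \<beta>)) ?L"] by auto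
      also have "mat_poly A [:d:] = d \<cdot>\<^sub>m 1\<^sub>m n" using A by (simp add: mat_poly_pCons[OF A])
      also have "d \<cdot>\<^sub>m 1\<^sub>m n *\<^sub>v w + 0\<^sub>v n = d \<cdot>\<^sub>v w" using w by (intro eq_vecI) auto
      finally show ?thesis .
    qed
    moreover have "C *\<^sub>v w = N *\<^sub>v (D *\<^sub>v w)"
    proof -
      have "D * N + N * D = C" unfolding DN using carriers cc by (intro eq_matI; simp del: index_mult_mat(1))
      then have "C *\<^sub>v w = D * N *\<^sub>v w + N * D *\<^sub>v w" using carriers cc w
        by (metis add_mult_distrib_mat_vec mult_carrier_mat)
      also have "D * N *\<^sub>v w = D *\<^sub>v 0\<^sub>v n" using carriers cc w z by (simp add: w_def)
      also have "\<dots> = 0\<^sub>v n" using carriers by auto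
      finally show ?thesis using carriers cc w Dc by simp
    qed
    moreover have "D *\<^sub>v w = M *\<^sub>v (D *\<^sub>v x)"
      unfolding w_def using assoc_mult_mat_vec[OF carriers(3) M x] assoc_mult_mat_vec[OF M carriers(3) x] DM by simp
    ultimately have "d \<cdot>\<^sub>v w = N *\<^sub>v (M *\<^sub>v (D *\<^sub>v x))" by simp
    also have "\<dots> = N * M *\<^sub>v (D *\<^sub>v x)" using assoc_mult_mat_vec[OF cc(1) M Dc(1)] by simp
    finally have "d \<cdot>\<^sub>v w = N * M *\<^sub>v (D *\<^sub>v x)" .
    then have "inverse d \<cdot>\<^sub>v (d \<cdot>\<^sub>v w) = N * M *\<^sub>v (inverse d \<cdot>\<^sub>v (D *\<^sub>v x))"
      using mult_mat_vec[of "N * M" n n "D *\<^sub>v x" "inverse d"] cc M Dc by (simp add: mult_carrier_mat[of _ n n _ n])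
    moreover have "inverse d \<cdot>\<^sub>v (d \<cdot>\<^sub>v w) = w" using d by (intro eq_vecI) auto
    ultimately show "\<exists>y\<in>carrier_vec n. M *\<^sub>v x = mat_poly A (?L ^ (2 * k + 1)) *\<^sub>v y"
      unfolding MN(2) w_def[symmetric] using Dc by (metis smult_carrier_vec)
  qed (use cc M mp in auto)
  from this[unfolded MN(2)[symmetric] MNN[symmetric], unfolded M_def] show ?thesis by linarith
qed

end

context idempotent_pair
begin

lemma balanced_rank_drop:
  assumes ab: "\<alpha> \<noteq> 0" "\<beta> \<noteq> 0" "\<alpha> \<noteq> \<beta>" "\<alpha> \<noteq> - \<beta>"
  shows "balanced \<alpha> \<beta> (rank_drop A (1\<^sub>m n))"
proof -
  interpret reflecting_matrix n A K "\<alpha> + \<beta>" by (rule reflecting)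
  let ?c = "inverse ((\<alpha> * \<beta>)\<^sup>2)"
  have s: "\<alpha> + \<beta> \<noteq> 0" using ab(4) by (simp add: eq_neg_iff_add_eq_0)
  have c: "?c \<noteq> 0" using ab by simp
  define q where "q = smult ?c ([:0, 1:] * [:- (\<alpha> + \<beta>), 1:] * ([:- \<alpha>, 1:] * [:- \<beta>, 1:]))"
  have KK: "K * K = mat_poly A q" unfolding q_def by (rule mat_poly_K_square[OF ab(1,2)])
  have rd: "rank_drop A (1\<^sub>m n) r k = matrix_rank (B r (k - 1)) - matrix_rank (B r k)" for r k
    unfolding rank_drop_def B_def using right_mult_one_mat[OF mp] by simp
  have mono: "matrix_rank (B r k) \<le> matrix_rank (B r j)" if "j \<le> k" for r j k
    using rank_power_antimono[OF A one_carrier_mat that, of "[:-r,1:]"] right_mult_one_mat[OF mp]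
    by (simp add: B_def)
  have drop: "rank_drop A (1\<^sub>m n) (\<alpha> + \<beta> - r) (k + 1) \<le> rank_drop A (1\<^sub>m n) r k"
    if K: "K * K = mat_poly A ([:- r, 1:] * [:- (\<alpha> + \<beta> - r), 1:] * g)" and g: "poly g (\<alpha> + \<beta> - r) \<noteq> 0"
      and r: "\<alpha> + \<beta> - r \<noteq> r" and k: "k \<ge> 1" for r g k
  proof -
    obtain j where j: "k = j + 1" using k by (metis le_add_diff_inverse2)
    show ?thesis unfolding rd j
      using rank_loss_le_reflected[OF K g r, of j] mono[of j "j + 1" r] mono[of "j+1" "j + 2" "\<alpha> + \<beta> - r"] by simp
  qed
  let ?g1 = "smult ?c ([:- \<alpha>, 1:] * [:- \<beta>, 1:])" and ?g2 = "smult ?c ([:0, 1:] * [:- (\<alpha> + \<beta>), 1:])"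
  have q0: "q = [:- 0, 1:] * [:- (\<alpha> + \<beta> - 0), 1:] * ?g1"
    and qs: "q = [:- (\<alpha> + \<beta>), 1:] * [:- (\<alpha> + \<beta> - (\<alpha> + \<beta>)), 1:] * ?g1"
    and qa: "q = [:- \<alpha>, 1:] * [:- (\<alpha> + \<beta> - \<alpha>), 1:] * ?g2"
    and qb: "q = [:- \<beta>, 1:] * [:- (\<alpha> + \<beta> - \<beta>), 1:] * ?g2"
    unfolding q_def by (simp_all only: mult_smult_right minus_zero diff_zero diff_self add_diff_cancel_left' add_diff_cancel_right' ac_simps)
  have g: "poly ?g1 0 \<noteq> 0" "poly ?g1 (\<alpha> + \<beta>) \<noteq> 0" "poly ?g2 \<alpha> \<noteq> 0" "poly ?g2 \<beta> \<noteq> 0"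
    unfolding poly_smult poly_mult mult_eq_0_iff using ab c s by (auto simp: algebra_simps)
  have "intertwined (rank_drop A (1\<^sub>m n) 0) (rank_drop A (1\<^sub>m n) (\<alpha> + \<beta>))"
    using drop[OF KK[unfolded q0]] drop[OF KK[unfolded qs]] g s unfolding intertwined_def by simp
  moreover have "intertwined (rank_drop A (1\<^sub>m n) \<alpha>) (rank_drop A (1\<^sub>m n) \<beta>)"
    using drop[OF KK[unfolded qa]] drop[OF KK[unfolded qb]] g ab(3) unfolding intertwined_def by simp
  moreover have "rank_drop A (1\<^sub>m n) \<mu> k = rank_drop A (1\<^sub>m n) (\<alpha> + \<beta> - \<mu>) k"
    if \<mu>: "\<mu> \<notin> {0, \<alpha>, \<beta>, \<alpha> + \<beta>}" for \<mu> k
  proof -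
    have "poly q \<mu> \<noteq> 0" "poly q (\<alpha> + \<beta> - \<mu>) \<noteq> 0"
      unfolding q_def poly_smult poly_mult mult_eq_0_iff using \<mu> c by (auto simp: algebra_simps)
    then have "matrix_rank (B (\<alpha> + \<beta> - \<mu>) j) = matrix_rank (B \<mu> j)" for j
      using rank_power_le_reflected[OF KK, of \<mu> j] rank_power_le_reflected[OF KK, of "\<alpha> + \<beta> - \<mu>" j] by simp
    then show ?thesis unfolding rd by simp
  qed
  moreover have "rank_drop A (1\<^sub>m n) ((\<alpha> + \<beta>) / 2) (2 * k + 1) = rank_drop A (1\<^sub>m n) ((\<alpha> + \<beta>) / 2) (2 * k + 2)"
    if two: "(2::'a) \<noteq> 0" for k
  proof (rule antisym)
    let ?h = "(\<alpha> + \<beta>) / 2"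
    show "rank_drop A (1\<^sub>m n) ?h (2 * k + 1) \<le> rank_drop A (1\<^sub>m n) ?h (2 * k + 2)"
      using even_rank_drop[OF ab two, of k, folded B_def] mono[of "2 * k" "2 * k + 1" ?h] mono[of "2 * k + 1" "2 * k + 2" ?h]
      unfolding rd by simp
    have f: "matrix_rank (B ?h 1 * B ?h j) + matrix_rank (B ?h j * B ?h 1) \<le> matrix_rank (B ?h j) + matrix_rank (B ?h 1 * (B ?h j * B ?h 1))" for j
      by (rule frobenius_rank_inequality[of _ n n _ n _ n]) simp_all
    show "rank_drop A (1\<^sub>m n) ?h (2 * k + 2) \<le> rank_drop A (1\<^sub>m n) ?h (2 * k + 1)"
      using f[of "2 * k"] mono[of "2 * k" "2 * k + 1" ?h] mono[of "2 * k + 1" "2 * k + 2" ?h] by (simp add: rd B_mult)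
  qed
  ultimately show ?thesis unfolding balanced_def by blast
qed

end

lemma composite_imp_balanced:
  fixes A :: "'a::field mat"
  assumes "\<alpha> \<noteq> 0" "\<beta> \<noteq> 0" "\<alpha> \<noteq> \<beta>" "\<alpha> \<noteq> - \<beta>" and "composite n \<alpha> \<beta> A"
  shows "balanced \<alpha> \<beta> (rank_drop A (1\<^sub>m n))"
proof -
  obtain P Q where PQ: "P \<in> carrier_mat n n" "Q \<in> carrier_mat n n" "P * P = P" "Q * Q = Q"
    "A = \<alpha> \<cdot>\<^sub>m P + \<beta> \<cdot>\<^sub>m Q" using assms(5) unfolding composite_def by blast
  interpret I: idempotent_pair n P Q \<alpha> \<beta> using PQ by unfold_locales
  show ?thesis using I.balanced_rank_drop[OF assms(1-4)] PQ(5) unfolding I.A_def by simp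
qed

section \<open>Jordan normal forms over an algebraically closed field\<close>

lemma invertible_with_first_column:
  fixes v :: "'a::field vec"
  assumes v: "v \<in> carrier_vec n" "v \<noteq> 0\<^sub>v n"
  obtains W W' where "W \<in> carrier_mat n n" "W' \<in> carrier_mat n n" "W * W' = 1\<^sub>m n" "W' * W = 1\<^sub>m n" "col W 0 = v"
proof -
  obtain k where k: "k < n" "v $ k \<noteq> 0" using v by (metis carrier_vecD eq_vecI index_zero_vec)
  \<comment> \<open>With the entries \<open>0\<close> and \<open>k\<close> of \<open>v\<close> exchanged, the matrix becomes lower triangular with a nonzero diagonal.\<close>
  define L where "L = mat n n (\<lambda>(i,j). if j = 0 then v $ (if i = 0 then k else if i = k then 0 else i) else if i = j then 1 else 0)"
  define W where "W = swaprows 0 k L"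
  have L: "L \<in> carrier_mat n n" by (simp add: L_def)
  have W: "W \<in> carrier_mat n n" using L by (simp add: W_def)
  have n: "0 < n" using k by simp
  have "det L = prod_list (diag_mat L)"
    by (rule det_lower_triangular[OF _ L]) (auto simp: L_def)
  then have "det L \<noteq> 0" using k by (auto simp: diag_mat_def L_def prod_list_zero_iff)
  then have "det W \<noteq> 0"
  proof (cases "k = 0")
    case True
    then have "W = L" unfolding W_def by (intro eq_matI) auto
    with \<open>det L \<noteq> 0\<close> show ?thesis by simp
  next
    case False
    with \<open>det L \<noteq> 0\<close> show ?thesis using det_swaprows[OF n k(1) _ L] by (simp add: W_def)
  qed
  from det_non_zero_imp_unit[OF W this, of undefined]
  obtain W' where W': "W' \<in> carrier_mat n n" "W' * W = 1\<^sub>m n" "W * W' = 1\<^sub>m n"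
    by (auto simp: Units_def ring_mat_simps)
  have "col W 0 = v" using n k v by (intro eq_vecI) (auto simp: W_def L_def)
  with W W' show thesis by (intro that)
qed

text \<open>An eigenvector, completed to a basis, splits off a block of size one; the remaining diagonal block
  is triangularized by induction.\<close>
lemma similar_upper_triangular:
  fixes A :: "'a::alg_closed_field mat"
  assumes "A \<in> carrier_mat n n"
  shows "\<exists>T \<in> carrier_mat n n. similar_mat A T \<and> upper_triangular T"
  using assms
proof (induction n arbitrary: A)
  case 0
  then show ?case using similar_mat_refl[OF "0.prems"] by (intro bexI[of _ A]) auto
next
  case (Suc n)
  note A = Suc.prems
  have "degree (char_poly A) = Suc n" using degree_monic_char_poly[OF A] by simp
  then obtain \<mu> where "poly (char_poly A) \<mu> = 0" using alg_closed_imp_poly_has_root[of "char_poly A"] by auto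
  then obtain v where "eigenvector A v \<mu>"
    using eigenvalue_root_char_poly[OF A] by (auto simp: eigenvalue_def)
  then have v: "v \<in> carrier_vec (Suc n)" "v \<noteq> 0\<^sub>v (Suc n)" "A *\<^sub>v v = \<mu> \<cdot>\<^sub>v v"
    using A by (auto simp: eigenvector_def)
  obtain W W' where W: "W \<in> carrier_mat (Suc n) (Suc n)" "W' \<in> carrier_mat (Suc n) (Suc n)"
    "W * W' = 1\<^sub>m (Suc n)" "W' * W = 1\<^sub>m (Suc n)" "col W 0 = v"
    using invertible_with_first_column[OF v(1,2)] by blast
  define M where "M = W' * A * W"
  have M: "M \<in> carrier_mat (Suc n) (Suc n)" using W A by (simp add: M_def)
  have MW: "W * M * W' = A"
  proof -
    have "W * M * W' = (W * W') * A * (W * W')" unfolding M_def using W(1,2) A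
      by (simp add: assoc_mult_mat[of _ "Suc n" "Suc n" _ "Suc n" _ "Suc n"] mult_carrier_mat[of _ "Suc n" "Suc n" _ "Suc n"])
    then show ?thesis using W A by simp
  qed
  have sim: "similar_mat A M"
    by (rule similar_matI[of _ _ W W' "Suc n"]) (use A M W MW in auto)
  have col: "col M 0 = \<mu> \<cdot>\<^sub>v unit_vec (Suc n) 0"
  proof -
    have "col M 0 = W' * A *\<^sub>v v" unfolding M_def using W A by (subst col_mult2[of _ "Suc n" "Suc n" _ "Suc n"]) auto
    also have "\<dots> = W' *\<^sub>v (A *\<^sub>v v)" using W A v by simp
    also have "\<dots> = \<mu> \<cdot>\<^sub>v (W' *\<^sub>v v)" unfolding v(3) using W v by (intro mult_mat_vec) auto
    also have "W' *\<^sub>v v = col (W' * W) 0" unfolding W(5)[symmetric] using W by (subst col_mult2[of _ "Suc n" "Suc n" _ "Suc n"]) auto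
    finally show ?thesis unfolding W(4) by simp
  qed
  define M2 where "M2 = mat n n (\<lambda>(i,j). M $$ (Suc i, Suc j))"
  define r where "r = mat 1 n (\<lambda>(i,j). M $$ (i, Suc j))"
  have M_eq: "M = four_block_mat (mat 1 1 (\<lambda>_. \<mu>)) r (0\<^sub>m n 1) M2"
  proof (rule eq_matI)
    fix i j assume ij: "i < dim_row (four_block_mat (mat 1 1 (\<lambda>_. \<mu>)) r (0\<^sub>m n 1) M2)"
      "j < dim_col (four_block_mat (mat 1 1 (\<lambda>_. \<mu>)) r (0\<^sub>m n 1) M2)"
    then have ij': "i < Suc n" "j < Suc n" by (auto simp: r_def M2_def)
    have "M $$ (i, 0) = (if i = 0 then \<mu> else 0)"
      using arg_cong[OF col, of "\<lambda>w. vec_index w i"] M ij' by auto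
    then show "M $$ (i, j) = four_block_mat (mat 1 1 (\<lambda>_. \<mu>)) r (0\<^sub>m n 1) M2 $$ (i, j)"
      using ij' by (cases i; cases j) (auto simp: r_def M2_def)
  qed (use M in \<open>auto simp: M2_def\<close>)
  have M2: "M2 \<in> carrier_mat n n" by (simp add: M2_def)
  obtain T where T: "T \<in> carrier_mat n n" "similar_mat M2 T" "upper_triangular T"
    using Suc.IH[OF M2] by blast
  have 1: "mat 1 1 (\<lambda>_. \<mu>) \<in> carrier_mat 1 1" by simp
  have r: "r \<in> carrier_mat 1 n" by (simp add: r_def)
  obtain r' where r': "r' \<in> carrier_mat 1 n" "similar_mat M (four_block_mat (mat 1 1 (\<lambda>_. \<mu>)) r' (0\<^sub>m n 1) T)"
    using similar_mat_four_block_0_ex[OF similar_mat_refl[OF 1] T(2) r 1 M2] unfolding M_eq by auto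
  let ?T = "four_block_mat (mat 1 1 (\<lambda>_. \<mu>)) r' (0\<^sub>m n 1) T"
  have Tc: "?T \<in> carrier_mat (Suc n) (Suc n)" using four_block_carrier_mat[OF 1 T(1)] by simp
  have "upper_triangular ?T"
    using T r' by (intro upper_triangularI) (auto simp: upper_triangularD)
  then show ?case using Tc similar_mat_trans[OF sim r'(2)] by blast
qed

lemma jordan_nf_exists_alg_closed:
  fixes A :: "'a::alg_closed_field mat"
  assumes A: "A \<in> carrier_mat n n"
  shows "\<exists>n_as. jordan_nf A n_as"
proof -
  obtain T where T: "T \<in> carrier_mat n n" "similar_mat A T" "upper_triangular T"
    using similar_upper_triangular[OF A] by blast
  show ?thesis
    using triangular_to_jnf_vector[OF T(1,3)] similar_mat_trans[OF T(2)] unfolding jordan_nf_def by blast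
qed

section \<open>Block numbers as drops of rank\<close>

abbreviation ac_mat :: "'a::field mat \<Rightarrow> 'a alg_closure mat" where
  "ac_mat A \<equiv> map_mat to_ac A"

interpretation to_ac: field_hom "to_ac :: 'a::field \<Rightarrow> 'a alg_closure"
  by unfold_locales auto

lemma num_blocks_ge_eq_rank_drop:
  fixes A :: "'a::field mat"
  assumes A: "A \<in> carrier_mat n n"
  shows "num_blocks_ge A \<mu> k = rank_drop (ac_mat A) (1\<^sub>m n) \<mu> k"
proof -
  have cA: "ac_mat A \<in> carrier_mat n n" using A by simp
  note mp = mat_poly_carrier[OF cA]
  have d: "dim_gen_eigenspace (ac_mat A) \<mu> j = n - matrix_rank (mat_poly (ac_mat A) ([:- \<mu>, 1:] ^ j))" for j
    unfolding dim_gen_eigenspace_def mat_poly_power[OF cA] mat_poly_linear[OF cA]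
    using matrix_rank_plus_kernel_dim[of "char_matrix (ac_mat A) \<mu> ^\<^sub>m j" n n] cA
    by (metis add_diff_cancel_left' char_matrix_closed pow_carrier_mat)
  have le: "matrix_rank (mat_poly (ac_mat A) ([:- \<mu>, 1:] ^ j)) \<le> n" for j
    using matrix_rank_plus_kernel_dim[OF mp] by (metis le_add1)
  show ?thesis unfolding num_blocks_ge_def d rank_drop_def right_mult_one_mat[OF mp]
    using le[of k] le[of "k - 1"] by linarith
qed

lemma num_blocks_ge_Suc:
  fixes A :: "'a::field mat"
  assumes A: "A \<in> carrier_mat n n" and k: "k \<ge> 1"
  shows "num_blocks_ge A \<mu> k = num_blocks_eq A \<mu> k + num_blocks_ge A \<mu> (k + 1)"
proof -
  obtain n_as where j: "jordan_nf (ac_mat A) n_as"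
    using jordan_nf_exists_alg_closed[of "ac_mat A" n] A by auto
  have "length (filter (\<lambda>(m, x). m \<ge> k \<and> x = \<mu>) xs) =
      count_list xs (k, \<mu>) + length (filter (\<lambda>(m, x). m \<ge> k + 1 \<and> x = \<mu>) xs)" for xs :: "(nat \<times> 'a alg_closure) list"
    by (induction xs) auto
  then show ?thesis using num_blocks_ge_jordan_nf[OF j, of _ \<mu>] num_blocks_eq_jordan_nf[OF j, of \<mu> k] k
    by simp
qed

text \<open>The bound is uniform in the eigenvalue and provides the start for the downward induction that
  recovers cumulated block numbers from exact ones.\<close>
lemma num_blocks_ge_eventually_0:
  fixes A :: "'a::field mat"
  assumes A: "A \<in> carrier_mat n n"
  obtains N where "\<And>\<mu> k. k \<ge> N \<Longrightarrow> num_blocks_ge A \<mu> k = 0"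
proof -
  obtain n_as where j: "jordan_nf (ac_mat A) n_as"
    using jordan_nf_exists_alg_closed[of "ac_mat A" n] A by auto
  have "num_blocks_ge A \<mu> k = 0" if "k \<ge> Suc (Max (insert 0 (fst ` set n_as)))" for \<mu> k
  proof -
    have "\<not> m \<ge> k" if "(m, x) \<in> set n_as" for m x
    proof -
      have "m \<le> Max (insert 0 (fst ` set n_as))" using that by (intro Max_ge) force+
      then show ?thesis using \<open>k \<ge> _\<close> by simp
    qed
    then have "filter (\<lambda>(m, x). m \<ge> k \<and> x = \<mu>) n_as = []" by (auto simp: filter_empty_conv)
    then show ?thesis using num_blocks_ge_jordan_nf[OF j, of k \<mu>] that by simp
  qed
  then show thesis by (rule that)
qed

text \<open>The numbers of blocks of exact size are the differences of the cumulated ones, and these vanish for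
  large sizes, so either family determines the other.\<close>
lemma blocks_conditions_iff_balanced:
  fixes A :: "'a::field mat" and \<alpha> \<beta> :: 'a
  assumes A: "A \<in> carrier_mat n n"
  shows "(intertwined (num_blocks_ge A 0) (num_blocks_ge A (to_ac (\<alpha> + \<beta>))) \<and>
    intertwined (num_blocks_ge A (to_ac \<alpha>)) (num_blocks_ge A (to_ac \<beta>)) \<and>
    (\<forall>\<mu>. \<mu> \<notin> {0, to_ac \<alpha>, to_ac \<beta>, to_ac (\<alpha> + \<beta>)} \<longrightarrow>
       (\<forall>k\<ge>1. num_blocks_eq A \<mu> k = num_blocks_eq A (to_ac (\<alpha> + \<beta>) - \<mu>) k)) \<and>
    (CHAR('a) \<noteq> 2 \<longrightarrow> (\<forall>k. num_blocks_eq A (to_ac ((\<alpha> + \<beta>) / 2)) (2 * k + 1) = 0)))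
   \<longleftrightarrow> balanced (to_ac \<alpha>) (to_ac \<beta>) (rank_drop (ac_mat A) (1\<^sub>m n))"
proof -
  have rd: "rank_drop (ac_mat A) (1\<^sub>m n) = num_blocks_ge A"
    by (intro ext) (rule num_blocks_ge_eq_rank_drop[OF A, symmetric])
  have "(\<forall>k\<ge>1. num_blocks_eq A \<mu> k = num_blocks_eq A \<mu>' k) \<longleftrightarrow> (\<forall>k\<ge>1. num_blocks_ge A \<mu> k = num_blocks_ge A \<mu>' k)" for \<mu> \<mu>'
  proof (intro iffI allI impI)
    fix k :: nat assume eq: "\<forall>k\<ge>1. num_blocks_ge A \<mu> k = num_blocks_ge A \<mu>' k" and "k \<ge> 1"
    then show "num_blocks_eq A \<mu> k = num_blocks_eq A \<mu>' k"
      using num_blocks_ge_Suc[OF A, of k \<mu>] num_blocks_ge_Suc[OF A, of k \<mu>'] eq[rule_format, of k] eq[rule_format, of "k + 1"] by simp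
  next
    fix k :: nat assume eq: "\<forall>k\<ge>1. num_blocks_eq A \<mu> k = num_blocks_eq A \<mu>' k" and k: "k \<ge> 1"
    obtain N where N: "\<And>\<mu> k. k \<ge> N \<Longrightarrow> num_blocks_ge A \<mu> k = 0" using num_blocks_ge_eventually_0[OF A] by blast
    have "num_blocks_ge A \<mu> k = num_blocks_ge A \<mu>' k" if "k \<le> max N k" "k \<ge> 1" for k
      using that
    proof (induction rule: inc_induct)
      case base
      then show ?case using N[of "max N k"] by simp
    next
      case (step m)
      then show ?case using num_blocks_ge_Suc[OF A, of m] eq by simp
    qed
    then show "num_blocks_ge A \<mu> k = num_blocks_ge A \<mu>' k" using k by simp
  qed
  moreover have "CHAR('a) \<noteq> 2 \<longleftrightarrow> (2 :: 'a alg_closure) \<noteq> 0"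
  proof -
    have "(2 :: 'a alg_closure) = to_ac 2" by simp
    also have "\<dots> = 0 \<longleftrightarrow> (of_nat 2 :: 'a) = 0" by (simp del: to_ac_numeral)
    also have "\<dots> \<longleftrightarrow> CHAR('a) dvd 2" by (rule of_nat_eq_0_iff_char_dvd)
    also have "\<dots> \<longleftrightarrow> CHAR('a) = 2"
      using CHAR_not_1[where 'a = 'a] prime_nat_iff[of 2] two_is_prime_nat by auto
    finally show ?thesis by simp
  qed
  moreover have "num_blocks_eq A \<mu> (2 * k + 1) = 0 \<longleftrightarrow> num_blocks_ge A \<mu> (2 * k + 1) = num_blocks_ge A \<mu> (2 * k + 2)" for \<mu> k
    using num_blocks_ge_Suc[OF A, of "2 * k + 1" \<mu>] by simp
  ultimately show ?thesis unfolding balanced_def rd by simp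
qed

lemma composite_ac_mat:
  assumes "composite n \<alpha> \<beta> A"
  shows "composite n (to_ac \<alpha>) (to_ac \<beta>) (ac_mat A)"
proof -
  obtain P Q where PQ: "P \<in> carrier_mat n n" "Q \<in> carrier_mat n n" "P * P = P" "Q * Q = Q"
    "A = \<alpha> \<cdot>\<^sub>m P + \<beta> \<cdot>\<^sub>m Q" using assms unfolding composite_def by blast
  have "ac_mat A = to_ac \<alpha> \<cdot>\<^sub>m ac_mat P + to_ac \<beta> \<cdot>\<^sub>m ac_mat Q"
    using PQ(1,2) unfolding PQ(5) by (intro eq_matI) auto
  moreover have "ac_mat P * ac_mat P = ac_mat P" "ac_mat Q * ac_mat Q = ac_mat Q"
    using PQ to_ac.mat_hom_mult by metis+
  ultimately show ?thesis unfolding composite_def using PQ(1,2) by (intro bexI[of _ "ac_mat P"] bexI[of _ "ac_mat Q"]) auto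
qed

section \<open>Idempotents on quotients of the polynomial ring\<close>

definition poly_linear :: "('a::comm_ring_1 poly \<Rightarrow> 'a poly) \<Rightarrow> bool" where
  "poly_linear F \<longleftrightarrow> (\<forall>p q. F (p + q) = F p + F q) \<and> (\<forall>c p. F (smult c p) = smult c (F p))"

text \<open>Multiplication by \<open>X\<close> on \<open>K[X]/\<mu>\<close> is a composite, witnessed by idempotent linear maps on \<open>K[X]\<close>
  itself that preserve the multiples of \<open>\<mu>\<close>. Working upstairs keeps the witnesses explicit and
  the verification a matter of polynomial identities.\<close>
definition composite_mod :: "'a::field \<Rightarrow> 'a \<Rightarrow> 'a poly \<Rightarrow> bool" where
  "composite_mod \<alpha> \<beta> \<mu> \<longleftrightarrow> (\<exists>P Q. poly_linear P \<and> poly_linear Q \<and>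
     (\<forall>f. P (P f) = P f) \<and> (\<forall>f. Q (Q f) = Q f) \<and>
     (\<forall>f. smult \<alpha> (P f) + smult \<beta> (Q f) = [:0, 1:] * f) \<and>
     (\<forall>f. \<mu> dvd P (\<mu> * f)) \<and> (\<forall>f. \<mu> dvd Q (\<mu> * f)))"

text \<open>The substitution of \<open>s - X\<close> for \<open>X\<close>.\<close>
definition reflect :: "'a::comm_ring_1 \<Rightarrow> 'a poly \<Rightarrow> 'a poly" where
  "reflect s p = pcompose p [:s, - 1:]"

lemma reflect_reflect [simp]: "reflect s (reflect s p) = p"
proof -
  have "pcompose [:s, - 1:] [:s, - 1:] = [:0, 1:]" by (simp add: pcompose_pCons)
  then show ?thesis unfolding reflect_def pcompose_assoc[symmetric] by (simp add: pcompose_idR)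
qed

lemma reflect_simps:
  "reflect s (p + q) = reflect s p + reflect s q" "reflect s (p - q) = reflect s p - reflect s q"
  "reflect s (p * q) = reflect s p * reflect s q" "reflect s (smult c p) = smult c (reflect s p)"
  "reflect s [:a, b:] = [:a + b * s, - b:]" "reflect s 0 = 0" "reflect s [:a:] = [:a:]"
  by (simp_all add: reflect_def pcompose_add pcompose_diff pcompose_mult pcompose_smult pcompose_pCons)

lemma reflect_power: "reflect s (f ^ k) = reflect s f ^ k"
  by (induction k) (simp_all add: reflect_simps(3), simp add: reflect_def pcompose_1)

text \<open>The operator \<open>f \<mapsto> (f - f(s - X)) / (2X - s)\<close>, a divided difference for the reflection. It is
  linear over the polynomials that are symmetric under the reflection, and its values are symmetric.
  If \<open>s \<noteq> 0\<close> the denominator is nonzero in every characteristic; in characteristic two it is a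
  constant.\<close>
definition reflection_quotient :: "'a::field \<Rightarrow> 'a poly \<Rightarrow> 'a poly" where
  "reflection_quotient s p = (p - reflect s p) div [:- s, 2:]"

text \<open>The division is exact since \<open>X\<close> and \<open>s - X\<close> agree modulo \<open>2X - s\<close>; the induction makes this work
  also when \<open>2X - s\<close> has degree zero.\<close>
lemma reflection_quotient_mult: "[:- s, 2:] * reflection_quotient s p = p - reflect s (p :: 'a::field poly)"
proof -
  have "[:- s, 2:] dvd p - reflect s p"
  proof (induction p)
    case (pCons a p)
    then obtain q where q: "p - reflect s p = [:- s, 2:] * q" by (auto elim: dvdE)
    have "pCons a p = [:a:] + [:0, 1:] * p" by simp
    then have "pCons a p - reflect s (pCons a p) = [:0, 1:] * p - [:s, - 1:] * reflect s p"
      by (simp only: reflect_simps) simp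
    also have "reflect s p = p - [:- s, 2:] * q" using q by (simp add: algebra_simps)
    also have "[:0, 1:] * p - [:s, - 1:] * (p - [:- s, 2:] * q) = ([:0, 1:] - [:s, - 1:]) * p + [:s, - 1:] * ([:- s, 2:] * q)"
      by (simp only: algebra_simps)
    also have "[:0, 1:] - [:s, - 1:] = [:- s, 2:]" by simp
    also have "[:- s, 2:] * p + [:s, - 1:] * ([:- s, 2:] * q) = [:- s, 2:] * (p + [:s, - 1:] * q)" by (simp only: algebra_simps)
    finally show ?case by (simp only: dvd_triv_left)
  qed (simp add: reflect_simps)
  then show ?thesis unfolding reflection_quotient_def by (simp only: dvd_mult_div_cancel)
qed

lemma reflection_quotient_eqI:
  assumes "(s::'a::field) \<noteq> 0" and "[:- s, 2:] * q = p - reflect s p"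
  shows "reflection_quotient s p = q"
  using assms reflection_quotient_mult[of s p] by (metis mult_left_cancel neg_equal_0_iff_equal pCons_eq_0_iff)

lemma reflection_quotient_add:
  assumes "(s::'a::field) \<noteq> 0"
  shows "reflection_quotient s (p + q) = reflection_quotient s p + reflection_quotient s q"
  by (rule reflection_quotient_eqI[OF assms])
    (simp only: distrib_left reflection_quotient_mult reflect_simps, simp only: algebra_simps)

lemma reflection_quotient_smult:
  assumes "(s::'a::field) \<noteq> 0"
  shows "reflection_quotient s (smult c p) = smult c (reflection_quotient s p)"
  by (rule reflection_quotient_eqI[OF assms])
    (simp only: mult_smult_right reflection_quotient_mult reflect_simps smult_diff_right)

lemma reflect_reflection_quotient:
  assumes "(s::'a::field) \<noteq> 0"
  shows "reflect s (reflection_quotient s p) = reflection_quotient s p"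
proof (rule reflection_quotient_eqI[symmetric, OF assms])
  define d where "d = [:- s, 2:]"
  have "reflect s d = - d" by (simp add: d_def reflect_simps)
  moreover have "reflect s (d * reflection_quotient s p) = reflect s p - p"
    unfolding d_def reflection_quotient_mult reflect_simps reflect_reflect ..
  ultimately have "d * reflect s (reflection_quotient s p) = p - reflect s p"
    by (simp add: reflect_simps(3)) (metis minus_diff_eq minus_minus)
  then show "[:- s, 2:] * reflect s (reflection_quotient s p) = p - reflect s p" by (simp only: d_def)
qed

lemma reflection_quotient_mult_symmetric:
  assumes "(s::'a::field) \<noteq> 0" "reflect s g = g"
  shows "reflection_quotient s (p * g) = reflection_quotient s p * g"
  by (rule reflection_quotient_eqI[OF assms(1)])
    (simp only: mult.assoc[symmetric] reflection_quotient_mult reflect_simps assms(2) left_diff_distrib)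

text \<open>With \<open>\<partial>\<close> the divided difference for \<open>s = \<alpha> + \<beta>\<close>, the witnesses are
  \<open>Q f = X (X - \<alpha>) \<partial>f / \<beta>\<close> and \<open>P f = X (f - (X - \<alpha>) \<partial>f) / \<alpha>\<close>. That their combination is
  multiplication by \<open>X\<close> is immediate. The map \<open>Q\<close> is idempotent because \<open>\<partial>\<close> is linear over symmetric
  polynomials and \<open>\<partial>(X (X - \<alpha>)) = \<beta>\<close>; the map \<open>P\<close> is idempotent because
  \<open>\<partial>(X w) = w\<close> for \<open>w = f - (X - \<alpha>) \<partial>f\<close>. Finally \<open>\<partial>(h g f) = g \<partial>(h f)\<close> for symmetric \<open>g\<close>, and the
  prefactor \<open>X (X - \<alpha>)\<close> supplies the missing divisor \<open>h\<close>.\<close>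
lemma composite_mod_base:
  fixes \<alpha> \<beta> :: "'a::field"
  assumes ab: "\<alpha> \<noteq> 0" "\<beta> \<noteq> 0" "\<alpha> + \<beta> \<noteq> 0"
    and g: "reflect (\<alpha> + \<beta>) g = g" and h: "h dvd [:0, 1:] * [:- \<alpha>, 1:]"
  shows "composite_mod \<alpha> \<beta> (h * g)"
proof -
  let ?s = "\<alpha> + \<beta>"
  define D where "D = reflection_quotient ?s"
  define x where "x = ([:0, 1:] :: 'a poly)"
  define a b where "a = [:\<alpha>:]" and "b = [:\<beta>:]"
  define ai bi where "ai = [:inverse \<alpha>:]" and "bi = [:inverse \<beta>:]"
  have inv: "ai * a = 1" "bi * b = 1" using ab by (simp_all add: ai_def bi_def a_def b_def one_pCons)
  have xa: "[:- \<alpha>, 1:] = x - a" and delta: "[:- ?s, 2:] = 2 * x - (a + b)"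
    by (simp_all add: x_def a_def b_def numeral_poly)
  have refl_x: "reflect ?s x = a + b - x" "reflect ?s a = a"
    unfolding x_def a_def b_def by (simp_all add: reflect_simps)
  have D_mult: "(2 * x - (a + b)) * D p = p - reflect ?s p" for p
    unfolding delta[symmetric] D_def by (rule reflection_quotient_mult)
  have D_eqI: "D p = q" if "(2 * x - (a + b)) * q = p - reflect ?s p" for p q
    using that ab(3) unfolding delta[symmetric] D_def by (intro reflection_quotient_eqI)
  have D_add: "D (p + q) = D p + D q" for p q
    unfolding D_def by (rule reflection_quotient_add[OF ab(3)])
  have D_smult: "D (smult c p) = smult c (D p)" for c p
    unfolding D_def by (rule reflection_quotient_smult[OF ab(3)])
  have D_const: "D ([:c:] * p) = [:c:] * D p" for c p using D_smult[of c p] by simp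
  have D_refl: "reflect ?s (D p) = D p" for p
    unfolding D_def by (rule reflect_reflection_quotient[OF ab(3)])
  define Q where "Q f = bi * (x * (x - a) * D f)" for f
  define P where "P f = ai * (x * (f - (x - a) * D f))" for f
  have lin: "poly_linear Q" "poly_linear P"
    unfolding poly_linear_def Q_def P_def D_add D_smult by (auto simp: algebra_simps smult_diff_right smult_add_right)
  have sum: "a * P f + b * Q f = x * f" for f
  proof -
    have "a * P f + b * Q f = (ai * a) * (x * (f - (x - a) * D f)) + (bi * b) * (x * (x - a) * D f)"
      unfolding P_def Q_def by (simp only: ac_simps)
    then show ?thesis unfolding inv by (simp add: algebra_simps)
  qed
  have du: "D (x * (x - a) * D f) = b * D f" for f
    by (rule D_eqI) (simp only: reflect_simps D_refl refl_x, simp only: algebra_simps, simp add: algebra_simps)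
  have QQ: "Q (Q f) = Q f" for f
  proof -
    have "Q (Q f) = bi * (x * (x - a) * (bi * (b * D f)))"
      unfolding Q_def by (simp only: bi_def D_const du[unfolded b_def] b_def)
    also have "\<dots> = (bi * b) * Q f" unfolding Q_def by (simp only: ac_simps)
    finally show ?thesis by (simp add: inv)
  qed
  have DP: "D (x * (f - (x - a) * D f)) = f - (x - a) * D f" for f
  proof (rule D_eqI)
    have r: "reflect ?s f = f - (2 * x - (a + b)) * D f" unfolding D_mult by simp
    show "(2 * x - (a + b)) * (f - (x - a) * D f)
        = x * (f - (x - a) * D f) - reflect ?s (x * (f - (x - a) * D f))"
      unfolding reflect_simps D_refl refl_x r by (simp add: algebra_simps)
  qed
  have PP: "P (P f) = P f" for f
  proof -
    define w where "w = f - (x - a) * D f"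
    have "D (P f) = ai * w" unfolding P_def ai_def D_const DP w_def ..
    then have "P (P f) = ai * (x * (ai * (x * w) - (x - a) * (ai * w)))"
      unfolding P_def[of "P f"] by (simp only: P_def[of f] w_def)
    also have "\<dots> = (ai * a) * (ai * (x * w))" by (simp add: algebra_simps)
    finally show ?thesis by (simp add: inv P_def w_def)
  qed
  have dQ: "h * g dvd Q (h * g * f)" for f
  proof -
    have "D (h * g * f) = D (h * f) * g"
      using reflection_quotient_mult_symmetric[OF ab(3) g, of "h * f"] by (simp add: ac_simps D_def)
    then have "Q (h * g * f) = (x * (x - a) * g) * (bi * D (h * f))" unfolding Q_def by (simp only: ac_simps)
    moreover have "h * g dvd x * (x - a) * g" using h unfolding xa x_def[symmetric] by (intro mult_dvd_mono) auto
    ultimately show ?thesis by simp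
  qed
  have dP: "h * g dvd P (h * g * f)" for f
  proof -
    have "P k = (ai * a) * P k" for k by (simp add: inv)
    also have "(ai * a) * P k = ai * (x * k - b * Q k)" for k
    proof -
      have "a * P k = x * k - b * Q k" using sum[of k] by (simp add: eq_diff_eq)
      then show ?thesis by (simp only: mult.assoc)
    qed
    finally have "P (h * g * f) = ai * (x * (h * g * f) - b * Q (h * g * f))" by blast
    moreover have "h * g dvd x * (h * g * f)" by (simp add: ac_simps)
    ultimately show ?thesis using dQ[of f] by (simp only: dvd_mult dvd_diff)
  qed
  have "smult \<alpha> (P f) + smult \<beta> (Q f) = [:0, 1:] * f" for f
    using sum[of f] unfolding a_def b_def x_def by simp
  then show ?thesis unfolding composite_mod_def using lin PP QQ dP dQ by blast
qed

lemma composite_mod_swap: "composite_mod \<alpha> \<beta> \<mu> \<Longrightarrow> composite_mod \<beta> \<alpha> \<mu>"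
  unfolding composite_mod_def by (metis add.commute)

text \<open>If \<open>X = \<alpha>P + \<beta>Q\<close> then \<open>\<alpha> + \<beta> - X = \<alpha>(1 - P) + \<beta>(1 - Q)\<close>, so complementary idempotents serve the
  reflected polynomial.\<close>
lemma composite_mod_reflect:
  fixes \<alpha> \<beta> :: "'a::field"
  assumes "composite_mod \<alpha> \<beta> (reflect (\<alpha> + \<beta>) \<mu>)"
  shows "composite_mod \<alpha> \<beta> \<mu>"
proof -
  let ?r = "reflect (\<alpha> + \<beta>)"
  obtain P Q where PQ: "poly_linear P" "poly_linear Q" "\<And>f. P (P f) = P f" "\<And>f. Q (Q f) = Q f"
    "\<And>f. smult \<alpha> (P f) + smult \<beta> (Q f) = [:0, 1:] * f" "\<And>f. ?r \<mu> dvd P (?r \<mu> * f)" "\<And>f. ?r \<mu> dvd Q (?r \<mu> * f)"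
    using assms unfolding composite_mod_def by blast
  define P' where "P' f = f - ?r (P (?r f))" for f
  define Q' where "Q' f = f - ?r (Q (?r f))" for f
  have lin: "poly_linear (\<lambda>f. f - ?r (F (?r f)))" if "poly_linear F" for F
    using that by (simp add: poly_linear_def reflect_simps algebra_simps smult_diff_right)
  have diff: "F (p - q) = F p - F q" if "poly_linear F" for F p q
    using that unfolding poly_linear_def by (metis add_diff_cancel_right' diff_add_cancel)
  have idem: "(f - ?r (F (?r f))) - ?r (F (?r (f - ?r (F (?r f))))) = f - ?r (F (?r f))"
    if "poly_linear F" "\<And>f. F (F f) = F f" for F f
    by (simp add: reflect_simps diff[OF that(1)] that(2))
  have dvd: "\<mu> dvd \<mu> * f - ?r (F (?r (\<mu> * f)))" if d: "\<And>f. ?r \<mu> dvd F (?r \<mu> * f)" for F f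
  proof -
    obtain k where "F (?r \<mu> * ?r f) = ?r \<mu> * k" using d[of "?r f"] unfolding dvd_def by blast
    then have "?r (F (?r (\<mu> * f))) = \<mu> * ?r k" by (simp add: reflect_simps)
    then show ?thesis by simp
  qed
  have "smult \<alpha> (P' f) + smult \<beta> (Q' f) = [:0, 1:] * f" for f
  proof -
    have "smult \<alpha> (P' f) + smult \<beta> (Q' f) = smult (\<alpha> + \<beta>) f - ?r (smult \<alpha> (P (?r f)) + smult \<beta> (Q (?r f)))"
      by (simp add: P'_def Q'_def reflect_simps smult_diff_right smult_add_left)
    also have "\<dots> = [:0, 1:] * f"
      unfolding PQ(5) reflect_simps by (simp add: algebra_simps)
    finally show ?thesis .
  qed
  moreover have "poly_linear P'" "poly_linear Q'"
    unfolding P'_def[abs_def] Q'_def[abs_def] by (rule lin, rule PQ)+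
  moreover have "P' (P' f) = P' f" "Q' (Q' f) = Q' f" for f
    unfolding P'_def Q'_def by (rule idem, rule PQ, rule PQ)+
  moreover have "\<mu> dvd P' (\<mu> * f)" "\<mu> dvd Q' (\<mu> * f)" for f
    unfolding P'_def Q'_def by (rule dvd, rule PQ)+
  ultimately show ?thesis unfolding composite_mod_def by blast
qed

text \<open>Reflection exchanges \<open>0\<close> with \<open>\<alpha> + \<beta>\<close> and \<open>\<alpha>\<close> with \<open>\<beta>\<close>, and exchanging the two idempotents
  exchanges \<open>\<alpha>\<close> with \<open>\<beta>\<close> alone. Together they reduce the four choices of roots to the one of
  the previous construction.\<close>
lemma composite_mod_corner:
  fixes \<alpha> \<beta> :: "'a::field"
  assumes ab: "\<alpha> \<noteq> 0" "\<beta> \<noteq> 0" "\<alpha> + \<beta> \<noteq> 0"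
    and g: "reflect (\<alpha> + \<beta>) g = g" and h: "h dvd [:- r, 1:] * [:- \<rho>, 1:]"
    and r: "r \<in> {0, \<alpha> + \<beta>}" and \<rho>: "\<rho> \<in> {\<alpha>, \<beta>}"
  shows "composite_mod \<alpha> \<beta> (h * g)"
proof -
  have g': "reflect (\<beta> + \<alpha>) g = g" using g by (simp add: add.commute)
  have 0: "composite_mod \<alpha> \<beta> (h * g)" if "h dvd [:0, 1:] * [:- \<rho>, 1:]" "\<rho> \<in> {\<alpha>, \<beta>}" for h \<rho>
  proof (cases "\<rho> = \<alpha>")
    case True
    show ?thesis by (rule composite_mod_base[OF ab g that(1)[unfolded True]])
  next
    case False
    then have \<rho>: "\<rho> = \<beta>" using that(2) by simp
    have "\<beta> + \<alpha> \<noteq> 0" using ab(3) by (simp add: add.commute)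
    from composite_mod_swap[OF composite_mod_base[OF ab(2,1) this g' that(1)[unfolded \<rho>]]]
    show ?thesis .
  qed
  show ?thesis
  proof (cases "r = 0")
    case True
    show ?thesis by (rule 0[OF h[unfolded True minus_zero] \<rho>])
  next
    case False
    then have r: "r = \<alpha> + \<beta>" using r by simp
    obtain k where k: "[:- r, 1:] * [:- \<rho>, 1:] = h * k" using h unfolding dvd_def by blast
    have "reflect (\<alpha> + \<beta>) h * reflect (\<alpha> + \<beta>) k = reflect (\<alpha> + \<beta>) [:- r, 1:] * reflect (\<alpha> + \<beta>) [:- \<rho>, 1:]"
      unfolding reflect_simps(3)[symmetric] k ..
    also have "\<dots> = [:0, 1:] * [:- (\<alpha> + \<beta> - \<rho>), 1:]" unfolding r by (simp add: reflect_simps)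
    finally have "reflect (\<alpha> + \<beta>) h dvd [:0, 1:] * [:- (\<alpha> + \<beta> - \<rho>), 1:]" by (rule dvdI[OF sym])
    then have "composite_mod \<alpha> \<beta> (reflect (\<alpha> + \<beta>) h * g)" by (rule 0) (use \<rho> in \<open>auto\<close>)
    then have "composite_mod \<alpha> \<beta> (reflect (\<alpha> + \<beta>) (h * g))" by (simp only: reflect_simps g)
    then show ?thesis by (rule composite_mod_reflect)
  qed
qed

section \<open>Root multiplicities and symmetry\<close>

lemma order_eqI:
  fixes p :: "'a::idom poly"
  assumes "p = [:- a, 1:] ^ k * q" "poly q a \<noteq> 0"
  shows "order a p = k"
proof -
  have "q \<noteq> 0" using assms(2) by auto
  then show ?thesis using assms by (simp add: order_mult order_power_n_n order_0I)
qed

lemma order_linear: "order a [:- b, 1:] = (if a = b then 1 else 0 :: nat)" for a b :: "'a::idom"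
proof (cases "a = b")
  case True
  then show ?thesis using order_power_n_n[of a 1] by simp
next
  case False
  then show ?thesis by (simp add: order_0I)
qed

lemma order_reflect:
  fixes p :: "'a::field poly"
  assumes p: "p \<noteq> 0"
  shows "order a (reflect s p) = order (s - a) p"
proof -
  obtain q where q: "p = [:- (s - a), 1:] ^ order (s - a) p * q" "\<not> [:- (s - a), 1:] dvd q"
    using order_decomp[OF p, of "s - a"] by blast
  let ?k = "order (s - a) p"
  have rl: "reflect s [:- (s - a), 1:] = - [:- a, 1:]" by (simp add: reflect_simps)
  have "reflect s p = (- [:- a, 1:]) ^ ?k * reflect s q"
    by (subst q(1)) (simp only: reflect_simps(3) reflect_power rl)
  also have "(- [:- a, 1:]) ^ ?k = (-1) ^ ?k * [:- a, 1:] ^ ?k" by (rule power_minus)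
  finally have 1: "reflect s p = [:- a, 1:] ^ ?k * ((- 1) ^ ?k * reflect s q)" by (simp only: ac_simps)
  have "poly (reflect s q) a = poly q (s - a)" by (simp add: reflect_def poly_pcompose)
  then have "poly ((- 1) ^ ?k * reflect s q) a \<noteq> 0" using q(2) by (simp add: poly_eq_0_iff_dvd poly_power)
  from order_eqI[OF 1 this] show ?thesis .
qed

lemma dvd_if_order_le:
  fixes p q :: "'a::alg_closed_field poly"
  assumes "p \<noteq> 0" "q \<noteq> 0" "\<And>a. order a p \<le> order a q"
  shows "p dvd q"
  using assms
proof (induction "degree p" arbitrary: p q)
  case 0
  then obtain c where "p = [:c:]" by (auto elim: degree_eq_zeroE)
  then show ?case using 0 by (auto intro!: const_poly_dvd_iff[THEN iffD2] simp: dvd_field_iff)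
next
  case (Suc d)
  obtain a where a: "poly p a = 0" using alg_closed_imp_poly_has_root[of p] Suc.hyps(2) by auto
  then have "order a p \<noteq> 0" using Suc.prems by (simp add: order_root)
  then have "poly q a = 0" using Suc.prems(3)[of a] by (simp add: order_root)
  obtain p' q' where p': "p = [:- a, 1:] * p'" and q': "q = [:- a, 1:] * q'"
    using a \<open>poly q a = 0\<close> unfolding poly_eq_0_iff_dvd dvd_def by blast
  have nz: "p' \<noteq> 0" "q' \<noteq> 0" using Suc.prems p' q' by auto
  have "degree p = Suc (degree p')" unfolding p' using nz by (subst degree_mult_eq) auto
  moreover have "order b p' \<le> order b q'" for b
    using Suc.prems(3)[of b] order_mult[OF Suc.prems(1)[unfolded p'], of b] order_mult[OF Suc.prems(2)[unfolded q'], of b]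
    unfolding p' q' by simp
  ultimately have "p' dvd q'" using Suc.hyps(1)[of p' q'] nz Suc.hyps(2) by simp
  then show ?case unfolding p' q' by (rule mult_dvd_mono[OF dvd_refl])
qed

text \<open>Two polynomials with the same root multiplicities agree up to a constant \<open>c\<close>. In characteristic two,
  comparing leading coefficients gives \<open>c = 1\<close>. Otherwise the fixed point \<open>h = s / 2\<close> decides: after the
  even power of \<open>X - h\<close> is divided out, which the reflection preserves, the values at \<open>h\<close> agree and
  are not zero. An odd power would change sign and give \<open>c = - 1\<close>.\<close>
lemma reflect_eq_self_if_orders:
  fixes g :: "'a::alg_closed_field poly"
  assumes g: "g \<noteq> 0" and sym: "\<And>a. order (s - a) g = order a g"
    and even: "(2::'a) \<noteq> 0 \<Longrightarrow> even (order (s / 2) g)"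
  shows "reflect s g = g"
proof -
  have r: "reflect s g \<noteq> 0" using g reflect_reflect[of s g] by (metis reflect_simps(6))
  have "g dvd reflect s g" by (rule dvd_if_order_le[OF g r]) (simp add: order_reflect[OF g] sym)
  then obtain k where k: "reflect s g = g * k" unfolding dvd_def by blast
  have dr: "degree (reflect s g) = degree g" by (simp add: reflect_def degree_pcompose)
  have "k \<noteq> 0" using r k by auto
  then have "degree k = 0" using arg_cong[OF k, of degree] g dr by (simp add: degree_mult_eq)
  then obtain c where "k = [:c:]" by (auto elim: degree_eq_zeroE)
  then have c: "reflect s g = smult c g" using k by simp
  have "c = 1"
  proof (cases "(2::'a) = 0")
    case True
    have m: "(- 1 :: 'a) = 1" using True by (metis add.inverse_unique one_add_one)
    have "lead_coeff (reflect s g) = lead_coeff g * (- 1) ^ degree g"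
      unfolding reflect_def by (subst lead_coeff_comp) auto
    moreover have "lead_coeff (reflect s g) = c * lead_coeff g" unfolding c by (rule lead_coeff_smult)
    ultimately have "c * lead_coeff g = lead_coeff g" unfolding m by simp
    then show ?thesis using g by simp
  next
    case False
    define h where "h = s / 2"
    have "h + h = 2 * h" by (rule mult_2[symmetric])
    then have h: "s - h = h" using False by (simp add: h_def field_simps)
    obtain j where j: "order h g = 2 * j" using even[OF False] unfolding h_def by (auto elim: evenE)
    obtain q where q: "g = [:- h, 1:] ^ order h g * q" "\<not> [:- h, 1:] dvd q"
      using order_decomp[OF g, of h] by blast
    define l where "l = [:- h, 1:]"
    have gl: "g = (l * l) ^ j * q" using q(1) unfolding j l_def power_mult power2_eq_square .
    have rl: "reflect s l = - l" unfolding l_def reflect_simps using h by (simp add: algebra_simps)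
    have l0: "l \<noteq> 0" by (simp add: l_def)
    have "reflect s g = (l * l) ^ j * reflect s q" unfolding gl reflect_simps(3) reflect_power rl by simp
    moreover have "smult c g = (l * l) ^ j * smult c q" by (subst gl) simp
    ultimately have "(l * l) ^ j * smult c q = (l * l) ^ j * reflect s q" using c by simp
    then have "smult c q = reflect s q" using l0 by (metis mult_left_cancel no_zero_divisors power_not_zero)
    moreover have "poly (reflect s q) h = poly q h" by (simp add: reflect_def poly_pcompose h)
    ultimately have "c * poly q h = poly q h" by (metis poly_smult)
    moreover have "poly q h \<noteq> 0" using q(2) by (simp add: poly_eq_0_iff_dvd)
    ultimately show ?thesis by simp
  qed
  then show ?thesis using c by simp
qed

interpretation ac_poly: map_poly_inj_idom_hom "to_ac :: 'a::field \<Rightarrow> 'a alg_closure"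
  by unfold_locales

abbreviation ac_poly :: "'a::field poly \<Rightarrow> 'a alg_closure poly" where
  "ac_poly \<equiv> map_poly to_ac"

lemma ac_poly_eq_0_iff [simp]: "ac_poly p = 0 \<longleftrightarrow> p = 0"
  by (simp add: map_poly_eq_0_iff)

lemma ac_poly_mult: "ac_poly (p * q) = ac_poly p * ac_poly q"
  by (rule ac_poly.hom_mult)

lemma ac_poly_linear: "ac_poly [:- c, 1:] = [:- to_ac c, 1:]"
  by (simp add: map_poly_pCons)

lemma poly_ac_poly: "poly (ac_poly p) (to_ac c) = to_ac (poly p c)"
  by (induction p) (auto simp: map_poly_pCons)

lemma ac_poly_reflect: "ac_poly (reflect s p) = reflect (to_ac s) (ac_poly p)"
  unfolding reflect_def to_ac.map_poly_pcompose by (simp add: map_poly_pCons)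

text \<open>The multiplicities at \<open>0\<close> and \<open>\<alpha> + \<beta>\<close> differ by at most one, and so do those at \<open>\<alpha>\<close> and \<open>\<beta>\<close>. Dividing
  by one linear factor \<open>h1\<close> for the first pair and \<open>h2\<close> for the second, where they do differ, leaves a
  polynomial \<open>g\<close> with symmetric multiplicities, hence a symmetric polynomial; the divisor
  \<open>h1 * h2\<close> has its roots in \<open>K\<close>, so the factorization exists there although the
  multiplicities are taken in the closure.\<close>
lemma composite_mod_if_orders:
  fixes \<alpha> \<beta> :: "'a::field" and \<mu> :: "'a poly"
  assumes ab: "\<alpha> \<noteq> 0" "\<beta> \<noteq> 0" "\<alpha> \<noteq> \<beta>" "\<alpha> \<noteq> - \<beta>" and \<mu>: "\<mu> \<noteq> 0"
  defines "m \<equiv> \<lambda>a. order a (ac_poly \<mu>)"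
  assumes m0: "m 0 \<le> m (to_ac (\<alpha> + \<beta>)) + 1" "m (to_ac (\<alpha> + \<beta>)) \<le> m 0 + 1"
    and ma: "m (to_ac \<alpha>) \<le> m (to_ac \<beta>) + 1" "m (to_ac \<beta>) \<le> m (to_ac \<alpha>) + 1"
    and sym: "\<And>a. a \<notin> {0, to_ac \<alpha>, to_ac \<beta>, to_ac (\<alpha> + \<beta>)} \<Longrightarrow> m (to_ac (\<alpha> + \<beta>) - a) = m a"
    and even: "(2 :: 'a alg_closure) \<noteq> 0 \<Longrightarrow> even (m (to_ac ((\<alpha> + \<beta>) / 2)))"
  shows "composite_mod \<alpha> \<beta> \<mu>"
proof -
  let ?s = "\<alpha> + \<beta>"
  have s: "?s \<noteq> 0" using ab(4) by (simp add: eq_neg_iff_add_eq_0)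
  define r where "r = (if m (to_ac ?s) > m 0 then ?s else 0)"
  define \<rho> where "\<rho> = (if m (to_ac \<beta>) > m (to_ac \<alpha>) then \<beta> else \<alpha>)"
  define h1 where "h1 = (if m 0 = m (to_ac ?s) then 1 else [:- r, 1:])"
  define h2 where "h2 = (if m (to_ac \<alpha>) = m (to_ac \<beta>) then 1 else [:- \<rho>, 1:])"
  have root: "poly \<mu> a = 0" if "m (to_ac a) > 0" for a
  proof -
    have "poly (ac_poly \<mu>) (to_ac a) = 0" using that by (simp only: order_root m_def) auto
    then show ?thesis unfolding poly_ac_poly by simp
  qed
  have r_root: "poly \<mu> r = 0" if "m 0 \<noteq> m (to_ac ?s)" using root[of r] that by (auto simp: r_def split: if_splits)
  have \<rho>_root: "poly \<mu> \<rho> = 0" if "m (to_ac \<alpha>) \<noteq> m (to_ac \<beta>)" using root[of \<rho>] that by (auto simp: \<rho>_def split: if_splits)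
  have r\<rho>: "r \<noteq> \<rho>" using ab by (auto simp: r_def \<rho>_def split: if_splits)
  have "h1 dvd \<mu>"
  proof (cases "m 0 = m (to_ac ?s)")
    case False
    then show ?thesis using r_root[OF False] unfolding h1_def poly_eq_0_iff_dvd by simp
  qed (simp add: h1_def)
  then obtain k1 where k1: "\<mu> = h1 * k1" unfolding dvd_def by blast
  have "h2 dvd k1"
  proof (cases "m (to_ac \<alpha>) = m (to_ac \<beta>)")
    case False
    have "poly h1 \<rho> \<noteq> 0" using r\<rho> by (simp add: h1_def)
    then have "poly k1 \<rho> = 0" using \<rho>_root[OF False] unfolding k1 by simp
    then show ?thesis using False unfolding h2_def poly_eq_0_iff_dvd by simp
  qed (simp add: h2_def)
  then obtain g where k1_g: "k1 = h2 * g" unfolding dvd_def by blast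
  have \<mu>_eq: "\<mu> = h1 * h2 * g" unfolding k1 k1_g by simp
  have g: "g \<noteq> 0" and hn: "h1 \<noteq> 0" "h2 \<noteq> 0" using \<mu> \<mu>_eq by auto
  have ord: "m a = order a (ac_poly h1) + order a (ac_poly h2) + order a (ac_poly g)" for a
    unfolding m_def \<mu>_eq ac_poly_mult using g hn by (simp add: order_mult)
  define S A B where "S = to_ac ?s" and "A = to_ac \<alpha>" and "B = to_ac \<beta>"
  note abs = S_def[symmetric] A_def[symmetric] B_def[symmetric]
  have dist: "A \<noteq> 0" "B \<noteq> 0" "A \<noteq> B" "S \<noteq> 0" "S \<noteq> A" "S \<noteq> B" and SAB: "S - A = B" "S - B = A"
    using ab s by (simp_all only: S_def A_def B_def to_ac_eq_0_iff to_ac_eq_iff) auto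
  have ord_lin: "order a (ac_poly [:- c, 1:]) = (if a = to_ac c then 1 else 0)" for a c
    unfolding ac_poly_linear by (rule order_linear)
  have ord_1: "order a (ac_poly 1) = 0" for a by (simp add: order_0I)
  have ord_corner: "order a (ac_poly (if x = y then 1 else [:- (if x < y then d else c), 1:]))
      = (if x < y \<and> a = to_ac d \<or> y < x \<and> a = to_ac c then 1 else 0)" for a c d and x y :: nat
  proof -
    consider "x < y" "\<not> y < x" "x \<noteq> y" | "y < x" "\<not> x < y" "x \<noteq> y" | "x = y" by linarith
    then show ?thesis by cases (simp_all only: ord_lin ord_1 if_True if_False less_irrefl simp_thms)
  qed
  have oh1: "order a (ac_poly h1) = (if m 0 < m S \<and> a = S \<or> m S < m 0 \<and> a = 0 then 1 else 0)" for a
    unfolding h1_def r_def ord_corner abs to_ac_0 ..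
  have oh2: "order a (ac_poly h2) = (if m A < m B \<and> a = B \<or> m B < m A \<and> a = A then 1 else 0)" for a
    unfolding h2_def \<rho>_def ord_corner abs ..
  have o: "order 0 (ac_poly h2) = 0" "order S (ac_poly h2) = 0" "order A (ac_poly h1) = 0" "order B (ac_poly h1) = 0"
    "order 0 (ac_poly h1) = (if m S < m 0 then 1 else 0)" "order S (ac_poly h1) = (if m 0 < m S then 1 else 0)"
    "order A (ac_poly h2) = (if m B < m A then 1 else 0)" "order B (ac_poly h2) = (if m A < m B then 1 else 0)"
    unfolding oh1 oh2 using dist dist[symmetric] by simp_all
  have balance: "p = q" if "x = (if y < x then 1 else 0) + p" "y = (if x < y then 1 else 0) + q" "x \<le> y + 1" "y \<le> x + 1"
    for x y p q :: nat
  proof -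
    consider "x < y" "\<not> y < x" | "y < x" "\<not> x < y" | "\<not> x < y" "\<not> y < x" by linarith
    then show ?thesis
    proof cases
      case 1
      show ?thesis using that(1)[unfolded if_not_P[OF 1(2)]] that(2)[unfolded if_P[OF 1(1)]] that(3,4) 1 by linarith
    next
      case 2
      show ?thesis using that(1)[unfolded if_P[OF 2(1)]] that(2)[unfolded if_not_P[OF 2(2)]] that(3,4) 2 by linarith
    next
      case 3
      show ?thesis using that(1)[unfolded if_not_P[OF 3(2)]] that(2)[unfolded if_not_P[OF 3(1)]] 3 by linarith
    qed
  qed
  have go: "order 0 (ac_poly g) = order S (ac_poly g)"
    by (rule balance[OF ord[of 0, unfolded o add_0_right] ord[of S, unfolded o add_0_right] m0[unfolded abs]])
  have go': "order A (ac_poly g) = order B (ac_poly g)"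
    by (rule balance[OF ord[of A, unfolded o add_0] ord[of B, unfolded o add_0] ma[unfolded abs]])
  have g_sym: "order (S - a) (ac_poly g) = order a (ac_poly g)" for a
  proof (cases "a \<in> {0, A, B, S}")
    case True
    then show ?thesis using go go' SAB by auto
  next
    case False
    then have F: "a \<noteq> 0" "a \<noteq> A" "a \<noteq> B" "a \<noteq> S" by auto
    then have "S - a \<noteq> 0" "S - a \<noteq> A" "S - a \<noteq> B" "S - a \<noteq> S"
      using SAB by (metis diff_diff_eq2 diff_add_cancel add_diff_cancel_left' diff_0_right right_minus_eq)+
    then show ?thesis using sym[unfolded abs, OF False] ord[of a] ord[of "S - a"] F by (simp add: oh1 oh2)
  qed
  have g_even: "even (order (S / 2) (ac_poly g))" if two: "(2 :: 'a alg_closure) \<noteq> 0"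
  proof -
    have h: "to_ac (?s / 2) = S / 2" by (simp add: S_def)
    have "(2::'a) \<noteq> 0" using two by (metis to_ac_0 to_ac_numeral)
    then have "?s / 2 \<notin> {0, \<alpha>, \<beta>, ?s}" using ab s by (auto simp: field_simps)
    then have "to_ac (?s / 2) \<notin> {0, to_ac \<alpha>, to_ac \<beta>, to_ac ?s}" by (simp only: insert_iff empty_iff to_ac_eq_iff to_ac_eq_0_iff) auto
    then have "S / 2 \<noteq> 0" "S / 2 \<noteq> A" "S / 2 \<noteq> B" "S / 2 \<noteq> S" unfolding h abs by blast+
    then have "m (S / 2) = order (S / 2) (ac_poly g)"
      unfolding ord[of "S / 2"] oh1 oh2 by (simp only: simp_thms if_False add_0)
    then show ?thesis using even[OF two] unfolding h by simp
  qed
  have "ac_poly g \<noteq> 0" using g by simp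
  from reflect_eq_self_if_orders[OF this g_sym g_even] have "ac_poly (reflect ?s g) = ac_poly g" unfolding ac_poly_reflect abs .
  then have g_refl: "reflect ?s g = g" by (rule ac_poly.injectivity)
  have h: "h1 * h2 dvd [:- r, 1:] * [:- \<rho>, 1:]" unfolding h1_def h2_def by (intro mult_dvd_mono) auto
  have "r \<in> {0, ?s}" "\<rho> \<in> {\<alpha>, \<beta>}" by (auto simp: r_def \<rho>_def)
  from composite_mod_corner[OF ab(1,2) s g_refl h this] show ?thesis unfolding \<mu>_eq .
qed

section \<open>Cyclic direct summands\<close>

text \<open>Induction on the number of columns: if \<open>L\<close> inverts the matrix \<open>R\<close> of the first \<open>d\<close> columns, the residue
  \<open>z = w - R L w\<close> of the next column \<open>w\<close> is nonzero, and a nonzero entry of it yields a functional that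
  vanishes on the earlier columns and is one on the new column.\<close>
lemma left_inverse_if_injective:
  fixes w :: "nat \<Rightarrow> 'a::field vec"
  assumes w: "\<And>j. w j \<in> carrier_vec n"
    and inj: "\<And>c. c \<in> carrier_vec d \<Longrightarrow> mat n d (\<lambda>(i, j). vec_index (w j) i) *\<^sub>v c = 0\<^sub>v n \<Longrightarrow> c = 0\<^sub>v d"
  shows "\<exists>L \<in> carrier_mat d n. L * mat n d (\<lambda>(i, j). vec_index (w j) i) = 1\<^sub>m d"
  using inj
proof (induction d)
  case 0
  show ?case by (intro bexI[of _ "0\<^sub>m 0 n"]) auto
next
  case (Suc d)
  define R where "R d = mat n d (\<lambda>(i, j). vec_index (w j) i)" for d
  have R: "R d \<in> carrier_mat n d" for d by (simp add: R_def)
  have R_Suc: "R (Suc d) *\<^sub>v c = R d *\<^sub>v vec_first c d + c $ d \<cdot>\<^sub>v w d" if "c \<in> carrier_vec (Suc d)" for c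
    using that w[of d] by (intro eq_vecI) (auto simp: R_def scalar_prod_def vec_first_def)
  have "c = 0\<^sub>v d" if c: "c \<in> carrier_vec d" "R d *\<^sub>v c = 0\<^sub>v n" for c
  proof -
    let ?c = "vec (Suc d) (\<lambda>i. if i < d then c $ i else 0)"
    have "vec_first ?c d = c" using c by (intro eq_vecI) (auto simp: vec_first_def)
    then have "R (Suc d) *\<^sub>v ?c = 0\<^sub>v n + 0 \<cdot>\<^sub>v w d" using c by (subst R_Suc) auto
    also have "\<dots> = 0\<^sub>v n" using w[of d] by (intro eq_vecI) auto
    finally have z: "?c = 0\<^sub>v (Suc d)" using Suc.prems[of ?c] by (simp add: R_def)
    have "c $ i = 0" if "i < d" for i using arg_cong[OF z, of "\<lambda>c. vec_index c i"] that by simp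
    then show ?thesis using c by (intro eq_vecI) auto
  qed
  then obtain L where L: "L \<in> carrier_mat d n" "L * R d = 1\<^sub>m d" using Suc.IH unfolding R_def by blast
  define u where "u = L *\<^sub>v w d"
  have u: "u \<in> carrier_vec d" using L w[of d] by (simp add: u_def)
  define z where "z = w d - R d *\<^sub>v u"
  have z: "z \<in> carrier_vec n" using w R[of d] u by (simp add: z_def)
  have "z \<noteq> 0\<^sub>v n"
  proof
    assume z0: "z = 0\<^sub>v n"
    let ?c = "vec (Suc d) (\<lambda>i. if i < d then - (u $ i) else 1)"
    have "vec_first ?c d = - u" using u by (intro eq_vecI) (auto simp: vec_first_def)
    then have "R (Suc d) *\<^sub>v ?c = R d *\<^sub>v (- u) + 1 \<cdot>\<^sub>v w d" by (subst R_Suc) auto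
    also have "R d *\<^sub>v (- u) = - (R d *\<^sub>v u)" using R[of d] u by (intro eq_vecI) auto
    also have "- (R d *\<^sub>v u) + 1 \<cdot>\<^sub>v w d = z" using w[of d] R[of d] by (intro eq_vecI) (auto simp: z_def)
    finally have "?c = 0\<^sub>v (Suc d)" using z0 Suc.prems[of ?c] by (simp add: R_def)
    from arg_cong[OF this, of "\<lambda>c. vec_index c d"] show False by simp
  qed
  then obtain i where i: "i < n" "z $ i \<noteq> 0" using z by (metis carrier_vecD eq_vecI index_zero_vec)
  define y where "y = inverse (z $ i) \<cdot>\<^sub>v (unit_vec n i - row (R d * L) i)"
  have rowc: "row (R d * L) i \<in> carrier_vec n" using L by (intro carrier_vecI) simp
  have y: "y \<in> carrier_vec n" using rowc by (simp add: y_def)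
  have y_eq: "y \<bullet> v = inverse (z $ i) * (v $ i - (R d *\<^sub>v (L *\<^sub>v v)) $ i)" if v: "v \<in> carrier_vec n" for v
  proof -
    have "(unit_vec n i - row (R d * L) i) \<bullet> v = unit_vec n i \<bullet> v - row (R d * L) i \<bullet> v"
      using rowc v by (intro minus_scalar_prod_distrib[of _ n]) auto
    also have "unit_vec n i \<bullet> v = v $ i" using v i by simp
    also have "row (R d * L) i \<bullet> v = (R d * L *\<^sub>v v) $ i" using i R[of d] by simp
    also have "R d * L *\<^sub>v v = R d *\<^sub>v (L *\<^sub>v v)" using assoc_mult_mat_vec[OF R L(1) v] .
    finally show ?thesis unfolding y_def using rowc v by (subst smult_scalar_prod_distrib[of _ n]) auto
  qed
  have w_unit: "w j = R d *\<^sub>v unit_vec d j" if "j < d" for j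
    using that w[of j] R[of d] by (intro eq_vecI) (auto simp: R_def)
  have Lw: "L *\<^sub>v w j = unit_vec d j" if "j < d" for j
  proof -
    have "L *\<^sub>v w j = L * R d *\<^sub>v unit_vec d j" unfolding w_unit[OF that] by (rule assoc_mult_mat_vec[OF L(1) R, symmetric]) simp
    then show ?thesis unfolding L(2) by simp
  qed
  have yw: "y \<bullet> w j = 0" if "j < d" for j
    unfolding y_eq[OF w] Lw[OF that] w_unit[OF that, symmetric] by simp
  have yd: "y \<bullet> w d = 1"
    unfolding y_eq[OF w] using i(2) w[of d] R[of d] i(1) unfolding u_def[symmetric] by (simp add: z_def)
  define M where "M = mat (Suc d) n (\<lambda>(k, l). if k < d then L $$ (k, l) - u $ k * y $ l else y $ l)"
  have M: "M \<in> carrier_mat (Suc d) n" by (simp add: M_def)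
  have rowM: "row M k = (if k < d then row L k - u $ k \<cdot>\<^sub>v y else y)" if "k < Suc d" for k
    using that L y by (intro eq_vecI) (auto simp: M_def)
  have Mw: "row M k \<bullet> w j = (if k = j then 1 else 0)" if "k < Suc d" "j < Suc d" for k j
  proof (cases "k < d")
    case True
    have "row M k \<bullet> w j = row L k \<bullet> w j - u $ k * (y \<bullet> w j)"
      unfolding rowM[OF that(1)] using True L y w[of j]
      by (simp add: minus_scalar_prod_distrib[of _ n] smult_scalar_prod_distrib[of _ n])
    also have "row L k \<bullet> w j = (L *\<^sub>v w j) $ k" using True L by simp
    also have "\<dots> = (if j = d then vec_index u k else if k = j then 1 else 0)"
      using that True Lw[of j] by (auto simp: u_def less_Suc_eq)
    finally show ?thesis using that True yw[of j] yd by (auto simp: less_Suc_eq)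
  next
    case False
    then show ?thesis using that yw[of j] yd unfolding rowM[OF that(1)] by (auto simp: less_Suc_eq)
  qed
  have "M * R (Suc d) = 1\<^sub>m (Suc d)"
  proof (rule eq_matI)
    fix k j assume kj: "k < dim_row (1\<^sub>m (Suc d) :: 'a mat)" "j < dim_col (1\<^sub>m (Suc d) :: 'a mat)"
    have "col (R (Suc d)) j = w j" using kj w[of j] by (intro eq_vecI) (auto simp: R_def)
    then show "(M * R (Suc d)) $$ (k, j) = 1\<^sub>m (Suc d) $$ (k, j)" using kj M R[of "Suc d"] Mw[of k j] by simp
  qed (use M R[of "Suc d"] in auto)
  then show ?case using M unfolding R_def by blast
qed

text \<open>The determinant is the product of the diagonal entries.\<close>
lemma unitriangular_inverse:
  fixes H :: "'a::field mat"
  assumes H: "H \<in> carrier_mat d d" and tri: "\<And>i j. j \<le> i \<Longrightarrow> i < d \<Longrightarrow> H $$ (i, j) = (if i = j then 1 else 0)"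
  obtains G where "G \<in> carrier_mat d d" "G * H = 1\<^sub>m d" "H * G = 1\<^sub>m d"
proof -
  have "det H = prod_list (diag_mat H)"
    by (rule det_upper_triangular[OF _ H]) (use H tri in auto)
  also have "\<dots> = 1" using H tri by (auto simp: diag_mat_def intro!: prod_list_neutral)
  finally have "det H \<noteq> 0" by simp
  from det_non_zero_imp_unit[OF H this, of undefined] show thesis
    using that by (auto simp: Units_def ring_mat_simps)
qed

text \<open>Non-divisibility is detected at a single prime. The prime is found as a divisor of least positive
  degree, and its full power is removed from \<open>g\<close> if it divides \<open>f\<close>, so
  that the induction continues with the cofactor.\<close>
lemma exists_prime_power_not_dvd:
  fixes f g :: "'a::field poly"
  assumes "g \<noteq> 0" "\<not> g dvd f"
  shows "\<exists>p b. prime_elem p \<and> p ^ b dvd g \<and> \<not> p ^ b dvd f"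
  using assms
proof (induction "degree g" arbitrary: g rule: less_induct)
  case less
  have "degree g \<noteq> 0"
  proof
    assume "degree g = 0"
    then have "g dvd 1" using less.prems(1) by (simp add: is_unit_iff_degree)
    then show False using less.prems(2) dvd_trans one_dvd by blast
  qed
  define S where "S = {q. q dvd g \<and> degree q \<noteq> 0}"
  have "g \<in> S" using \<open>degree g \<noteq> 0\<close> by (simp add: S_def)
  then obtain p where p: "p \<in> S" "\<And>q. q \<in> S \<Longrightarrow> degree p \<le> degree q"
    using ex_has_least_nat[of "\<lambda>q. q \<in> S" g degree] by blast
  have p0: "p \<noteq> 0" "p dvd g" "degree p \<noteq> 0" using p(1) less.prems(1) by (auto simp: S_def)
  have "irreducible p"
  proof (rule irreducibleI)
    show "p \<noteq> 0" by (rule p0)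
    show "\<not> p dvd 1" using p0 by (simp add: is_unit_iff_degree)
    fix a b assume ab: "p = a * b"
    have ab0: "a \<noteq> 0" "b \<noteq> 0" using ab p0 by auto
    have deg: "degree p = degree a + degree b" unfolding ab using ab0 by (rule degree_mult_eq)
    have "a dvd g" using p0(2) unfolding ab by (rule dvd_mult_left)
    then have "degree a = 0 \<or> degree p \<le> degree a" using p(2)[of a] by (auto simp: S_def)
    then have "degree a = 0 \<or> degree b = 0" using deg by auto
    then show "a dvd 1 \<or> b dvd 1" using ab0 by (simp add: is_unit_iff_degree)
  qed
  then have prime: "prime_elem p" by (rule field_poly_irreducible_imp_prime)
  obtain b g0 where b: "g = p ^ b * g0" "\<not> p dvd g0"
  proof -
    have "b \<le> degree g" if "p ^ b dvd g" for b
    proof -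
      have "b \<le> degree (p ^ b)" using p0 by (simp add: degree_power_eq)
      also have "\<dots> \<le> degree g" using dvd_imp_degree_le[OF that less.prems(1)] .
      finally show ?thesis .
    qed
    then obtain b where b: "p ^ b dvd g" "\<And>c. p ^ c dvd g \<Longrightarrow> c \<le> b"
      using ex_has_greatest_nat[of "\<lambda>b. p ^ b dvd g" 0 "\<lambda>b. b" "Suc (degree g)"]
      by (auto simp: less_Suc_eq_le)
    obtain g0 where g0: "g = p ^ b * g0" using b(1) unfolding dvd_def by blast
    have "\<not> p dvd g0"
    proof
      assume "p dvd g0"
      then have "p ^ Suc b dvd g" unfolding g0 by (simp add: mult.commute mult_dvd_mono)
      then show False using b(2)[of "Suc b"] by simp
    qed
    with g0 show thesis by (rule that)
  qed
  show ?case
  proof (cases "p ^ b dvd f")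
    case False
    moreover have "p ^ b dvd g" unfolding b(1) by (rule dvd_triv_left)
    ultimately show ?thesis using prime by blast
  next
    case True
    have g0: "g0 \<noteq> 0" using less.prems b by auto
    have "b \<noteq> 0"
    proof
      assume "b = 0"
      then have "g = g0" using b(1) by simp
      then show False using b(2) p0(2) by simp
    qed
    then have "degree (p ^ b) \<noteq> 0" using p0 by (simp add: degree_power_eq)
    moreover have "degree g = degree (p ^ b) + degree g0" unfolding b(1) using g0 p0 by (intro degree_mult_eq) auto
    ultimately have "degree g0 < degree g" by simp
    moreover have "\<not> g0 dvd f"
    proof
      assume "g0 dvd f"
      then obtain h where h: "f = g0 * h" unfolding dvd_def by blast
      have "p ^ b dvd h" using True unfolding h using prime_power_dvd_multD[OF prime _ _ b(2)] \<open>b \<noteq> 0\<close> by blast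
      then show False using less.prems(2) unfolding b(1) h by (simp add: mult.commute mult_dvd_mono)
    qed
    ultimately obtain q c where "prime_elem q" "q ^ c dvd g0" "\<not> q ^ c dvd f" using less.hyps g0 by blast
    then show ?thesis using b(1) by (metis dvd_mult)
  qed
qed

lemma exists_poly_coeff_vec:
  fixes c :: "'a::comm_ring_1 vec"
  assumes "c \<in> carrier_vec d"
  obtains p where "vec d (coeff p) = c" "p = 0 \<or> degree p < d"
proof -
  define p where "p = (\<Sum>j<d. monom (vec_index c j) j)"
  have cp: "coeff p j = (if j < d then vec_index c j else 0)" for j by (auto simp: p_def coeff_sum)
  have "degree p < d" if "p \<noteq> 0"
  proof (rule ccontr)
    assume "\<not> degree p < d"
    then have "coeff p (degree p) = 0" unfolding cp by simp
    then show False using that by simp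
  qed
  then show thesis using assms by (intro that[of p]) (auto intro!: eq_vecI simp: cp)
qed

text \<open>A generator of the annihilator ideal of \<open>x\<close>, determined up to a unit.\<close>
definition is_order_poly :: "'a::field mat \<Rightarrow> nat \<Rightarrow> 'a vec \<Rightarrow> 'a poly \<Rightarrow> bool" where
  "is_order_poly A n x \<mu> \<longleftrightarrow> \<mu> \<noteq> 0 \<and> (\<forall>p. mat_poly A p *\<^sub>v x = 0\<^sub>v n \<longleftrightarrow> \<mu> dvd p)"

context
  fixes A :: "'a::field mat" and n :: nat
  assumes A: "A \<in> carrier_mat n n"
begin

private lemmas mp = mat_poly_carrier[OF A]
private lemmas mpv = mat_poly_vec_carrier[OF A]

lemma mat_poly_vec_expand:
  assumes x: "x \<in> carrier_vec n" and p: "p = 0 \<or> degree p < d"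
  shows "mat_poly A p *\<^sub>v x
    = mat n d (\<lambda>(i, j). vec_index (mat_poly A (monom 1 j) *\<^sub>v x) i) *\<^sub>v vec d (coeff p)"
proof (rule eq_vecI)
  fix i assume "i < dim_vec (mat n d (\<lambda>(i, j). vec_index (mat_poly A (monom 1 j) *\<^sub>v x) i) *\<^sub>v vec d (coeff p))"
  then have i: "i < n" by simp
  define \<phi> where "\<phi> p = vec_index (mat_poly A p *\<^sub>v x) i" for p
  have "\<phi> p = (\<Sum>j<d. coeff p j * \<phi> (monom 1 j))"
  proof (rule poly_functional_expand[OF _ _ p])
    show "\<phi> (p + q) = \<phi> p + \<phi> q" for p q
      using i carrier_vecD[OF mpv[OF x, of p]] carrier_vecD[OF mpv[OF x, of q]]
      by (simp only: \<phi>_def mat_poly_add_vec[OF A x] index_add_vec)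
    show "\<phi> (smult c p) = c * \<phi> p" for c p
    proof -
      have "(c \<cdot>\<^sub>m mat_poly A p) *\<^sub>v x = c \<cdot>\<^sub>v (mat_poly A p *\<^sub>v x)"
        using x mp[of p] by (intro eq_vecI) auto
      then show ?thesis using i carrier_vecD[OF mpv[OF x, of p]]
        by (simp only: \<phi>_def mat_poly_smult[OF A] index_smult_vec)
    qed
  qed
  then show "vec_index (mat_poly A p *\<^sub>v x) i
     = vec_index (mat n d (\<lambda>(i, j). vec_index (mat_poly A (monom 1 j) *\<^sub>v x) i) *\<^sub>v vec d (coeff p)) i"
    using i by (simp add: \<phi>_def scalar_prod_def atLeast0LessThan mult.commute)
qed (use mp[of p] in auto)

text \<open>The \<open>n + 1\<close> vectors \<open>x, A x, \<dots>, A^n x\<close> cannot be the columns of a matrix with a left inverse,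
  as its rank is at most \<open>n\<close>.\<close>
lemma exists_annihilating_poly:
  assumes x: "x \<in> carrier_vec n"
  obtains p where "p \<noteq> 0" "mat_poly A p *\<^sub>v x = 0\<^sub>v n"
proof -
  define w where "w j = mat_poly A (monom 1 j) *\<^sub>v x" for j
  define R where "R = mat n (Suc n) (\<lambda>(i, j). vec_index (w j) i)"
  have w: "w j \<in> carrier_vec n" for j unfolding w_def by (rule mpv[OF x])
  have R: "R \<in> carrier_mat n (Suc n)" by (simp add: R_def)
  have "\<exists>c. c \<in> carrier_vec (Suc n) \<and> R *\<^sub>v c = 0\<^sub>v n \<and> c \<noteq> 0\<^sub>v (Suc n)"
  proof (rule ccontr)
    assume "\<not> ?thesis"
    then obtain L where L: "L \<in> carrier_mat (Suc n) n" "L * R = 1\<^sub>m (Suc n)"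
      using left_inverse_if_injective[of w n "Suc n", OF w] unfolding R_def by blast
    have "Suc n = matrix_rank (L * R)" unfolding L(2) by simp
    also have "\<dots> \<le> matrix_rank R" by (rule matrix_rank_mult_le_right[OF L(1) R])
    also have "\<dots> = matrix_rank (1\<^sub>m n * R)" using R by simp
    also have "\<dots> \<le> matrix_rank (1\<^sub>m n :: 'a mat)" by (rule matrix_rank_mult_le_left[OF one_carrier_mat R])
    finally show False by simp
  qed
  then obtain c where c: "c \<in> carrier_vec (Suc n)" "R *\<^sub>v c = 0\<^sub>v n" "c \<noteq> 0\<^sub>v (Suc n)" by blast
  obtain p where pc: "vec (Suc n) (coeff p) = c" and deg: "p = 0 \<or> degree p < Suc n"
    using exists_poly_coeff_vec[OF c(1)] .
  have "p \<noteq> 0"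
  proof
    assume "p = 0"
    then have "vec (Suc n) (coeff p) = 0\<^sub>v (Suc n)" by (intro eq_vecI) auto
    then show False using pc c(3) by simp
  qed
  have "mat_poly A p *\<^sub>v x = R *\<^sub>v vec (Suc n) (coeff p)"
    unfolding R_def w_def by (rule mat_poly_vec_expand[OF x deg])
  then have "mat_poly A p *\<^sub>v x = 0\<^sub>v n" unfolding pc c(2) .
  with \<open>p \<noteq> 0\<close> show thesis by (rule that)
qed

lemma exists_order_poly:
  assumes x: "x \<in> carrier_vec n"
  shows "\<exists>\<mu>. is_order_poly A n x \<mu>"
proof -
  define S where "S = {p. p \<noteq> 0 \<and> mat_poly A p *\<^sub>v x = 0\<^sub>v n}"
  obtain p where "p \<in> S" using exists_annihilating_poly[OF x] unfolding S_def by blast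
  then obtain \<mu> where \<mu>: "\<mu> \<in> S" "\<And>q. q \<in> S \<Longrightarrow> degree \<mu> \<le> degree q"
    using ex_has_least_nat[of "\<lambda>q. q \<in> S" p degree] by blast
  have m: "\<mu> \<noteq> 0" "mat_poly A \<mu> *\<^sub>v x = 0\<^sub>v n" using \<mu>(1) by (auto simp: S_def)
  have mult: "mat_poly A (k * \<mu>) *\<^sub>v x = 0\<^sub>v n" for k
    unfolding mat_poly_mult_vec[OF A x, symmetric] m(2) using mp[of k] by auto
  have "\<mu> dvd p" if p: "mat_poly A p *\<^sub>v x = 0\<^sub>v n" for p
  proof -
    have "mat_poly A p *\<^sub>v x = mat_poly A (p div \<mu> * \<mu>) *\<^sub>v x + mat_poly A (p mod \<mu>) *\<^sub>v x"
      unfolding mat_poly_add_vec[OF A x, symmetric] by simp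
    then have "mat_poly A (p mod \<mu>) *\<^sub>v x = 0\<^sub>v n" unfolding p mult using mpv[OF x, of "p mod \<mu>"] by simp
    then have "p mod \<mu> \<noteq> 0 \<longrightarrow> degree \<mu> \<le> degree (p mod \<mu>)" using \<mu>(2)[of "p mod \<mu>"] by (simp add: S_def)
    then have "p mod \<mu> = 0" using degree_mod_less[OF m(1), of p] by linarith
    then show ?thesis by auto
  qed
  moreover have "mat_poly A p *\<^sub>v x = 0\<^sub>v n" if "\<mu> dvd p" for p
    using that mult by (auto simp: dvd_def mult.commute)
  ultimately show ?thesis unfolding is_order_poly_def using m(1) by blast
qed

lemma order_poly_cyclic_left_inverse:
  assumes x: "x \<in> carrier_vec n" and \<mu>: "is_order_poly A n x \<mu>"
  shows "\<exists>L \<in> carrier_mat (degree \<mu>) n.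
     L * mat n (degree \<mu>) (\<lambda>(i, j). vec_index (mat_poly A (monom 1 j) *\<^sub>v x) i) = 1\<^sub>m (degree \<mu>)"
proof (rule left_inverse_if_injective)
  let ?d = "degree \<mu>"
  fix c assume c: "c \<in> carrier_vec ?d" "mat n ?d (\<lambda>(i, j). vec_index (mat_poly A (monom 1 j) *\<^sub>v x) i) *\<^sub>v c = 0\<^sub>v n"
  obtain p where pc: "vec ?d (coeff p) = c" and deg: "p = 0 \<or> degree p < ?d"
    using exists_poly_coeff_vec[OF c(1)] .
  from mat_poly_vec_expand[OF x deg] have "mat_poly A p *\<^sub>v x = 0\<^sub>v n" unfolding pc c(2) .
  then have "\<mu> dvd p" using \<mu> by (simp add: is_order_poly_def)
  then have "p = 0" using deg dvd_imp_degree_le[of \<mu> p] by (metis not_le)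
  then show "c = 0\<^sub>v ?d" unfolding pc[symmetric] by (intro eq_vecI) auto
qed (rule mpv[OF x])

lemma order_poly_degree_le:
  assumes x: "x \<in> carrier_vec n" and \<mu>: "is_order_poly A n x \<mu>"
  shows "degree \<mu> \<le> n"
proof -
  let ?d = "degree \<mu>"
  define R where "R = mat n ?d (\<lambda>(i, j). vec_index (mat_poly A (monom 1 j) *\<^sub>v x) i)"
  have R: "R \<in> carrier_mat n ?d" by (simp add: R_def)
  obtain L where L: "L \<in> carrier_mat ?d n" "L * R = 1\<^sub>m ?d"
    using order_poly_cyclic_left_inverse[OF x \<mu>] unfolding R_def by blast
  have "?d = matrix_rank (L * R)" unfolding L(2) by simp
  also have "\<dots> \<le> matrix_rank L" by (rule matrix_rank_mult_le_left[OF L(1) R])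
  also have "\<dots> \<le> n" using matrix_rank_plus_kernel_dim[OF L(1)] by simp
  finally show ?thesis .
qed

text \<open>The order polynomial of greatest degree in an invariant subspace annihilates the whole subspace. If
  the order \<open>g\<close> of \<open>w\<close> did not divide \<open>f\<close>, some prime power \<open>p^b\<close> would divide \<open>g\<close> while only \<open>p^a\<close>, with
  \<open>a < b\<close>, divides \<open>f\<close>. Then \<open>p^a(A) x\<close> has order \<open>f1 = f / p^a\<close>, which is prime to \<open>p\<close>, a multiple of
  \<open>w\<close> has order \<open>p^b\<close>, and their sum has order \<open>f1 p^b\<close>, of larger degree than \<open>f\<close>.\<close>
lemma max_order_poly_annihilates:
  assumes x: "x \<in> carrier_vec n" and f: "is_order_poly A n x f"
    and W: "x \<in> W" "W \<subseteq> carrier_vec n" "\<And>u v. u \<in> W \<Longrightarrow> v \<in> W \<Longrightarrow> u + v \<in> W"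
      "\<And>p v. v \<in> W \<Longrightarrow> mat_poly A p *\<^sub>v v \<in> W"
    and max: "\<And>v \<mu>. v \<in> W \<Longrightarrow> is_order_poly A n v \<mu> \<Longrightarrow> degree \<mu> \<le> degree f"
    and w: "w \<in> W"
  shows "mat_poly A f *\<^sub>v w = 0\<^sub>v n"
proof (rule ccontr)
  assume neq: "mat_poly A f *\<^sub>v w \<noteq> 0\<^sub>v n"
  have wc: "w \<in> carrier_vec n" using w W by auto
  obtain g where g: "is_order_poly A n w g" using exists_order_poly[OF wc] by blast
  have f0: "f \<noteq> 0" and g0: "g \<noteq> 0" using f g by (auto simp: is_order_poly_def)
  have "\<not> g dvd f" using neq g by (simp add: is_order_poly_def)
  then obtain p b where p: "prime_elem p" "p ^ b dvd g" "\<not> p ^ b dvd f"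
    using exists_prime_power_not_dvd[OF g0] by blast
  have p0: "p \<noteq> 0" "degree p \<noteq> 0" using p(1) by (auto simp: prime_elem_def is_unit_iff_degree)
  obtain a where a: "p ^ a dvd f" "\<And>c. p ^ c dvd f \<Longrightarrow> c \<le> a"
  proof -
    have "c < b" if "p ^ c dvd f" for c
      using that p(3) power_le_dvd by (metis not_le)
    then show thesis using ex_has_greatest_nat[of "\<lambda>c. p ^ c dvd f" 0 "\<lambda>c. c" b] that by auto
  qed
  have ab: "a < b" using a(1) p(3) power_le_dvd by (metis not_le)
  have b0: "b > 0" using ab by simp
  obtain f1 where f1: "f = p ^ a * f1" using a(1) unfolding dvd_def by blast
  have pf1: "\<not> p dvd f1"
  proof
    assume "p dvd f1"
    then have "p ^ Suc a dvd f" unfolding f1 by (simp add: mult.commute mult_dvd_mono)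
    then show False using a(2)[of "Suc a"] by simp
  qed
  obtain g1 where g1: "g = p ^ b * g1" using p(2) unfolding dvd_def by blast
  define x' where "x' = mat_poly A (p ^ a) *\<^sub>v x"
  define w' where "w' = mat_poly A g1 *\<^sub>v w"
  have x': "mat_poly A q *\<^sub>v x' = 0\<^sub>v n \<longleftrightarrow> f1 dvd q" for q
  proof -
    have "mat_poly A q *\<^sub>v x' = 0\<^sub>v n \<longleftrightarrow> p ^ a * f1 dvd p ^ a * q"
      using f unfolding x'_def mat_poly_mult_vec[OF A x] is_order_poly_def f1 by (simp add: mult.commute)
    then show ?thesis using p0 by simp
  qed
  have w': "mat_poly A q *\<^sub>v w' = 0\<^sub>v n \<longleftrightarrow> p ^ b dvd q" for q
  proof -
    have "mat_poly A q *\<^sub>v w' = 0\<^sub>v n \<longleftrightarrow> g1 * p ^ b dvd g1 * q"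
      using g unfolding w'_def mat_poly_mult_vec[OF A wc] is_order_poly_def g1 by (simp add: mult.commute)
    then show ?thesis using g0 g1 by simp
  qed
  have x'W: "x' \<in> W" and w'W: "w' \<in> W" unfolding x'_def w'_def by (rule W(4)[OF W(1)], rule W(4)[OF w])
  then have c: "x' \<in> carrier_vec n" "w' \<in> carrier_vec n" using W(2) by auto
  have sW: "x' + w' \<in> W" using x'W w'W by (rule W(3))
  then have sc: "x' + w' \<in> carrier_vec n" using W(2) by auto
  obtain r where r: "is_order_poly A n (x' + w') r" using exists_order_poly[OF sc] by blast
  have r0: "r \<noteq> 0" using r by (simp add: is_order_poly_def)
  have comb: "mat_poly A (q * r) *\<^sub>v x' + mat_poly A (q * r) *\<^sub>v w' = 0\<^sub>v n" for q
  proof -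
    have "mat_poly A (q * r) *\<^sub>v (x' + w') = 0\<^sub>v n" using r by (simp add: is_order_poly_def)
    then show ?thesis using mult_add_distrib_mat_vec[OF mp c] by simp
  qed
  have "mat_poly A (f1 * r) *\<^sub>v x' = 0\<^sub>v n" by (simp add: x')
  then have "mat_poly A (f1 * r) *\<^sub>v w' = 0\<^sub>v n" using comb[of f1] mpv[OF c(2), of "f1 * r"] by simp
  then have "p ^ b dvd f1 * r" by (simp add: w')
  then have pr: "p ^ b dvd r" using prime_power_dvd_multD[OF p(1) _ b0 pf1] by blast
  have "mat_poly A (p ^ b * r) *\<^sub>v w' = 0\<^sub>v n" by (simp add: w')
  then have "mat_poly A (p ^ b * r) *\<^sub>v x' = 0\<^sub>v n" using comb[of "p ^ b"] mpv[OF c(1), of "p ^ b * r"] by simp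
  then have "f1 dvd p ^ b * r" by (simp add: x')
  then obtain k where k: "p ^ b * r = f1 * k" unfolding dvd_def by blast
  have "p ^ b dvd f1 * k" unfolding k[symmetric] by (rule dvd_triv_left)
  then have "p ^ b dvd k" using prime_power_dvd_multD[OF p(1) _ b0 pf1] by blast
  then obtain l where "k = p ^ b * l" unfolding dvd_def by blast
  then have r_eq: "r = f1 * l" using k p0 by (simp add: mult.left_commute)
  have "p ^ b dvd l" using pr prime_power_dvd_multD[OF p(1) _ b0 pf1] unfolding r_eq by blast
  then have dvd: "f1 * p ^ b dvd r" unfolding r_eq by (rule mult_dvd_mono[OF dvd_refl])
  have f10: "f1 \<noteq> 0" using f0 f1 by auto
  have "degree f = a * degree p + degree f1" unfolding f1 using p0 f10 by (simp add: degree_mult_eq degree_power_eq)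
  also have "\<dots> < b * degree p + degree f1" using ab p0 by simp
  also have "\<dots> = degree (f1 * p ^ b)" using p0 f10 by (simp add: degree_mult_eq degree_power_eq)
  also have "\<dots> \<le> degree r" by (rule dvd_imp_degree_le[OF dvd r0])
  also have "\<dots> \<le> degree f" by (rule max[OF sW r])
  finally show False by simp
qed

end

text \<open>The matrix, with respect to \<open>1, X, X\<^sup>2, \<dots>\<close>, of the map that \<open>F\<close> induces on \<open>K[X]/\<mu>\<close> when it is linear and
  preserves the multiples of \<open>\<mu>\<close>.\<close>
definition mod_mat :: "'a::field poly \<Rightarrow> ('a poly \<Rightarrow> 'a poly) \<Rightarrow> 'a mat" where
  "mod_mat \<mu> F = mat (degree \<mu>) (degree \<mu>) (\<lambda>(i, j). coeff (F (monom 1 j) mod \<mu>) i)"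

abbreviation companion :: "'a::field poly \<Rightarrow> 'a mat" where
  "companion \<mu> \<equiv> mod_mat \<mu> ((*) [:0, 1:])"

lemma mod_mat_carrier [simp]: "mod_mat \<mu> F \<in> carrier_mat (degree \<mu>) (degree \<mu>)"
  by (simp add: mod_mat_def)

lemma mod_mat_mult:
  fixes \<mu> :: "'a::field poly"
  assumes \<mu>: "\<mu> \<noteq> 0" and F: "poly_linear F" "\<And>f. \<mu> dvd F (\<mu> * f)"
  shows "mod_mat \<mu> F * mod_mat \<mu> G = mod_mat \<mu> (\<lambda>f. F (G f))"
proof (rule eq_matI)
  let ?d = "degree \<mu>"
  fix i j assume "i < dim_row (mod_mat \<mu> (\<lambda>f. F (G f)))" "j < dim_col (mod_mat \<mu> (\<lambda>f. F (G f)))"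
  then have ij: "i < ?d" "j < ?d" by (auto simp: mod_mat_def)
  define p where "p = G (monom 1 j)"
  define \<phi> where "\<phi> q = coeff (F q mod \<mu>) i" for q
  have "\<phi> (p mod \<mu>) = (\<Sum>k<?d. coeff (p mod \<mu>) k * \<phi> (monom 1 k))"
  proof (rule poly_functional_expand)
    show "\<phi> (p + q) = \<phi> p + \<phi> q" "\<phi> (smult c p) = c * \<phi> p" for p q c
      using F(1) by (simp_all add: \<phi>_def poly_linear_def poly_mod_add_left mod_smult_left)
    show "p mod \<mu> = 0 \<or> degree (p mod \<mu>) < ?d" by (rule degree_mod_less[OF \<mu>])
  qed
  moreover have "\<phi> (p mod \<mu>) = \<phi> p"
  proof -
    have "F p = F (p mod \<mu>) + F (\<mu> * (p div \<mu>))"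
      using F(1) unfolding poly_linear_def by (metis mod_mult_div_eq)
    then show ?thesis unfolding \<phi>_def using F(2)[of "p div \<mu>"] by (simp add: poly_mod_add_left dvd_imp_mod_0)
  qed
  ultimately have "(\<Sum>k<?d. coeff (p mod \<mu>) k * \<phi> (monom 1 k)) = \<phi> p" by simp
  moreover have "(mod_mat \<mu> F * mod_mat \<mu> G) $$ (i, j) = (\<Sum>k<?d. coeff (p mod \<mu>) k * \<phi> (monom 1 k))"
    using ij by (simp add: mod_mat_def scalar_prod_def p_def \<phi>_def atLeast0LessThan mult.commute)
  ultimately show "(mod_mat \<mu> F * mod_mat \<mu> G) $$ (i, j) = mod_mat \<mu> (\<lambda>f. F (G f)) $$ (i, j)"
    using ij by (simp add: mod_mat_def p_def \<phi>_def)
qed (auto simp: mod_mat_def)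

lemma composite_companion:
  fixes \<mu> :: "'a::field poly"
  assumes \<mu>: "\<mu> \<noteq> 0" and c: "composite_mod \<alpha> \<beta> \<mu>"
  shows "composite (degree \<mu>) \<alpha> \<beta> (companion \<mu>)"
proof -
  obtain P Q where PQ: "poly_linear P" "poly_linear Q" "\<And>f. P (P f) = P f" "\<And>f. Q (Q f) = Q f"
    "\<And>f. smult \<alpha> (P f) + smult \<beta> (Q f) = [:0, 1:] * f" "\<And>f. \<mu> dvd P (\<mu> * f)" "\<And>f. \<mu> dvd Q (\<mu> * f)"
    using c unfolding composite_mod_def by blast
  have "mod_mat \<mu> P * mod_mat \<mu> P = mod_mat \<mu> P" "mod_mat \<mu> Q * mod_mat \<mu> Q = mod_mat \<mu> Q"
    unfolding mod_mat_mult[OF \<mu> PQ(1,6)] mod_mat_mult[OF \<mu> PQ(2,7)] PQ(3,4) by simp_all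
  moreover have "companion \<mu> = \<alpha> \<cdot>\<^sub>m mod_mat \<mu> P + \<beta> \<cdot>\<^sub>m mod_mat \<mu> Q"
  proof (rule eq_matI)
    fix i j assume "i < dim_row (\<alpha> \<cdot>\<^sub>m mod_mat \<mu> P + \<beta> \<cdot>\<^sub>m mod_mat \<mu> Q)" "j < dim_col (\<alpha> \<cdot>\<^sub>m mod_mat \<mu> P + \<beta> \<cdot>\<^sub>m mod_mat \<mu> Q)"
    then have ij: "i < degree \<mu>" "j < degree \<mu>" by (auto simp: mod_mat_def)
    have "companion \<mu> $$ (i, j) = coeff ((smult \<alpha> (P (monom 1 j)) + smult \<beta> (Q (monom 1 j))) mod \<mu>) i"
      unfolding PQ(5) using ij by (simp add: mod_mat_def)
    then show "companion \<mu> $$ (i, j) = (\<alpha> \<cdot>\<^sub>m mod_mat \<mu> P + \<beta> \<cdot>\<^sub>m mod_mat \<mu> Q) $$ (i, j)"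
      using ij by (simp add: mod_mat_def poly_mod_add_left mod_smult_left)
  qed (auto simp: mod_mat_def)
  ultimately show ?thesis unfolding composite_def by (intro bexI[of _ "mod_mat \<mu> P"] bexI[of _ "mod_mat \<mu> Q"]) auto
qed

text \<open>The image of a nonzero idempotent that commutes with \<open>A\<close> has a cyclic direct summand, isomorphic to
  \<open>K[X]/\<mu>\<close> with \<open>\<mu>\<close> the minimal polynomial of \<open>A\<close> there. The columns of \<open>R\<close> are the vectors
  \<open>x, A x, \<dots>, A^(d - 1) x\<close> for some \<open>x\<close> with order polynomial \<open>\<mu>\<close>. For the projection, let \<open>T\<close> be a functional
  that reads off the coefficient of \<open>A^(d - 1) x\<close>. The functionals \<open>T A^(d - 1), \<dots>, T A, T\<close> span a space
  that is stable under \<open>A\<close>, because \<open>\<mu>(A)\<close> vanishes on the image of the idempotent, and their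
  pairing with the columns of \<open>R\<close> is unitriangular. So they form a dual system up to an invertible
  matrix, and their common kernel is a stable complement.\<close>
lemma cyclic_summand:
  fixes A e :: "'a::field mat"
  assumes A: "A \<in> carrier_mat n n" and e: "e \<in> carrier_mat n n" and ee: "e * e = e" and eA: "e * A = A * e"
    and e0: "e \<noteq> 0\<^sub>m n n"
  obtains \<mu> R L where "degree \<mu> > 0" "R \<in> carrier_mat n (degree \<mu>)" "L \<in> carrier_mat (degree \<mu>) n"
    "L * R = 1\<^sub>m (degree \<mu>)" "A * R = R * companion \<mu>" "L * A = companion \<mu> * L" "e * R = R" "L * e = L"
    "mat_poly A \<mu> * e = 0\<^sub>m n n"
proof -
  note mp = mat_poly_carrier[OF A]
  note mpv = mat_poly_vec_carrier[OF A]
  have e_mp: "e * mat_poly A p = mat_poly A p * e" for p by (rule mat_poly_intertwine[OF A e A eA])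
  define W where "W = {v \<in> carrier_vec n. e *\<^sub>v v = v}"
  have Wc: "W \<subseteq> carrier_vec n" by (auto simp: W_def)
  have Wadd: "u + v \<in> W" if "u \<in> W" "v \<in> W" for u v
    using that by (simp add: W_def mult_add_distrib_mat_vec[OF e])
  have Wmp: "mat_poly A p *\<^sub>v v \<in> W" if "v \<in> W" for p v
  proof -
    have v: "v \<in> carrier_vec n" "e *\<^sub>v v = v" using that by (auto simp: W_def)
    have "e *\<^sub>v (mat_poly A p *\<^sub>v v) = e * mat_poly A p *\<^sub>v v" by (rule assoc_mult_mat_vec[OF e mp v(1), symmetric])
    also have "\<dots> = mat_poly A p *\<^sub>v (e *\<^sub>v v)" unfolding e_mp by (rule assoc_mult_mat_vec[OF mp e v(1)])
    finally show ?thesis using mpv[OF v(1)] v(2) by (simp add: W_def)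
  qed
  have W_image: "e *\<^sub>v v \<in> W" if "v \<in> carrier_vec n" for v
    using assoc_mult_mat_vec[OF e e that] e that ee by (simp add: W_def)
  define good where "good d \<longleftrightarrow> (\<exists>x \<mu>. x \<in> W \<and> is_order_poly A n x \<mu> \<and> degree \<mu> = d)" for d
  have "0\<^sub>v n \<in> carrier_vec n" by simp
  from W_image[OF this] exists_order_poly[OF A] obtain d0 where "good d0" unfolding good_def using Wc by blast
  moreover have "d < Suc n" if "good d" for d
    using that order_poly_degree_le[OF A] Wc unfolding good_def by (auto simp: less_Suc_eq_le)
  ultimately obtain d where d: "good d" "\<And>k. good k \<Longrightarrow> k \<le> d"
    using ex_has_greatest_nat[of good d0 "\<lambda>d. d" "Suc n"] by blast
  then obtain x \<mu> where x: "x \<in> W" "is_order_poly A n x \<mu>" "degree \<mu> = d" unfolding good_def by blast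
  have max: "degree f \<le> degree \<mu>" if "v \<in> W" "is_order_poly A n v f" for v f
    using d(2)[of "degree f"] that x(3) unfolding good_def by blast
  have xc: "x \<in> carrier_vec n" and ex: "e *\<^sub>v x = x" using x by (auto simp: W_def)
  have ann: "mat_poly A \<mu> *\<^sub>v w = 0\<^sub>v n" if "w \<in> W" for w
    by (rule max_order_poly_annihilates[OF A xc x(2) x(1) Wc Wadd Wmp max that])
  have \<mu>0: "\<mu> \<noteq> 0" using x(2) by (simp add: is_order_poly_def)
  have \<mu>e: "mat_poly A \<mu> * e = 0\<^sub>m n n"
  proof (rule mat_col_eqI)
    fix j assume "j < dim_col (0\<^sub>m n n :: 'a mat)"
    then have j: "j < n" by simp
    have "col (mat_poly A \<mu> * e) j = mat_poly A \<mu> *\<^sub>v col e j" by (rule col_mult2[OF mp e j])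
    also have "col e j = e *\<^sub>v unit_vec n j" using e j by (intro eq_vecI) auto
    also have "mat_poly A \<mu> *\<^sub>v (e *\<^sub>v unit_vec n j) = 0\<^sub>v n" by (rule ann[OF W_image]) simp
    finally show "col (mat_poly A \<mu> * e) j = col (0\<^sub>m n n) j" using j by simp
  qed (use mp e in auto)
  have d_pos: "d > 0"
  proof (rule ccontr)
    assume "\<not> d > 0"
    then obtain c where c: "\<mu> = [:c:]" using x(3) by (auto elim: degree_eq_zeroE)
    then have "mat_poly A \<mu> = c \<cdot>\<^sub>m 1\<^sub>m n" using A by (simp add: mat_poly_pCons[OF A])
    then have "c \<cdot>\<^sub>m e = 0\<^sub>m n n" using \<mu>e e by (simp add: mult_smult_assoc_mat[of _ n n _ n])
    moreover have "c \<noteq> 0" using \<mu>0 c by auto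
    moreover have "inverse c \<cdot>\<^sub>m (c \<cdot>\<^sub>m e) = e" using \<open>c \<noteq> 0\<close> by (intro eq_matI) auto
    ultimately have "inverse c \<cdot>\<^sub>m 0\<^sub>m n n = e" by metis
    moreover have "inverse c \<cdot>\<^sub>m 0\<^sub>m n n = (0\<^sub>m n n :: 'a mat)" by (intro eq_matI) auto
    ultimately show False using e0 by simp
  qed
  define C where "C = companion \<mu>"
  have C: "C \<in> carrier_mat d d" using x(3) by (auto simp: C_def)
  define R where "R = mat n d (\<lambda>(i, j). vec_index (mat_poly A (monom 1 j) *\<^sub>v x) i)"
  have R: "R \<in> carrier_mat n d" by (simp add: R_def)
  have colR: "col R j = mat_poly A (monom 1 j) *\<^sub>v x" if "j < d" for j
    using that mpv[OF xc, of "monom 1 j"] mp[of "monom 1 j"] by (intro eq_vecI) (auto simp: R_def)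
  have eR: "e * R = R"
  proof (rule mat_col_eqI)
    fix j assume "j < dim_col R"
    then have j: "j < d" using R by simp
    have "col (e * R) j = e *\<^sub>v col R j" by (rule col_mult2[OF e R j])
    then show "col (e * R) j = col R j" unfolding colR[OF j] using Wmp[OF x(1), of "monom 1 j"] by (simp add: W_def)
  qed (use e R in auto)
  have expand: "mat_poly A p *\<^sub>v x = R *\<^sub>v vec d (coeff (p mod \<mu>))" for p
  proof -
    have "mat_poly A p *\<^sub>v x = mat_poly A (p mod \<mu>) *\<^sub>v x + mat_poly A (p div \<mu>) *\<^sub>v (mat_poly A \<mu> *\<^sub>v x)"
      unfolding mat_poly_mult_vec[OF A xc] mat_poly_add_vec[OF A xc, symmetric] by (simp add: add.commute)
    also have "mat_poly A \<mu> *\<^sub>v x = 0\<^sub>v n" by (rule ann[OF x(1)])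
    also have "mat_poly A (p div \<mu>) *\<^sub>v 0\<^sub>v n = 0\<^sub>v n" using mp[of "p div \<mu>"] by auto
    also have "mat_poly A (p mod \<mu>) *\<^sub>v x + 0\<^sub>v n = mat_poly A (p mod \<mu>) *\<^sub>v x" using mpv[OF xc] by simp
    also have "\<dots> = R *\<^sub>v vec d (coeff (p mod \<mu>))" unfolding R_def
      by (rule mat_poly_vec_expand[OF A xc]) (use degree_mod_less[OF \<mu>0] x(3) in auto)
    finally show ?thesis .
  qed
  have AR: "A * R = R * C"
  proof (rule mat_col_eqI)
    fix j assume "j < dim_col (R * C)"
    then have j: "j < d" using C by simp
    have "col (A * R) j = mat_poly A [:0, 1:] *\<^sub>v (mat_poly A (monom 1 j) *\<^sub>v x)"
      unfolding col_mult2[OF A R j] colR[OF j] mat_poly_monom_1[OF A] ..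
    also have "\<dots> = R *\<^sub>v vec d (coeff (([:0, 1:] * monom 1 j) mod \<mu>))"
      unfolding mat_poly_mult_vec[OF A xc] by (rule expand)
    also have "vec d (coeff (([:0, 1:] * monom 1 j) mod \<mu>)) = col C j"
      using j x(3) by (intro eq_vecI) (auto simp: C_def mod_mat_def)
    also have "R *\<^sub>v col C j = col (R * C) j" by (rule col_mult2[OF R C j, symmetric])
    finally show "col (A * R) j = col (R * C) j" .
  qed (use A R C in auto)
  obtain Y where Y: "Y \<in> carrier_mat d n" "Y * R = 1\<^sub>m d"
    using order_poly_cyclic_left_inverse[OF A xc x(2)] unfolding x(3) R_def by blast
  \<comment> \<open>Cutting down by \<open>e\<close> makes the functionals vanish on the kernel of \<open>e\<close>, where \<open>\<mu>(A)\<close> need not be zero.\<close>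
  define Ye where "Ye = Y * e"
  have Ye: "Ye \<in> carrier_mat d n" using Y e by (simp add: Ye_def)
  have Yee: "Ye * e = Ye" unfolding Ye_def using Y e ee by (simp add: assoc_mult_mat[of _ d n _ n _ n])
  define T where "T = mat 1 n (\<lambda>(_, k). Ye $$ (d - 1, k))"
  have T: "T \<in> carrier_mat 1 n" by (simp add: T_def)
  have rowT: "row T 0 = row Ye (d - 1)" using Ye d_pos by (intro eq_vecI) (auto simp: T_def)
  have Te: "T * e = T"
  proof (rule eq_matI)
    fix i k assume "i < dim_row T" "k < dim_col T"
    then have ik: "i = 0" "k < n" by (auto simp: T_def)
    have "(T * e) $$ (i, k) = row Ye (d - 1) \<bullet> col e k" using ik T e rowT by simp
    also have "\<dots> = (Ye * e) $$ (d - 1, k)" using ik Ye e d_pos by simp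
    also have "Ye * e = Ye" by (rule Yee)
    finally show "(T * e) $$ (i, k) = T $$ (i, k)" using ik by (simp add: T_def)
  qed (use T e in auto)
  have T_top: "vec_index (T *\<^sub>v (mat_poly A (monom 1 m) *\<^sub>v x)) 0 = (if m = d - 1 then 1 else 0)" if m: "m < d" for m
  proof -
    let ?v = "mat_poly A (monom 1 m) *\<^sub>v x"
    have v: "?v \<in> carrier_vec n" by (rule mpv[OF xc])
    have "vec_index (T *\<^sub>v ?v) 0 = vec_index (Ye *\<^sub>v ?v) (d - 1)" using T Ye d_pos rowT by simp
    also have "Ye *\<^sub>v ?v = Y *\<^sub>v (e *\<^sub>v ?v)" unfolding Ye_def by (rule assoc_mult_mat_vec[OF Y(1) e v])
    also have "e *\<^sub>v ?v = col R m" using Wmp[OF x(1), of "monom 1 m"] colR[OF m] by (simp add: W_def)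
    also have "Y *\<^sub>v col R m = col (Y * R) m" by (rule col_mult2[OF Y(1) R m, symmetric])
    finally show ?thesis unfolding Y(2) using m d_pos by auto
  qed
  \<comment> \<open>The rows are in reverse order of the powers, so that the pairing with \<open>R\<close> is upper triangular.\<close>
  define L0 where "L0 = mat d n (\<lambda>(i, k). (T * mat_poly A (monom 1 (d - 1 - i))) $$ (0, k))"
  have L0: "L0 \<in> carrier_mat d n" by (simp add: L0_def)
  have rowL0: "row L0 i = row (T * mat_poly A (monom 1 (d - 1 - i))) 0" if "i < d" for i
    using that T mp[of "monom 1 (d - 1 - i)"] by (intro eq_vecI) (auto simp: L0_def)
  define H where "H = L0 * R"
  have H: "H \<in> carrier_mat d d" using L0 R by (simp add: H_def)
  have H_entry: "H $$ (i, j) = (if i = j then 1 else 0)" if "j \<le> i" "i < d" for i j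
  proof -
    have j: "j < d" using that by simp
    let ?m = "monom 1 (d - 1 - i) :: 'a poly"
    have "H $$ (i, j) = row (T * mat_poly A ?m) 0 \<bullet> (mat_poly A (monom 1 j) *\<^sub>v x)"
      unfolding H_def using that j L0 R rowL0[OF that(2)] colR[OF j] by simp
    also have "\<dots> = vec_index (T * mat_poly A ?m *\<^sub>v (mat_poly A (monom 1 j) *\<^sub>v x)) 0"
      using T by simp
    also have "T * mat_poly A ?m *\<^sub>v (mat_poly A (monom 1 j) *\<^sub>v x) = T *\<^sub>v (mat_poly A (?m * monom 1 j) *\<^sub>v x)"
      unfolding mat_poly_mult_vec[OF A xc, symmetric] by (rule assoc_mult_mat_vec[OF T mp mpv[OF xc]])
    also have "?m * monom 1 j = monom 1 (d - 1 - i + j)" unfolding mult_monom by simp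
    finally show ?thesis using T_top[of "d - 1 - i + j"] that by auto
  qed
  obtain G where G: "G \<in> carrier_mat d d" "G * H = 1\<^sub>m d" "H * G = 1\<^sub>m d"
    using unitriangular_inverse[OF H H_entry] .
  define L where "L = G * L0"
  have L: "L \<in> carrier_mat d n" using G L0 by (simp add: L_def)
  have LR: "L * R = 1\<^sub>m d" unfolding L_def using G L0 R by (simp add: assoc_mult_mat[of _ d d _ n _ d] H_def)
  have L0_L: "L0 = H * L" unfolding L_def using G L0 H by (simp flip: assoc_mult_mat[of _ d d _ d _ n])
  have L0e: "L0 * e = L0"
  proof (rule eq_matI)
    fix i k assume "i < dim_row L0" "k < dim_col L0"
    then have ik: "i < d" "k < n" using L0 by auto
    let ?M = "mat_poly A (monom 1 (d - 1 - i))"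
    have "(L0 * e) $$ (i, k) = (T * ?M * e) $$ (0, k)" using ik L0 e T mp rowL0[OF ik(1)] by simp
    also have "T * ?M * e = T * (e * ?M)" unfolding e_mp by (rule assoc_mult_mat[OF T mp e])
    also have "\<dots> = T * ?M" using assoc_mult_mat[OF T e mp] Te by simp
    finally show "(L0 * e) $$ (i, k) = L0 $$ (i, k)" using ik by (simp add: L0_def)
  qed (use L0 e in auto)
  have Le: "L * e = L" unfolding L_def using G L0 e L0e by (simp add: assoc_mult_mat[of _ d d _ n _ n])
  \<comment> \<open>The action of \<open>A\<close> on the span of the functionals, from the expansion of \<open>X^(d - i)\<close> modulo \<open>\<mu>\<close>.\<close>
  define C' where "C' = mat d d (\<lambda>(i, j). coeff (monom 1 (d - i) mod \<mu>) (d - Suc j))"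
  have C': "C' \<in> carrier_mat d d" by (simp add: C'_def)
  have L0A: "L0 * A = C' * L0"
  proof (rule eq_matI)
    fix i k assume "i < dim_row (C' * L0)" "k < dim_col (C' * L0)"
    then have ik: "i < d" "k < n" using L0 C' by auto
    define \<psi> where "\<psi> p = (T * mat_poly A p) $$ (0, k)" for p
    have \<psi>_add: "\<psi> (p + q) = \<psi> p + \<psi> q" for p q
      unfolding \<psi>_def mat_poly_add[OF A] mult_add_distrib_mat[OF T mp mp] using ik T mp[of q] by (subst index_add_mat) auto
    have \<psi>_smult: "\<psi> (smult c p) = c * \<psi> p" for c p
      unfolding \<psi>_def mat_poly_smult[OF A] mult_smult_distrib[OF T mp] using ik T mp[of p] by (subst index_smult_mat) auto
    have \<psi>_\<mu>: "\<psi> (q * \<mu>) = 0" for q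
    proof -
      have "T * mat_poly A (q * \<mu>) = T * e * mat_poly A (q * \<mu>)" unfolding Te ..
      also have "\<dots> = T * (mat_poly A (q * \<mu>) * e)" unfolding e_mp[symmetric] by (rule assoc_mult_mat[OF T e mp])
      also have "mat_poly A (q * \<mu>) * e = mat_poly A q * (mat_poly A \<mu> * e)"
        unfolding mat_poly_mult[OF A] by (rule assoc_mult_mat[OF mp mp e])
      also have "\<dots> = 0\<^sub>m n n" unfolding \<mu>e using mp by (rule right_mult_zero_mat)
      finally show ?thesis using ik T by (simp add: \<psi>_def)
    qed
    have \<psi>_mod: "\<psi> p = \<psi> (p mod \<mu>)" for p
      using \<psi>_add[of "p div \<mu> * \<mu>" "p mod \<mu>"] \<psi>_\<mu>[of "p div \<mu>"] by simp
    let ?q = "monom 1 (d - i) mod \<mu>"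
    have "(L0 * A) $$ (i, k) = (T * mat_poly A (monom 1 (d - 1 - i)) * A) $$ (0, k)"
      using ik L0 A T mp rowL0[OF ik(1)] by simp
    also have "T * mat_poly A (monom 1 (d - 1 - i)) * A = T * (mat_poly A (monom 1 (d - 1 - i)) * mat_poly A [:0, 1:])"
      unfolding mat_poly_monom_1[OF A] by (rule assoc_mult_mat[OF T mp A])
    also have "\<dots> = T * mat_poly A (monom 1 (d - 1 - i) * [:0, 1:])" unfolding mat_poly_mult[OF A] ..
    also have "monom 1 (d - 1 - i) * [:0, 1:] = (monom 1 (d - i) :: 'a poly)"
      using ik by (simp add: x_as_monom mult_monom Suc_diff_Suc)
    finally have "(L0 * A) $$ (i, k) = \<psi> (monom 1 (d - i))" by (simp add: \<psi>_def)
    also have "\<dots> = \<psi> ?q" by (rule \<psi>_mod)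
    also have "\<dots> = (\<Sum>l<d. coeff ?q l * \<psi> (monom 1 l))"
      by (rule poly_functional_expand[OF \<psi>_add \<psi>_smult]) (use degree_mod_less[OF \<mu>0] x(3) in auto)
    also have "\<dots> = (\<Sum>j<d. coeff ?q (d - Suc j) * \<psi> (monom 1 (d - Suc j)))"
      by (rule sum.nat_diff_reindex[symmetric])
    also have "\<dots> = (C' * L0) $$ (i, k)"
      using ik C' L0 by (simp add: C'_def L0_def \<psi>_def scalar_prod_def atLeast0LessThan)
    finally show "(L0 * A) $$ (i, k) = (C' * L0) $$ (i, k)" .
  qed (use L0 A C' in auto)
  define C'' where "C'' = G * C' * H"
  have C'': "C'' \<in> carrier_mat d d" using G C' H by (simp add: C''_def)
  have LA: "L * A = C'' * L"
  proof -
    have "L * A = G * (L0 * A)" unfolding L_def by (rule assoc_mult_mat[OF G(1) L0 A])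
    also have "\<dots> = G * (C' * (H * L))" unfolding L0A L0_L[symmetric] ..
    also have "\<dots> = C'' * L" unfolding C''_def using G C' H L
      by (simp add: assoc_mult_mat[of _ d d _ d _ n] assoc_mult_mat[of _ d d _ d _ d] mult_carrier_mat[of _ d d _ d])
    finally show ?thesis .
  qed
  have "C'' = C'' * (L * R)" unfolding LR using C'' by simp
  also have "\<dots> = L * A * R" unfolding LA by (rule assoc_mult_mat[OF C'' L R, symmetric])
  also have "\<dots> = L * (R * C)" unfolding AR[symmetric] by (rule assoc_mult_mat[OF L A R])
  also have "\<dots> = L * R * C" by (rule assoc_mult_mat[OF L R C, symmetric])
  finally have CC: "C'' = C" unfolding LR using C by simp
  show thesis
    by (rule that[of \<mu> R L]) (use d_pos R L LR AR LA eR Le \<mu>e in \<open>simp_all add: x(3) CC C_def[symmetric]\<close>)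
qed

section \<open>Block numbers of a cyclic summand\<close>

text \<open>A companion matrix has at most one Jordan block for each eigenvalue.\<close>
lemma companion_char_rank:
  fixes \<mu> :: "'a::field poly"
  shows "degree \<mu> \<le> matrix_rank (char_matrix (ac_mat (companion \<mu>)) c) + 1"
proof (cases "degree \<mu>")
  case (Suc m)
  define M where "M = char_matrix (ac_mat (companion \<mu>)) c"
  have cC: "ac_mat (companion \<mu>) \<in> carrier_mat (Suc m) (Suc m)" using mod_mat_carrier[of \<mu>] Suc by (auto simp del: mod_mat_carrier)
  have M: "M \<in> carrier_mat (Suc m) (Suc m)" unfolding M_def by (rule char_matrix_closed[OF cC])
  have entry: "M $$ (Suc i, j) = (if i = j then 1 else if Suc i = j then - c else 0)" if "i < m" "j < m" for i j
  proof -
    have "([:0, 1:] * monom 1 j :: 'a poly) mod \<mu> = monom 1 (Suc j)"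
    proof -
      have "([:0, 1:] * monom 1 j :: 'a poly) = monom 1 (Suc j)" by (simp add: x_as_monom mult_monom)
      then show ?thesis using that Suc by (simp add: mod_poly_less degree_monom_eq)
    qed
    then show ?thesis using that Suc cC by (auto simp: M_def char_matrix_def mod_mat_def coeff_monom)
  qed
  \<comment> \<open>Deleting the first row and the last column leaves a unitriangular matrix.\<close>
  define T where "T = mat m (Suc m) (\<lambda>(i, k). if k = Suc i then 1 else 0 :: 'a alg_closure)"
  define J where "J = mat (Suc m) m (\<lambda>(k, j). if k = j then 1 else 0 :: 'a alg_closure)"
  have TJ: "T \<in> carrier_mat m (Suc m)" "J \<in> carrier_mat (Suc m) m" by (simp_all add: T_def J_def)
  define U where "U = T * (M * J)"
  have U: "U \<in> carrier_mat m m" using TJ M by (simp add: U_def)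
  have U_entry: "U $$ (i, j) = M $$ (Suc i, j)" if "i < m" "j < m" for i j
  proof -
    have MJ: "(M * J) $$ (k, j) = M $$ (k, j)" if "k < Suc m" for k
    proof -
      have "(M * J) $$ (k, j) = (\<Sum>l\<in>{0..<Suc m}. M $$ (k, l) * (if l = j then 1 else 0))"
        using that \<open>j < m\<close> M TJ by (simp add: scalar_prod_def J_def)
      then show ?thesis using \<open>j < m\<close> by (simp add: if_distrib cong: if_cong)
    qed
    have "U $$ (i, j) = (\<Sum>k\<in>{0..<Suc m}. (if k = Suc i then 1 else 0) * (M * J) $$ (k, j))"
      unfolding U_def using that M TJ by (simp add: scalar_prod_def T_def)
    also have "\<dots> = (M * J) $$ (Suc i, j)" using that by (simp add: if_distrib if_distribR cong: if_cong)
    finally show ?thesis using MJ that by simp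
  qed
  obtain V where V: "V \<in> carrier_mat m m" "V * U = 1\<^sub>m m"
    by (rule unitriangular_inverse[OF U]) (auto simp: U_entry entry)
  have "m = matrix_rank (V * U)" unfolding V(2) by simp
  also have "\<dots> \<le> matrix_rank U" by (rule matrix_rank_mult_le_right[OF V(1) U])
  also have "\<dots> \<le> matrix_rank (M * J)" unfolding U_def by (rule matrix_rank_mult_le_right) (use TJ M in auto)
  also have "\<dots> \<le> matrix_rank M" by (rule matrix_rank_mult_le_left[OF M TJ(2)])
  finally show ?thesis using Suc by (simp add: M_def)
qed simp

text \<open>Each linear factor of \<open>q\<close> lowers the rank by at most one.\<close>
lemma matrix_rank_mat_poly_ge:
  fixes C :: "'a::alg_closed_field mat"
  assumes C: "C \<in> carrier_mat d d" and rk: "\<And>c. d \<le> matrix_rank (char_matrix C c) + 1" and q: "q \<noteq> 0"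
  shows "d \<le> matrix_rank (mat_poly C q) + degree q"
  using q
proof (induction "degree q" arbitrary: q)
  case 0
  then obtain c where c: "q = [:c:]" by (auto elim: degree_eq_zeroE)
  then have "mat_poly C q = c \<cdot>\<^sub>m 1\<^sub>m d" using C by (simp add: mat_poly_pCons[OF C])
  then show ?case using 0 c by simp
next
  case (Suc k)
  note mp = mat_poly_carrier[OF C]
  obtain a where "poly q a = 0" using alg_closed_imp_poly_has_root[of q] Suc.hyps(2) by auto
  then obtain p where p: "q = [:- a, 1:] * p" unfolding poly_eq_0_iff_dvd dvd_def by blast
  have p0: "p \<noteq> 0" using Suc.prems p by auto
  have deg: "degree q = Suc (degree p)" unfolding p using p0 by (subst degree_mult_eq) auto
  then have IH: "d \<le> matrix_rank (mat_poly C p) + degree p" using Suc.hyps(1)[of p] p0 Suc.hyps(2) by simp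
  have "matrix_rank (mat_poly C [:- a, 1:] * 1\<^sub>m d) + matrix_rank (1\<^sub>m d * mat_poly C p)
     \<le> matrix_rank (1\<^sub>m d :: 'a mat) + matrix_rank (mat_poly C [:- a, 1:] * (1\<^sub>m d * mat_poly C p))"
    by (rule frobenius_rank_inequality[OF mp one_carrier_mat mp])
  then have "matrix_rank (mat_poly C [:- a, 1:]) + matrix_rank (mat_poly C p) \<le> d + matrix_rank (mat_poly C q)"
    unfolding p mat_poly_mult[OF C] right_mult_one_mat[OF mp] left_mult_one_mat[OF mp] by simp
  moreover have "d \<le> matrix_rank (mat_poly C [:- a, 1:]) + 1" unfolding mat_poly_linear[OF C] by (rule rk)
  ultimately show ?case using IH deg by simp
qed

text \<open>Write \<open>\<mu> = (X - c)^j q\<close>. The two factors lower the rank by at most their degrees, and together they lower it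
  by the sum \<open>d\<close> of the degrees, so each of them attains its bound: the rank of the \<open>j\<close>-th power is
  \<open>d - j\<close> as long as \<open>j\<close> does not exceed the multiplicity of \<open>c\<close>.\<close>
lemma rank_drop_companion:
  fixes C :: "'a::alg_closed_field mat"
  assumes C: "C \<in> carrier_mat d d" and rk: "\<And>c. d \<le> matrix_rank (char_matrix C c) + 1"
    and \<mu>: "mat_poly C \<mu> = 0\<^sub>m d d" "degree \<mu> = d" "\<mu> \<noteq> 0" and k: "1 \<le> k" "k \<le> order c \<mu>"
  shows "rank_drop C (1\<^sub>m d) c k = 1"
proof -
  note mp = mat_poly_carrier[OF C]
  have r: "matrix_rank (mat_poly C ([:- c, 1:] ^ j)) = d - j \<and> j \<le> d" if j: "j \<le> order c \<mu>" for j
  proof -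
    obtain q where q: "\<mu> = [:- c, 1:] ^ j * q" using order_divides[of c j \<mu>] j unfolding dvd_def by blast
    have q0: "q \<noteq> 0" using q \<mu>(3) by auto
    have deg: "d = j + degree q" unfolding \<mu>(2)[symmetric] q using q0 by (subst degree_mult_eq) (auto simp: degree_power_eq)
    have "matrix_rank (mat_poly C ([:- c, 1:] ^ j) * 1\<^sub>m d) + matrix_rank (1\<^sub>m d * mat_poly C q)
       \<le> matrix_rank (1\<^sub>m d :: 'a mat) + matrix_rank (mat_poly C ([:- c, 1:] ^ j) * (1\<^sub>m d * mat_poly C q))"
      by (rule frobenius_rank_inequality[OF mp one_carrier_mat mp])
    then have "matrix_rank (mat_poly C ([:- c, 1:] ^ j)) + matrix_rank (mat_poly C q) \<le> d + matrix_rank (mat_poly C \<mu>)"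
      unfolding q mat_poly_mult[OF C] right_mult_one_mat[OF mp] left_mult_one_mat[OF mp] by simp
    moreover have "d \<le> matrix_rank (mat_poly C ([:- c, 1:] ^ j)) + degree ([:- c, 1:] ^ j)"
      by (rule matrix_rank_mat_poly_ge[OF C rk]) auto
    moreover have "d \<le> matrix_rank (mat_poly C q) + degree q" by (rule matrix_rank_mat_poly_ge[OF C rk q0])
    ultimately show ?thesis unfolding \<mu>(1) using deg by (simp add: degree_power_eq)
  qed
  show ?thesis unfolding rank_drop_def right_mult_one_mat[OF mp] using r[of k] r[of "k - 1"] k by simp
qed

text \<open>On the image of \<open>e\<close>, where \<open>\<mu>(A)\<close> vanishes, the powers \<open>(A - c)^(k - 1)\<close> and \<open>(A - c)^k\<close> have the same image,
  because \<open>(X - c)^(k - 1)\<close> lies in the ideal generated by \<open>(X - c)^k\<close> and \<open>\<mu>\<close>.\<close>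
lemma rank_drop_zero_beyond_order:
  fixes A e :: "'a::field mat"
  assumes A: "A \<in> carrier_mat n n" and e: "e \<in> carrier_mat n n" and \<mu>: "mat_poly A \<mu> * e = 0\<^sub>m n n" "\<mu> \<noteq> 0"
    and k: "order c \<mu> < k"
  shows "rank_drop A e c k = 0"
proof -
  note mp = mat_poly_carrier[OF A]
  let ?L = "[:- c, 1:]"
  obtain g where g: "\<mu> = ?L ^ order c \<mu> * g" "\<not> ?L dvd g" using order_decomp[OF \<mu>(2)] by blast
  have "poly g c \<noteq> 0" using g(2) by (simp add: poly_eq_0_iff_dvd)
  then obtain u v where uv: "u * ?L ^ 1 + v * g = 1" using bezout_linear_power by blast
  have "?L ^ (k - 1) = u * ?L ^ k + v * ?L ^ (k - 1 - order c \<mu>) * \<mu>"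
  proof -
    have k1: "k = Suc (k - 1)" using k by simp
    have "?L ^ (k - 1) = ?L ^ (k - 1) * (u * ?L ^ 1 + v * g)" unfolding uv by simp
    also have "\<dots> = u * ?L ^ k + v * (?L ^ (k - 1) * g)"
      by (subst k1, simp only: power_Suc power_one_right distrib_left) (simp only: ac_simps)
    also have "?L ^ (k - 1) * g = ?L ^ (k - 1 - order c \<mu>) * (?L ^ order c \<mu> * g)"
      using k by (simp flip: power_add mult.assoc)
    finally show ?thesis unfolding g(1)[symmetric] by (simp only: ac_simps)
  qed
  then have "mat_poly A (?L ^ (k - 1)) * e = (mat_poly A u * mat_poly A (?L ^ k) + mat_poly A (v * ?L ^ (k - 1 - order c \<mu>)) * mat_poly A \<mu>) * e"
    by (simp only: mat_poly_add[OF A] mat_poly_mult[OF A])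
  also have "\<dots> = mat_poly A u * (mat_poly A (?L ^ k) * e) + mat_poly A (v * ?L ^ (k - 1 - order c \<mu>)) * (mat_poly A \<mu> * e)"
    using add_mult_distrib_mat[OF mult_carrier_mat[OF mp mp] mult_carrier_mat[OF mp mp] e] assoc_mult_mat[OF mp mp e] by simp
  also have "\<dots> = mat_poly A u * (mat_poly A (?L ^ k) * e)"
    unfolding \<mu>(1) using right_mult_zero_mat[OF mp] mult_carrier_mat[OF mp mult_carrier_mat[OF mp e]] by simp
  finally have "matrix_rank (mat_poly A (?L ^ (k - 1)) * e) \<le> matrix_rank (mat_poly A (?L ^ k) * e)"
    using matrix_rank_mult_le_right[OF mp mult_carrier_mat[OF mp e]] by simp
  then show ?thesis by (simp add: rank_drop_def)
qed

text \<open>The maps \<open>R\<close> and \<open>L\<close> identify the image of the idempotent \<open>R * L\<close> with the space on which \<open>C\<close> acts.\<close>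
lemma rank_drop_summand:
  fixes A R L C :: "'a::field mat"
  assumes A: "A \<in> carrier_mat n n" and R: "R \<in> carrier_mat n d" and L: "L \<in> carrier_mat d n" and C: "C \<in> carrier_mat d d"
    and LR: "L * R = 1\<^sub>m d" and AR: "A * R = R * C"
  shows "rank_drop A (R * L) c k = rank_drop C (1\<^sub>m d) c k"
proof -
  note mA = mat_poly_carrier[OF A] and mC = mat_poly_carrier[OF C]
  have "matrix_rank (mat_poly A p * (R * L)) = matrix_rank (mat_poly C p)" for p
  proof (rule antisym)
    have AR': "mat_poly A p * R = R * mat_poly C p" by (rule mat_poly_intertwine[OF C R A AR[symmetric], symmetric])
    have eq: "mat_poly A p * (R * L) = R * (mat_poly C p * L)"
      unfolding assoc_mult_mat[OF mA R L, symmetric] AR' by (rule assoc_mult_mat[OF R mC L])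
    have "matrix_rank (R * (mat_poly C p * L)) \<le> matrix_rank (mat_poly C p * L)"
      by (rule matrix_rank_mult_le_right[OF R mult_carrier_mat[OF mC L]])
    also have "\<dots> \<le> matrix_rank (mat_poly C p)" by (rule matrix_rank_mult_le_left[OF mC L])
    finally show "matrix_rank (mat_poly A p * (R * L)) \<le> matrix_rank (mat_poly C p)" unfolding eq .
    have "L * (mat_poly A p * (R * L)) = L * R * (mat_poly C p * L)"
      unfolding eq by (rule assoc_mult_mat[OF L R mult_carrier_mat[OF mC L], symmetric])
    also have "\<dots> = mat_poly C p * L" unfolding LR by (rule left_mult_one_mat[OF mult_carrier_mat[OF mC L]])
    finally have "L * (mat_poly A p * (R * L)) * R = mat_poly C p * (L * R)"
      using assoc_mult_mat[OF mC L R] by simp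
    then have e: "mat_poly C p = L * (mat_poly A p * (R * L)) * R"
      unfolding LR right_mult_one_mat[OF mC] by (rule sym)
    have m: "mat_poly A p * (R * L) \<in> carrier_mat n n" using mult_carrier_mat[OF mA mult_carrier_mat[OF R L]] .
    have "matrix_rank (mat_poly C p) \<le> matrix_rank (L * (mat_poly A p * (R * L)))"
      by (subst e, rule matrix_rank_mult_le_left[OF mult_carrier_mat[OF L m] R])
    also have "\<dots> \<le> matrix_rank (mat_poly A p * (R * L))" by (rule matrix_rank_mult_le_right[OF L m])
    finally show "matrix_rank (mat_poly C p) \<le> matrix_rank (mat_poly A p * (R * L))" .
  qed
  then show ?thesis unfolding rank_drop_def right_mult_one_mat[OF mC] by simp
qed

section \<open>Decomposition into cyclic summands\<close>

text \<open>Here \<open>p\<close> and \<open>q\<close> are the largest block sizes of two eigenvalues. Intertwining forces them to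
  differ by at most one, and it survives when one largest block is removed on either side: lowering both
  sides of an inequality by one preserves it, and when only the smaller sequence is lowered there
  is nothing to show. When only the larger one is lowered, the smaller one is already zero.\<close>
lemma intertwined_remove:
  assumes uv: "intertwined u v"
    and u: "\<And>k. k \<ge> 1 \<Longrightarrow> u k = (if k \<le> p then 1 else 0) + u' k" "\<And>k. p < k \<Longrightarrow> u k = 0"
    and v: "\<And>k. k \<ge> 1 \<Longrightarrow> v k = (if k \<le> q then 1 else 0) + v' k" "\<And>k. q < k \<Longrightarrow> v k = 0"
  shows "intertwined u' v'" "p \<le> q + 1" "q \<le> p + 1"
proof -
  have half: "g' (k + 1) \<le> f' k"
    if "g (k + 1) \<le> f k" and k: "k \<ge> 1"
      and "\<And>k. k \<ge> 1 \<Longrightarrow> f k = (if k \<le> a then 1 else 0) + f' k" "\<And>k. a < k \<Longrightarrow> f k = 0"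
      and "\<And>k. k \<ge> 1 \<Longrightarrow> g k = (if k \<le> b then 1 else 0) + g' k" "\<And>k. b < k \<Longrightarrow> g k = 0"
    for f g f' g' :: "nat \<Rightarrow> nat" and a b k :: nat
  proof (cases "k + 1 \<le> b")
    case True
    show ?thesis
      using that(1) that(3)[OF k] that(5)[of "k + 1"] True by (simp split: if_splits)
  next
    case False
    then have "g' (k + 1) = 0" using that(5)[of "k + 1"] that(6)[of "k + 1"] by simp
    then show ?thesis by simp
  qed
  show "intertwined u' v'"
    unfolding intertwined_def
  proof (intro allI impI conjI)
    fix k :: nat assume k: "k \<ge> 1"
    show "v' (k + 1) \<le> u' k" by (rule half[of v k u p u' q v']) (use uv k u v in \<open>auto simp: intertwined_def\<close>)
    show "u' (k + 1) \<le> v' k" by (rule half[of u k v q v' p u']) (use uv k u v in \<open>auto simp: intertwined_def\<close>)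
  qed
  show "p \<le> q + 1"
  proof (rule ccontr)
    assume "\<not> p \<le> q + 1"
    then have "u (q + 1 + 1) \<ge> 1" "v (q + 1) = 0" using u(1)[of "q + 1 + 1"] v(2)[of "q + 1"] by simp_all
    moreover have "u (q + 1 + 1) \<le> v (q + 1)" using uv unfolding intertwined_def by simp
    ultimately show False by simp
  qed
  show "q \<le> p + 1"
  proof (rule ccontr)
    assume "\<not> q \<le> p + 1"
    then have "v (p + 1 + 1) \<ge> 1" "u (p + 1) = 0" using v(1)[of "p + 1 + 1"] u(2)[of "p + 1"] by simp_all
    moreover have "v (p + 1 + 1) \<le> u (p + 1)" using uv unfolding intertwined_def by simp
    ultimately show False by simp
  qed
qed

text \<open>Removing, for each eigenvalue \<open>c\<close>, one block of the largest size \<open>m c\<close> preserves the spectral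
  conditions. The conditions also constrain the sizes \<open>m c\<close> themselves, in the way that is needed to
  decompose the removed cyclic summand.\<close>
lemma balanced_remove:
  fixes \<alpha> \<beta> :: "'b::field"
  assumes bal: "balanced \<alpha> \<beta> \<nu>"
    and \<nu>: "\<And>c k. k \<ge> 1 \<Longrightarrow> \<nu> c k = (if k \<le> m c then 1 else 0) + \<nu>' c k" "\<And>c k. m c < k \<Longrightarrow> \<nu> c k = 0"
  shows "balanced \<alpha> \<beta> \<nu>'"
    and "m 0 \<le> m (\<alpha> + \<beta>) + 1" "m (\<alpha> + \<beta>) \<le> m 0 + 1" "m \<alpha> \<le> m \<beta> + 1" "m \<beta> \<le> m \<alpha> + 1"
    and "\<And>c. c \<notin> {0, \<alpha>, \<beta>, \<alpha> + \<beta>} \<Longrightarrow> m (\<alpha> + \<beta> - c) = m c"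
    and "(2::'b) \<noteq> 0 \<Longrightarrow> even (m ((\<alpha> + \<beta>) / 2))"
proof -
  have 1: "intertwined (\<nu> 0) (\<nu> (\<alpha> + \<beta>))" and 2: "intertwined (\<nu> \<alpha>) (\<nu> \<beta>)"
    and 3: "\<And>c k. c \<notin> {0, \<alpha>, \<beta>, \<alpha> + \<beta>} \<Longrightarrow> k \<ge> 1 \<Longrightarrow> \<nu> c k = \<nu> (\<alpha> + \<beta> - c) k"
    and 4: "\<And>k. (2::'b) \<noteq> 0 \<Longrightarrow> \<nu> ((\<alpha> + \<beta>) / 2) (2 * k + 1) = \<nu> ((\<alpha> + \<beta>) / 2) (2 * k + 2)"
    using bal unfolding balanced_def by blast+
  note i1 = intertwined_remove[OF 1 \<nu> \<nu>] and i2 = intertwined_remove[OF 2 \<nu> \<nu>]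
  show "m 0 \<le> m (\<alpha> + \<beta>) + 1" "m (\<alpha> + \<beta>) \<le> m 0 + 1" "m \<alpha> \<le> m \<beta> + 1" "m \<beta> \<le> m \<alpha> + 1"
    using i1(2,3) i2(2,3) by blast+
  have le: "m c \<le> m c'" if "\<And>k. k \<ge> 1 \<Longrightarrow> \<nu> c k = \<nu> c' k" for c c'
  proof (rule ccontr)
    assume "\<not> m c \<le> m c'"
    then have "\<nu> c (m c) \<ge> 1" "\<nu> c' (m c) = 0" "m c \<ge> 1" using \<nu>(1)[of "m c" c] \<nu>(2)[of c' "m c"] by simp_all
    then show False using that[of "m c"] by simp
  qed
  show sym: "m (\<alpha> + \<beta> - c) = m c" if c: "c \<notin> {0, \<alpha>, \<beta>, \<alpha> + \<beta>}" for c
    using le[of c "\<alpha> + \<beta> - c"] le[of "\<alpha> + \<beta> - c" c] 3[OF c] by fastforce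
  show even: "even (m ((\<alpha> + \<beta>) / 2))" if two: "(2::'b) \<noteq> 0"
  proof (rule ccontr)
    let ?h = "(\<alpha> + \<beta>) / 2"
    assume "odd (m ?h)"
    then obtain j where j: "m ?h = 2 * j + 1" by (auto elim: oddE)
    then have "\<nu> ?h (2 * j + 1) \<ge> 1" "\<nu> ?h (2 * j + 2) = 0" using \<nu>(1)[of "2 * j + 1" ?h] \<nu>(2)[of ?h "2 * j + 2"] by simp_all
    then show False using 4[OF two, of j] by simp
  qed
  have "\<nu>' c k = \<nu>' (\<alpha> + \<beta> - c) k" if "c \<notin> {0, \<alpha>, \<beta>, \<alpha> + \<beta>}" "k \<ge> 1" for c k
    using 3[OF that] \<nu>(1)[OF that(2), of c] \<nu>(1)[OF that(2), of "\<alpha> + \<beta> - c"] sym[OF that(1)] by simp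
  moreover have "\<nu>' ((\<alpha> + \<beta>) / 2) (2 * k + 1) = \<nu>' ((\<alpha> + \<beta>) / 2) (2 * k + 2)" if two: "(2::'b) \<noteq> 0" for k
  proof -
    obtain j where "m ((\<alpha> + \<beta>) / 2) = 2 * j" using even[OF two] by (auto elim: evenE)
    then have "2 * k + 1 \<le> m ((\<alpha> + \<beta>) / 2) \<longleftrightarrow> 2 * k + 2 \<le> m ((\<alpha> + \<beta>) / 2)" by presburger
    then show ?thesis
      using 4[OF two, of k] \<nu>(1)[of "2 * k + 1" "(\<alpha> + \<beta>) / 2"] \<nu>(1)[of "2 * k + 2" "(\<alpha> + \<beta>) / 2"] by simp
  qed
  ultimately show "balanced \<alpha> \<beta> \<nu>'" using i1(1) i2(1) unfolding balanced_def by blast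
qed

lemma idempotent_sum:
  fixes P1 P2 e1 e2 :: "'a::field mat"
  assumes c: "e1 \<in> carrier_mat n n" "e2 \<in> carrier_mat n n" "P1 \<in> carrier_mat n n" "P2 \<in> carrier_mat n n"
    and o: "e1 * e2 = 0\<^sub>m n n" "e2 * e1 = 0\<^sub>m n n"
    and P: "P1 * P1 = P1" "P2 * P2 = P2" "e1 * P1 = P1" "P1 * e1 = P1" "e2 * P2 = P2" "P2 * e2 = P2"
  shows "(P1 + P2) * (P1 + P2) = P1 + P2"
proof -
  have "P1 * P2 = (P1 * e1) * (e2 * P2)" using P by simp
  also have "\<dots> = P1 * ((e1 * e2) * P2)" using c by (simp add: assoc_mult_mat[of _ n n _ n _ n] mult_carrier_mat[of _ n n _ n])
  finally have 1: "P1 * P2 = 0\<^sub>m n n" using o c by simp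
  have "P2 * P1 = (P2 * e2) * (e1 * P1)" using P by simp
  also have "\<dots> = P2 * ((e2 * e1) * P1)" using c by (simp add: assoc_mult_mat[of _ n n _ n _ n] mult_carrier_mat[of _ n n _ n])
  finally have 2: "P2 * P1 = 0\<^sub>m n n" using o c by simp
  show ?thesis using c 1 2 P by (simp add: mult_add_distrib_mat[of _ n n _ n] add_mult_distrib_mat[of _ n n _ _ n])
qed

text \<open>The idempotent \<open>e\<close> stands for the invariant summand that is still to be decomposed. A cyclic summand
  whose polynomial \<open>\<mu>\<close> is the minimal polynomial is split off; over the closure it takes away one block of the
  largest size for each eigenvalue, so its root multiplicities satisfy the conditions under which
  \<open>K[X]/\<mu>\<close> carries explicit idempotents, and the complement satisfies the spectral conditions again. The
  idempotents obtained on the two summands are added.\<close>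
lemma balanced_imp_composite_on_summand:
  fixes A e :: "'a::field mat" and \<alpha> \<beta> :: 'a
  assumes A: "A \<in> carrier_mat n n"
    and ab: "\<alpha> \<noteq> 0" "\<beta> \<noteq> 0" "\<alpha> \<noteq> \<beta>" "\<alpha> \<noteq> - \<beta>"
    and e: "e \<in> carrier_mat n n" "e * e = e" "e * A = A * e"
    and bal: "balanced (to_ac \<alpha>) (to_ac \<beta>) (rank_drop (ac_mat A) (ac_mat e))"
  shows "\<exists>P \<in> carrier_mat n n. \<exists>Q \<in> carrier_mat n n. P * P = P \<and> Q * Q = Q \<and> A * e = \<alpha> \<cdot>\<^sub>m P + \<beta> \<cdot>\<^sub>m Q
     \<and> e * P = P \<and> P * e = P \<and> e * Q = Q \<and> Q * e = Q"
  using e bal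
proof (induction "matrix_rank e" arbitrary: e rule: less_induct)
  case less
  note e = less.prems(1) and ee = less.prems(2) and eA = less.prems(3) and bal = less.prems(4)
  show ?case
  proof (cases "e = 0\<^sub>m n n")
    case True
    have "\<alpha> \<cdot>\<^sub>m 0\<^sub>m n n + \<beta> \<cdot>\<^sub>m 0\<^sub>m n n = (0\<^sub>m n n :: 'a mat)" by (intro eq_matI) auto
    then show ?thesis using A unfolding True by (intro bexI[of _ "0\<^sub>m n n"]) auto
  next
    case False
    obtain \<mu> R L where deg: "degree \<mu> > 0" and R: "R \<in> carrier_mat n (degree \<mu>)" and L: "L \<in> carrier_mat (degree \<mu>) n"
      and LR: "L * R = 1\<^sub>m (degree \<mu>)" and AR: "A * R = R * companion \<mu>" and LA: "L * A = companion \<mu> * L"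
      and eR: "e * R = R" and Le: "L * e = L" and \<mu>e: "mat_poly A \<mu> * e = 0\<^sub>m n n"
      using cyclic_summand[OF A e ee eA False] by blast
    let ?d = "degree \<mu>"
    define C where "C = companion \<mu>"
    have C: "C \<in> carrier_mat ?d ?d" by (simp add: C_def)
    have \<mu>0: "\<mu> \<noteq> 0" using deg by auto
    note AR = AR[folded C_def] and LA = LA[folded C_def]
    define e1 where "e1 = R * L"
    define e2 where "e2 = e - e1"
    have e1: "e1 \<in> carrier_mat n n" using R L by (simp add: e1_def)
    have e2: "e2 \<in> carrier_mat n n" using e1 by (simp add: e2_def minus_carrier_mat)
    have sum: "e = e1 + e2" using e e1 by (intro eq_matI) (auto simp: e2_def)
    have ee1: "e * e1 = e1" unfolding e1_def using assoc_mult_mat[OF e R L] eR by simp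
    have e1e: "e1 * e = e1" unfolding e1_def using assoc_mult_mat[OF R L e] Le by simp
    have LR1: "L * (R * M) = M" if "M \<in> carrier_mat ?d k" for M k
      using assoc_mult_mat[OF L R that] LR that by simp
    have e1e1: "e1 * e1 = e1"
      unfolding e1_def using assoc_mult_mat[OF R L mult_carrier_mat[OF R L]] LR1[OF L] by simp
    have e1A: "e1 * A = A * e1"
    proof -
      have "e1 * A = R * (C * L)" unfolding e1_def LA[symmetric] by (rule assoc_mult_mat[OF R L A])
      also have "\<dots> = A * R * L" unfolding AR by (rule assoc_mult_mat[OF R C L, symmetric])
      also have "\<dots> = A * e1" unfolding e1_def by (rule assoc_mult_mat[OF A R L])
      finally show ?thesis .
    qed
    have self: "M - M = 0\<^sub>m n n" if "M \<in> carrier_mat n n" for M :: "'a mat" using that by (intro eq_matI) auto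
    have e12: "e1 * e2 = 0\<^sub>m n n" "e2 * e1 = 0\<^sub>m n n"
      unfolding e2_def using mult_minus_distrib_mat[OF e1 e e1] minus_mult_distrib_mat[OF e e1 e1] by (simp_all add: ee1 e1e e1e1 self[OF e1])
    have ee2: "e * e2 = e2" "e2 * e = e2"
      unfolding e2_def using mult_minus_distrib_mat[OF e e e1] minus_mult_distrib_mat[OF e e1 e] by (simp_all add: ee ee1 e1e)
    have e2e2: "e2 * e2 = e2"
    proof -
      have "e * e2 = e1 * e2 + e2 * e2" by (subst sum, rule add_mult_distrib_mat[OF e1 e2 e2])
      then show ?thesis unfolding ee2 e12 using e2 by simp
    qed
    have e2A: "e2 * A = A * e2"
      unfolding e2_def minus_mult_distrib_mat[OF e e1 A] mult_minus_distrib_mat[OF A e e1] eA e1A ..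
    have \<mu>e1: "mat_poly A \<mu> * e1 = 0\<^sub>m n n"
    proof -
      have "mat_poly A \<mu> * e1 = mat_poly A \<mu> * (e * e1)" unfolding ee1 ..
      also have "\<dots> = mat_poly A \<mu> * e * e1" by (rule assoc_mult_mat[OF mat_poly_carrier[OF A] e e1, symmetric])
      finally show ?thesis unfolding \<mu>e using e1 by simp
    qed
    have "matrix_rank e2 < matrix_rank e"
    proof -
      have "matrix_rank (1\<^sub>m n * (e1 + e2)) = matrix_rank (1\<^sub>m n * e1) + matrix_rank (1\<^sub>m n * e2)"
        by (rule matrix_rank_split_idempotent[of _ n]) (use e1 e2 e1e1 e2e2 e12 in auto)
      then have "matrix_rank e = matrix_rank e1 + matrix_rank e2" using e1 e2 sum by simp
      moreover have "?d \<le> matrix_rank e1"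
      proof -
        have "L * e1 * R = 1\<^sub>m ?d"
          unfolding e1_def using LR1[OF L] LR by simp
        then have "?d = matrix_rank (L * e1 * R)" by simp
        also have "\<dots> \<le> matrix_rank (L * e1)" by (rule matrix_rank_mult_le_left[OF mult_carrier_mat[OF L e1] R])
        also have "\<dots> \<le> matrix_rank e1" by (rule matrix_rank_mult_le_right[OF L e1])
        finally show ?thesis .
      qed
      ultimately show ?thesis using deg by simp
    qed
    have ac: "ac_mat A \<in> carrier_mat n n" "ac_mat e \<in> carrier_mat n n" "ac_mat e1 \<in> carrier_mat n n" "ac_mat e2 \<in> carrier_mat n n"
      "ac_mat R \<in> carrier_mat n ?d" "ac_mat L \<in> carrier_mat ?d n" "ac_mat C \<in> carrier_mat ?d ?d"
      using A e e1 e2 R L C by simp_all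
    note acm = to_ac.mat_hom_mult[symmetric]
    define m where "m c = order c (ac_poly \<mu>)" for c
    have ac\<mu>: "ac_poly \<mu> \<noteq> 0" using \<mu>0 by simp
    have ac_\<mu>e: "mat_poly (ac_mat A) (ac_poly \<mu>) * ac_mat e = 0\<^sub>m n n"
      and ac_\<mu>e1: "mat_poly (ac_mat A) (ac_poly \<mu>) * ac_mat e1 = 0\<^sub>m n n"
      unfolding to_ac.mat_poly_hom[OF A] acm[OF mat_poly_carrier[OF A] e] acm[OF mat_poly_carrier[OF A] e1] \<mu>e \<mu>e1
      by (auto intro!: eq_matI)
    have C\<mu>: "mat_poly C \<mu> = 0\<^sub>m ?d ?d"
    proof -
      note mC = mat_poly_carrier[OF C, of \<mu>] and mA = mat_poly_carrier[OF A, of \<mu>]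
      have AR': "mat_poly A \<mu> * R = R * mat_poly C \<mu>" by (rule mat_poly_intertwine[OF C R A AR[symmetric], symmetric])
      have "mat_poly C \<mu> = L * (R * mat_poly C \<mu>)" using LR1[OF mC] by simp
      also have "\<dots> = L * (mat_poly A \<mu> * (e * R))" unfolding AR'[symmetric] eR ..
      also have "mat_poly A \<mu> * (e * R) = mat_poly A \<mu> * e * R" by (rule assoc_mult_mat[OF mA e R, symmetric])
      finally show ?thesis unfolding \<mu>e using R L by simp
    qed
    have drop1: "rank_drop (ac_mat A) (ac_mat e1) c k = (if k \<le> m c then 1 else 0)" if k: "k \<ge> 1" for c k
    proof (cases "k \<le> m c")
      case True
      have "rank_drop (ac_mat A) (ac_mat R * ac_mat L) c k = rank_drop (ac_mat C) (1\<^sub>m ?d) c k"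
        by (rule rank_drop_summand[OF ac(1,5,6,7)]) (simp_all add: acm[OF L R] LR acm[OF A R] acm[OF R C] AR to_ac.mat_hom_one)
      also have "\<dots> = 1"
      proof (rule rank_drop_companion[OF ac(7), where \<mu> = "ac_poly \<mu>"])
        show "?d \<le> matrix_rank (char_matrix (ac_mat C) c) + 1" for c unfolding C_def by (rule companion_char_rank)
        show "mat_poly (ac_mat C) (ac_poly \<mu>) = 0\<^sub>m ?d ?d" unfolding to_ac.mat_poly_hom[OF C] C\<mu> by (auto intro!: eq_matI)
      qed (use ac\<mu> k True in \<open>auto simp: m_def\<close>)
      finally show ?thesis using True unfolding e1_def by (simp add: acm[OF R L])
    next
      case False
      then show ?thesis using rank_drop_zero_beyond_order[OF ac(1,3) ac_\<mu>e1 ac\<mu>, of c k] by (simp add: m_def)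
    qed
    have drop: "rank_drop (ac_mat A) (ac_mat e) c k = (if k \<le> m c then 1 else 0) + rank_drop (ac_mat A) (ac_mat e2) c k"
      if k: "k \<ge> 1" for c k
    proof -
      let ?B = "\<lambda>j. mat_poly (ac_mat A) ([:- c, 1:] ^ j)"
      have e_sum: "ac_mat e = ac_mat e1 + ac_mat e2" unfolding sum using e1 e2 by (intro eq_matI) auto
      have z: "ac_mat (0\<^sub>m n n) = 0\<^sub>m n n" by (auto intro!: eq_matI)
      have "matrix_rank (?B j * ac_mat e) = matrix_rank (?B j * ac_mat e1) + matrix_rank (?B j * ac_mat e2)" for j
        unfolding e_sum
      proof (rule matrix_rank_split_idempotent[OF mat_poly_carrier[OF ac(1)] ac(3,4)])
        show "ac_mat e1 * ?B j = ?B j * ac_mat e1"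
          by (rule mat_poly_intertwine[OF ac(1,3,1)]) (simp add: acm[OF e1 A] acm[OF A e1] e1A)
        show "ac_mat e2 * ?B j = ?B j * ac_mat e2"
          by (rule mat_poly_intertwine[OF ac(1,4,1)]) (simp add: acm[OF e2 A] acm[OF A e2] e2A)
      qed (simp_all add: acm[OF e1 e1] acm[OF e2 e2] acm[OF e1 e2] acm[OF e2 e1] e1e1 e2e2 e12 z)
      then have "rank_drop (ac_mat A) (ac_mat e) c k = rank_drop (ac_mat A) (ac_mat e1) c k + rank_drop (ac_mat A) (ac_mat e2) c k"
        using rank_power_antimono[OF ac(1,3), of "k - 1" k "[:- c, 1:]"] rank_power_antimono[OF ac(1,4), of "k - 1" k "[:- c, 1:]"]
        by (simp add: rank_drop_def)
      then show ?thesis unfolding drop1[OF k] .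
    qed
    have drop0: "rank_drop (ac_mat A) (ac_mat e) c k = 0" if "m c < k" for c k
      using rank_drop_zero_beyond_order[OF ac(1,2) ac_\<mu>e ac\<mu>] that by (simp add: m_def)
    note rem = balanced_remove[OF bal drop drop0]
    have "composite_mod \<alpha> \<beta> \<mu>"
      by (rule composite_mod_if_orders[OF ab \<mu>0, folded m_def]) (use rem(2-7) in simp_all)
    from composite_companion[OF \<mu>0 this]
    obtain P0 Q0 where PQ0: "P0 \<in> carrier_mat ?d ?d" "Q0 \<in> carrier_mat ?d ?d" "P0 * P0 = P0" "Q0 * Q0 = Q0"
      "C = \<alpha> \<cdot>\<^sub>m P0 + \<beta> \<cdot>\<^sub>m Q0" unfolding composite_def C_def by blast
    obtain P2 Q2 where PQ2: "P2 \<in> carrier_mat n n" "Q2 \<in> carrier_mat n n" "P2 * P2 = P2" "Q2 * Q2 = Q2"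
      "A * e2 = \<alpha> \<cdot>\<^sub>m P2 + \<beta> \<cdot>\<^sub>m Q2" "e2 * P2 = P2" "P2 * e2 = P2" "e2 * Q2 = Q2" "Q2 * e2 = Q2"
      using less.hyps[OF \<open>matrix_rank e2 < matrix_rank e\<close> e2 e2e2 e2A rem(1)] by blast
    define lift where "lift M = R * (M * L)" for M
    have lift: "lift M \<in> carrier_mat n n" "e1 * lift M = lift M" "lift M * e1 = lift M" if M: "M \<in> carrier_mat ?d ?d" for M
    proof -
      note MLc = mult_carrier_mat[OF M L]
      show c: "lift M \<in> carrier_mat n n" unfolding lift_def by (rule mult_carrier_mat[OF R MLc])
      show "e1 * lift M = lift M"
        unfolding e1_def assoc_mult_mat[OF R L c] unfolding lift_def LR1[OF MLc] ..
      show "lift M * e1 = lift M"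
        unfolding lift_def e1_def assoc_mult_mat[OF R MLc mult_carrier_mat[OF R L]] assoc_mult_mat[OF M L mult_carrier_mat[OF R L]] LR1[OF L] ..
    qed
    have lift_idem: "lift M * lift M = lift M" if M: "M \<in> carrier_mat ?d ?d" and MM: "M * M = M" for M
    proof -
      note MLc = mult_carrier_mat[OF M L]
      have "lift M * lift M = R * (M * (L * (R * (M * L))))"
        unfolding lift_def assoc_mult_mat[OF R MLc mult_carrier_mat[OF R MLc]] assoc_mult_mat[OF M L mult_carrier_mat[OF R MLc]] ..
      also have "\<dots> = R * (M * M * L)" unfolding LR1[OF MLc] assoc_mult_mat[OF M M L] ..
      finally show ?thesis unfolding MM lift_def .
    qed
    have Ae1: "A * e1 = \<alpha> \<cdot>\<^sub>m lift P0 + \<beta> \<cdot>\<^sub>m lift Q0"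
    proof -
      have "A * e1 = e1 * A" by (rule e1A[symmetric])
      also have "\<dots> = R * (C * L)" unfolding e1_def LA[symmetric] by (rule assoc_mult_mat[OF R L A])
      also have "C * L = \<alpha> \<cdot>\<^sub>m (P0 * L) + \<beta> \<cdot>\<^sub>m (Q0 * L)"
        unfolding PQ0(5) using PQ0(1,2) L by (simp add: add_mult_distrib_mat[of _ ?d ?d _ _ n] mult_smult_assoc_mat[of _ ?d ?d _ n])
      also have "R * \<dots> = \<alpha> \<cdot>\<^sub>m lift P0 + \<beta> \<cdot>\<^sub>m lift Q0"
        unfolding lift_def using mult_carrier_mat[OF PQ0(1) L] mult_carrier_mat[OF PQ0(2) L] R
        by (simp add: mult_add_distrib_mat[of _ n ?d _ n] mult_smult_distrib[of _ n ?d _ n])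
      finally show ?thesis .
    qed
    have absorb: "e * (lift M + N) = lift M + N" "(lift M + N) * e = lift M + N"
      if M: "M \<in> carrier_mat ?d ?d" and N: "N \<in> carrier_mat n n" "e2 * N = N" "N * e2 = N" for M N
    proof -
      have "e * lift M = e * e1 * lift M" using assoc_mult_mat[OF e e1 lift(1)[OF M]] lift(2)[OF M] by simp
      then have 1: "e * lift M = lift M" unfolding ee1 lift(2)[OF M] .
      have "lift M * e = lift M * (e1 * e)" using assoc_mult_mat[OF lift(1)[OF M] e1 e] lift(3)[OF M] by simp
      then have 2: "lift M * e = lift M" unfolding e1e lift(3)[OF M] .
      have "e * N = e * e2 * N" using assoc_mult_mat[OF e e2 N(1)] N(2) by simp
      then have 3: "e * N = N" unfolding ee2 N(2) .
      have "N * e = N * (e2 * e)" using assoc_mult_mat[OF N(1) e2 e] N(3) by simp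
      then have 4: "N * e = N" unfolding ee2 N(3) .
      show "e * (lift M + N) = lift M + N" unfolding mult_add_distrib_mat[OF e lift(1)[OF M] N(1)] 1 3 ..
      show "(lift M + N) * e = lift M + N" unfolding add_mult_distrib_mat[OF lift(1)[OF M] N(1) e] 2 4 ..
    qed
    show ?thesis
    proof (intro bexI conjI)
      show "A * e = \<alpha> \<cdot>\<^sub>m (lift P0 + P2) + \<beta> \<cdot>\<^sub>m (lift Q0 + Q2)"
      proof -
        have "A * e = (\<alpha> \<cdot>\<^sub>m lift P0 + \<beta> \<cdot>\<^sub>m lift Q0) + (\<alpha> \<cdot>\<^sub>m P2 + \<beta> \<cdot>\<^sub>m Q2)"
          unfolding Ae1[symmetric] PQ2(5)[symmetric] by (subst sum, rule mult_add_distrib_mat[OF A e1 e2])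
        also have "\<dots> = \<alpha> \<cdot>\<^sub>m (lift P0 + P2) + \<beta> \<cdot>\<^sub>m (lift Q0 + Q2)"
          using lift(1)[OF PQ0(1)] lift(1)[OF PQ0(2)] PQ2(1,2) by (intro eq_matI) (auto simp: algebra_simps)
        finally show ?thesis .
      qed
      show "(lift P0 + P2) * (lift P0 + P2) = lift P0 + P2"
        by (rule idempotent_sum[OF e1 e2 lift(1)[OF PQ0(1)] PQ2(1) e12 lift_idem[OF PQ0(1,3)] PQ2(3) lift(2,3)[OF PQ0(1)] PQ2(6,7)])
      show "(lift Q0 + Q2) * (lift Q0 + Q2) = lift Q0 + Q2"
        by (rule idempotent_sum[OF e1 e2 lift(1)[OF PQ0(2)] PQ2(2) e12 lift_idem[OF PQ0(2,4)] PQ2(4) lift(2,3)[OF PQ0(2)] PQ2(8,9)])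
      show "lift P0 + P2 \<in> carrier_mat n n" "lift Q0 + Q2 \<in> carrier_mat n n"
        using PQ2(1,2) by simp_all
    qed (use absorb[OF PQ0(1) PQ2(1,6,7)] absorb[OF PQ0(2) PQ2(2,8,9)] in auto)
  qed
qed

theorem theorem7:
  fixes A :: "'a :: field mat" and \<alpha> \<beta> :: 'a and n :: nat
  assumes "n \<ge> 1" and "A \<in> carrier_mat n n"
    and "\<alpha> \<noteq> 0" and "\<beta> \<noteq> 0" and "\<alpha> \<noteq> \<beta>" and "\<alpha> \<noteq> - \<beta>"
  shows "composite n \<alpha> \<beta> A \<longleftrightarrow>
    intertwined (num_blocks_ge A 0) (num_blocks_ge A (to_ac (\<alpha> + \<beta>))) \<and>
    intertwined (num_blocks_ge A (to_ac \<alpha>)) (num_blocks_ge A (to_ac \<beta>)) \<and>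
    (\<forall>\<mu>. \<mu> \<notin> {0, to_ac \<alpha>, to_ac \<beta>, to_ac (\<alpha> + \<beta>)} \<longrightarrow>
       (\<forall>k\<ge>1. num_blocks_eq A \<mu> k = num_blocks_eq A (to_ac (\<alpha> + \<beta>) - \<mu>) k)) \<and>
    (CHAR('a) \<noteq> 2 \<longrightarrow> (\<forall>k. num_blocks_eq A (to_ac ((\<alpha> + \<beta>) / 2)) (2 * k + 1) = 0))"
  unfolding blocks_conditions_iff_balanced[OF assms(2)]
proof
  note A = assms(2) and ab = assms(3-6)
  have "to_ac \<alpha> \<noteq> - to_ac \<beta>" using ab(4) by (metis to_ac_eq_iff to_ac_minus)
  with ab have ac: "to_ac \<alpha> \<noteq> 0" "to_ac \<beta> \<noteq> 0" "to_ac \<alpha> \<noteq> to_ac \<beta>" "to_ac \<alpha> \<noteq> - to_ac \<beta>" by simp_all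
  assume "composite n \<alpha> \<beta> A"
  from composite_imp_balanced[OF ac composite_ac_mat[OF this]]
  show "balanced (to_ac \<alpha>) (to_ac \<beta>) (rank_drop (ac_mat A) (1\<^sub>m n))" .
next
  note A = assms(2) and ab = assms(3-6)
  assume bal: "balanced (to_ac \<alpha>) (to_ac \<beta>) (rank_drop (ac_mat A) (1\<^sub>m n))"
  have "\<exists>P \<in> carrier_mat n n. \<exists>Q \<in> carrier_mat n n. P * P = P \<and> Q * Q = Q \<and> A * 1\<^sub>m n = \<alpha> \<cdot>\<^sub>m P + \<beta> \<cdot>\<^sub>m Q
     \<and> 1\<^sub>m n * P = P \<and> P * 1\<^sub>m n = P \<and> 1\<^sub>m n * Q = Q \<and> Q * 1\<^sub>m n = Q"
    by (rule balanced_imp_composite_on_summand[OF A ab]) (use A bal in \<open>auto simp: to_ac.mat_hom_one\<close>)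
  then show "composite n \<alpha> \<beta> A" unfolding composite_def using A by auto
qed

end
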